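(* Let $d\ge1$, $\alpha\ge1$, $t_{\mathrm{fin}}\in(0,\infty)$, and let $(\chi_N)_{N\ge1}$ be any sequence of positive numbers with $\chi_N\to0$. Fix $a\in(0,\infty)$, and let $\eta^N_\bullet$ be the rescaled zero-range process with parameter $\alpha$ and initial data $\eta^N_0\sim\Pi^N_a$. Then, for all $\delta>0$, $$\limsup_{\epsilon\to0}\limsup_{N\to\infty}\frac{\chi_N}{N^d}\log\mathbb{P}_{\Pi^N_a}\left(\int_0^{t_{\mathrm{fin}}}\frac1{N^d}\sum_{x\in\mathbb{T}^d_N}V^N_\alpha(\eta^N_t,\epsilon,x)\,dt>\delta\right)=-\infty,$$ where $$V^N_\alpha(\eta^N,\epsilon,x):=\left|(\eta^N(x))^\alpha-(\overline{\eta}^{N,N\epsilon}(x))^\alpha\right|.$$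
   Context: **Process.** $\mathbb{T}^d_N=\{0,\frac1N,\dots,\frac{N-1}N\}^d$ is the discrete torus. The state space is $X_N=(\chi_N\mathbb{N})^{\mathbb{T}^d_N}$ with $\mathbb N=\{0,1,2,\dots\}$. The rescaled zero-range process with parameter $\alpha$ is the continuous-time Markov process on $X_N$ with generator $N^2\mathcal{L}_N$, $$\mathcal{L}_NF(\eta^N)=\frac12\sum_{x\sim y}\frac{(\eta^N(x))^\alpha}{\chi_N}\left(F(\eta^{N,x,y})-F(\eta^N)\right),$$ where the sum runs over all directed nearest-neighbour edges $(x,y)$, $y=x\pm e_i/N$, of $\mathbb{T}^d_N$ ($2d$ per site $x$), and $\eta^{N,x,y}=\eta^N+\chi_N1_y-\chi_N1_x$. **Equilibrium measure.** For $a>0$, $\Pi^N_a$ is the product probability measure on $X_N$ $$\Pi^N_a(\eta^N)=\prod_{x\in\mathbb{T}^d_N}\frac{(a/\chi_N)^{\alpha\eta^N(x)/\chi_N}}{((\eta^N(x)/\chi_N)!)^\alpha\,Z_\alpha(a/\chi_N)},$$ with $Z_\alpha$ the normalisation constant; it is reversible for the process. $\mathbb{P}_{\Pi^N_a}$ is the law of the process started from $\eta^N_0\sim\Pi^N_a$. **Local averages.** For $\epsilon>0$, $$\overline{\eta}^{N,N\epsilon}(x):=\frac1{(2\lfloor\epsilon N\rfloor+1)^d}\sum_{y\in B_{\lfloor\epsilon N\rfloor}(x)}\eta^N(y),$$ where $B_L(x)\subset\mathbb{T}^d_N$ is the lattice box with $2L+1$ sites per side centred at $x$. *)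

theory Defs
  imports "HOL-Probability.Probability"
begin

text \<open>
  A transition semigroup on the discrete state space \<^term>\<open>E\<close> with generator \<^term>\<open>G\<close>:
  the pmf \<^term>\<open>P t x\<close> is the law at time \<^term>\<open>t\<close> of the process started at \<^term>\<open>x\<close>.
  Taking for \<^term>\<open>F\<close> indicator functions of points, the last condition says that the
  Q-matrix of the semigroup is the one determined by \<^term>\<open>G\<close>.
\<close>

definition markov_semigroup ::
  "'s set \<Rightarrow> (('s \<Rightarrow> real) \<Rightarrow> 's \<Rightarrow> real) \<Rightarrow> (real \<Rightarrow> 's \<Rightarrow> 's pmf) \<Rightarrow> bool" where
  "markov_semigroup E G P \<longleftrightarrow>
     (\<forall>t\<ge>0. \<forall>x\<in>E. set_pmf (P t x) \<subseteq> E) \<and>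
     (\<forall>x\<in>E. P 0 x = return_pmf x) \<and>
     (\<forall>s\<ge>0. \<forall>t\<ge>0. \<forall>x\<in>E. P (s + t) x = bind_pmf (P s x) (P t)) \<and>
     (\<forall>F. bounded (F ` E) \<longrightarrow>
        (\<forall>x\<in>E. ((\<lambda>t. (measure_pmf.expectation (P t x) F - F x) / t) \<longlongrightarrow> G F x) (at_right 0)))"

text \<open>
  \<^term>\<open>X\<close> is a Markov process on \<^term>\<open>E\<close> with generator \<^term>\<open>G\<close> and initial law \<^term>\<open>\<mu>\<close>,
  realised on \<^term>\<open>M\<close>, with paths that are right-continuous with left limits for the
  discrete topology. The Markov property is conditioning on finitely many past times,
  written without division.
\<close>

definition markov_process ::
  "'w measure \<Rightarrow> 's set \<Rightarrow> (('s \<Rightarrow> real) \<Rightarrow> 's \<Rightarrow> real) \<Rightarrow> 's measure \<Rightarrow> (real \<Rightarrow> 'w \<Rightarrow> 's) \<Rightarrow> bool" where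
  "markov_process M E G \<mu> X \<longleftrightarrow>
     prob_space M \<and>
     (\<forall>t\<ge>0. X t \<in> measurable M (count_space E)) \<and>
     distr M (count_space E) (X 0) = \<mu> \<and>
     (\<forall>\<omega>\<in>space M. \<forall>t\<ge>0. \<forall>\<^sub>F s in at_right t. X s \<omega> = X t \<omega>) \<and>
     (\<forall>\<omega>\<in>space M. \<forall>t>0. \<exists>y\<in>E. \<forall>\<^sub>F s in at_left t. X s \<omega> = y) \<and>
     (\<exists>P. markov_semigroup E G P \<and>
        (\<forall>(n::nat) (\<tau>::nat \<Rightarrow> real) (x::nat \<Rightarrow> 's).
           0 \<le> \<tau> 0 \<longrightarrow> (\<forall>i\<le>n. \<tau> i \<le> \<tau> (Suc i)) \<longrightarrow> (\<forall>i\<le>Suc n. x i \<in> E) \<longrightarrow>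
           measure M {\<omega>\<in>space M. \<forall>i\<le>Suc n. X (\<tau> i) \<omega> = x i} =
           measure M {\<omega>\<in>space M. \<forall>i\<le>n. X (\<tau> i) \<omega> = x i}
             * pmf (P (\<tau> (Suc n) - \<tau> n) (x n)) (x (Suc n))))"

text \<open>
  The dimension \<open>d\<close> is \<open>CARD('d)\<close>. The torus consists of the points of \<open>[0,1)\<^sup>d\<close> with
  coordinates in \<open>{0, 1/N, ..., (N-1)/N}\<close>; translations are reduced modulo 1 coordinatewise.
\<close>

definition torus :: "nat \<Rightarrow> (real ^ 'd) set" where
  "torus N = {x. \<forall>i. \<exists>k<N. x $ i = real k / real N}"

definition wrap :: "real ^ 'd \<Rightarrow> real ^ 'd" where
  "wrap v = (\<chi> i. frac (v $ i))"

definition lattice_box :: "nat \<Rightarrow> nat \<Rightarrow> real ^ 'd \<Rightarrow> (real ^ 'd) set" where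
  "lattice_box N L x =
     {wrap (x + (1 / real N) *\<^sub>R z) | z. \<forall>i. z $ i \<in> \<int> \<and> \<bar>z $ i\<bar> \<le> real L}"

text \<open>
  In the following \<^term>\<open>c\<close> stands for the particle mass \<open>\<chi>\<^sub>N\<close>. Configurations are functions
  on all of \<^typ>\<open>real ^ 'd\<close> that vanish off the torus.
\<close>

definition config_space :: "nat \<Rightarrow> real \<Rightarrow> (real ^ 'd \<Rightarrow> real) set" where
  "config_space N c = PiE_dflt (torus N) 0 (\<lambda>_. {c * real k | k :: nat. True})"

definition jump :: "real \<Rightarrow> (real ^ 'd \<Rightarrow> real) \<Rightarrow> real ^ 'd \<Rightarrow> real ^ 'd \<Rightarrow> (real ^ 'd \<Rightarrow> real)" where
  "jump c \<eta> x y = (\<lambda>z. \<eta> z + c * indicator {y} z - c * indicator {x} z)"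

text \<open>
  If \<^term>\<open>\<eta> x = 0\<close>, then \<^term>\<open>jump c \<eta> x y\<close> may leave the configuration space, but its
  rate is 0.
\<close>

definition zrp_generator ::
  "real \<Rightarrow> nat \<Rightarrow> real \<Rightarrow> ((real ^ 'd \<Rightarrow> real) \<Rightarrow> real) \<Rightarrow> (real ^ 'd \<Rightarrow> real) \<Rightarrow> real" where
  "zrp_generator \<alpha> N c F \<eta> =
     1 / 2 * (\<Sum>x\<in>torus N. \<Sum>i\<in>UNIV. \<Sum>\<sigma>\<in>{1, -1}.
        (\<eta> x) powr \<alpha> / c * (F (jump c \<eta> x (wrap (x + (\<sigma> / real N) *\<^sub>R axis i 1))) - F \<eta>))"

definition Z_norm :: "real \<Rightarrow> real \<Rightarrow> real" where
  "Z_norm \<alpha> \<phi> = (\<Sum>n::nat. \<phi> powr (\<alpha> * real n) / (fact n) powr \<alpha>)"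

text \<open>
  On the configuration space \<^term>\<open>\<eta> x / c\<close> is a natural number, so the floor below is exact.
\<close>

definition equilibrium_weight :: "real \<Rightarrow> nat \<Rightarrow> real \<Rightarrow> real \<Rightarrow> (real ^ 'd \<Rightarrow> real) \<Rightarrow> real" where
  "equilibrium_weight \<alpha> N c a \<eta> =
     (\<Prod>x\<in>torus N. (a / c) powr (\<alpha> * \<eta> x / c) /
        ((fact (nat \<lfloor>\<eta> x / c\<rfloor>)) powr \<alpha> * Z_norm \<alpha> (a / c)))"

definition equilibrium :: "real \<Rightarrow> nat \<Rightarrow> real \<Rightarrow> real \<Rightarrow> (real ^ 'd \<Rightarrow> real) measure" where
  "equilibrium \<alpha> N c a =
     density (count_space (config_space N c)) (\<lambda>\<eta>. ennreal (equilibrium_weight \<alpha> N c a \<eta>))"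

definition equilibrium_zrp ::
  "real \<Rightarrow> nat \<Rightarrow> real \<Rightarrow> real \<Rightarrow> 'w measure \<Rightarrow> (real \<Rightarrow> 'w \<Rightarrow> (real ^ 'd \<Rightarrow> real)) \<Rightarrow> bool" where
  "equilibrium_zrp \<alpha> N c a M \<eta> \<longleftrightarrow>
     markov_process M (config_space N c) (\<lambda>F \<xi>. (real N)\<^sup>2 * zrp_generator \<alpha> N c F \<xi>)
       (equilibrium \<alpha> N c a) \<eta>"

definition local_avg :: "nat \<Rightarrow> real \<Rightarrow> (real ^ 'd \<Rightarrow> real) \<Rightarrow> real ^ 'd \<Rightarrow> real" where
  "local_avg N \<epsilon> \<eta> x =
     (let L = nat \<lfloor>\<epsilon> * real N\<rfloor>
      in 1 / (2 * real L + 1) ^ CARD('d) * (\<Sum>y\<in>lattice_box N L x. \<eta> y))"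

definition V :: "real \<Rightarrow> nat \<Rightarrow> (real ^ 'd \<Rightarrow> real) \<Rightarrow> real \<Rightarrow> real ^ 'd \<Rightarrow> real" where
  "V \<alpha> N \<eta> \<epsilon> x = \<bar>(\<eta> x) powr \<alpha> - (local_avg N \<epsilon> \<eta> x) powr \<alpha>\<bar>"

text \<open>
  The logarithm with value \<open>-\<infinity>\<close> at 0, where \<^const>\<open>ln\<close> on the reals would give 0.
\<close>

definition ext_ln :: "real \<Rightarrow> ereal" where
  "ext_ln p = (if p \<le> 0 then -\<infinity> else ereal (ln p))"

end

theory Submission
  imports Defs
begin

text \<open>
  By reversibility, a Feynman--Kac argument bounds the exponential moment of the time integral
  of \<open>\<gamma> N\<^sup>d / \<chi>\<close> times the space average of \<open>V\<close> by the largest value of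
  \<open>(\<gamma> / \<chi>) \<langle>\<Sum>\<^sub>x V\<rangle> - N\<^sup>2 D\<close>, where the mean and the Dirichlet form \<open>D\<close> are taken with respect to a
  density supported on configurations of mass at most \<open>K N\<^sup>d\<close>. This set is finite and invariant, and
  its complement has superexponentially small equilibrium probability as \<open>K\<close> grows.

  Written through the configuration \<open>\<zeta>\<close> without the jumping particle, \<open>D\<close> is a sum of the squares
  \<open>(g (\<zeta> + 1\<^sub>x) - g (\<zeta> + 1\<^sub>y))\<^sup>2\<close>, so by the triangle inequality exchanges over a distance \<open>\<epsilon> N\<close> cost at
  most \<open>(d \<epsilon> N)\<^sup>2 D\<close>. An exchange between \<open>x\<close> and \<open>y\<close> dominates the mean of
  \<open>(\<eta>(x) powr (\<alpha>/2) - \<eta>(y) powr (\<alpha>/2))\<^sup>2\<close> up to an error that vanishes with \<open>\<chi>\<close>; no relation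
  between \<open>\<chi>\<close> and \<open>N\<close> is involved. Distances of order \<open>N\<close> bound the mean of \<open>\<Sum>\<^sub>x \<eta>(x) powr \<alpha>\<close> by mass and energy,
  distances of order \<open>\<epsilon> N\<close> then bound the mean of \<open>\<Sum>\<^sub>x V\<close>.
\<close>

section \<open>Exponential Chebyshev bound for time integrals of Markov processes\<close>

text \<open>The rates \<open>(\<eta> x) powr \<alpha>\<close> are unbounded, and the process is
  given only by its finite-dimensional laws, its path regularity and the derivative of its semigroup
  at time 0. Feynman--Kac is therefore carried out on a time grid: on a finite set of states a short
  step, tilted by the exponential of the potential, is a matrix whose norm follows from its
  first-order expansion, and refining the grid returns the time integral. The obstacle in the energy
  estimate is that the mass alone does not control the mean of
  \<open>(\<eta> x) powr \<alpha>\<close> when \<alpha> > 1, since mass may concentrate on few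
  sites. Concentration costs energy, and this is why distances of order N have to be treated before
  those of order \<epsilon> N; the square of N in the generator pays exactly for the squared
  distance. The power \<alpha>/2 is the square root of the jump rate. It comes from comparing g with
  the inverse square root of the equilibrium weight, whose ratios along a jump are ratios of such
  powers. Single sites are compared directly, and convexity of \<open>u powr \<alpha>\<close> passes
  from sites to the box average.\<close>

lemma finite_range_if_piecewise_constant:
  fixes f :: "real \<Rightarrow> 's"
  assumes right: "\<And>t. 0 \<le> t \<Longrightarrow> \<forall>\<^sub>F s in at_right t. f s = f t"
    and left: "\<And>t. 0 < t \<Longrightarrow> \<exists>y. \<forall>\<^sub>F s in at_left t. f s = y"
  shows "finite (f ` {0..T})"
proof -
  \<comment> \<open>Near t the path takes at most two values, \<open>f t\<close> from t onwards and
    the left limit before t; compactness of the interval leaves finitely many such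
    neighbourhoods.\<close>
  have "\<exists>U. open U \<and> t \<in> U \<and> finite (f ` (U \<inter> {0..T}))" if t: "t \<in> {0..T}" for t
  proof -
    from right[of t] t obtain b where b: "b > t" "\<And>s. t < s \<Longrightarrow> s < b \<Longrightarrow> f s = f t"
      unfolding eventually_at_right_field by auto
    obtain a y where a: "a < t" "\<And>s. 0 \<le> s \<Longrightarrow> a < s \<Longrightarrow> s < t \<Longrightarrow> f s = y"
    proof (cases "t = 0")
      case True
      \<comment> \<open>At t = 0 the condition on earlier times is vacuous, because only nonnegative
        times count.\<close>
      show ?thesis by (rule that[of "-1" undefined]) (use True in auto)
    next
      case False
      with t left[of t] obtain y where "\<forall>\<^sub>F s in at_left t. f s = y" by auto
      then obtain a where "a < t" "\<And>s. a < s \<Longrightarrow> s < t \<Longrightarrow> f s = y"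
        unfolding eventually_at_left_field by auto
      then show ?thesis using that by blast
    qed
    have "f ` ({a<..<b} \<inter> {0..T}) \<subseteq> {y, f t}"
    proof
      fix z assume "z \<in> f ` ({a<..<b} \<inter> {0..T})"
      then obtain s where s: "z = f s" "a < s" "s < b" "0 \<le> s" by auto
      consider "s < t" | "s = t" | "t < s" by linarith
      then show "z \<in> {y, f t}" using s a(2)[of s] b(2)[of s] by cases auto
    qed
    then have "finite (f ` ({a<..<b} \<inter> {0..T}))" by (rule finite_subset) auto
    then show ?thesis using a(1) b(1) by (intro exI[of _ "{a<..<b}"]) auto
  qed
  then obtain U where U: "\<And>t. t \<in> {0..T} \<Longrightarrow> open (U t) \<and> t \<in> U t \<and> finite (f ` (U t \<inter> {0..T}))"
    by metis
  have "compact {0..T}" by simp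
  then obtain C where C: "C \<subseteq> {0..T}" "finite C" "{0..T} \<subseteq> (\<Union>t\<in>C. U t)"
    using U by (elim compactE_image[where C = "{0..T}" and f = U]) auto
  have "f ` {0..T} \<subseteq> (\<Union>t\<in>C. f ` (U t \<inter> {0..T}))" using C(3) by blast
  moreover have "finite (\<Union>t\<in>C. f ` (U t \<inter> {0..T}))" using U C by blast
  ultimately show ?thesis by (rule finite_subset)
qed

text \<open>The right end point of the grid interval containing t equals t or tends to t from the
  right, so eventual constancy to the right of t gives pointwise convergence of the step functions.
  The finite range supplies the constant majorant for dominated convergence.\<close>

lemma riemann_sums_right_continuous:
  fixes w :: "real \<Rightarrow> real"
  assumes T: "T > 0" and fin: "finite (w ` {0..T})"
    and right: "\<And>t. 0 \<le> t \<Longrightarrow> \<forall>\<^sub>F s in at_right t. w s = w t"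
  shows "(\<lambda>n. T / real n * (\<Sum>i=1..n. w (real i * (T / real n))))
           \<longlonglongrightarrow> (LINT t:{0..T}|lborel. w t)"
proof -
  \<comment> \<open>The term at 0 has integral 0; it makes the step functions converge at every
    point, including the left end of the interval.\<close>
  define g where "g n t = w 0 * indicator {0} t +
      (\<Sum>i=1..n. w (real i * (T / real n)) * indicator {(real i - 1) * (T / real n)<..real i * (T / real n)} t)"
    for n and t :: real
  define f where "f t = indicator {0..T} t *\<^sub>R w t" for t
  obtain B where B: "\<And>t. t \<in> {0..T} \<Longrightarrow> \<bar>w t\<bar> \<le> B"
    using finite_imp_bounded[OF fin] unfolding bounded_iff by (metis imageI real_norm_def)
  have g_pos: "\<exists>i\<in>{1..n}. (real i - 1) * (T / real n) < t \<and> t \<le> real i * (T / real n) \<and>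
      g n t = w (real i * (T / real n))" if t: "0 < t" "t \<le> T" and n: "n \<ge> 1" for t n
  proof -
    define s where "s = T / real n"
    have s: "s > 0" using T n by (simp add: s_def)
    define i where "i = nat \<lceil>t / s\<rceil>"
    have ts: "t / s > 0" using t s by simp
    then have "\<lceil>t / s\<rceil> > 0" by simp
    then have i0: "real i = of_int \<lceil>t / s\<rceil>" unfolding i_def by simp
    have i1: "i \<ge> 1" using \<open>\<lceil>t / s\<rceil> > 0\<close> unfolding i_def by linarith
    have "real i \<ge> t / s" "real i < t / s + 1" unfolding i0 by linarith+
    then have i2: "t \<le> real i * s" "(real i - 1) * s < t" using s by (auto simp: field_simps)
    have "t / s \<le> real n" using t s n T by (simp add: s_def field_simps)
    then have "\<lceil>t / s\<rceil> \<le> int n" by (intro ceiling_le) simp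
    then have i3: "i \<le> n" unfolding i_def by (simp only: nat_le_iff)
    have uniq: "j = i" if "(real j - 1) * s < t" "t \<le> real j * s" for j
    proof -
      have "(real j - 1) * s < real i * s" "(real i - 1) * s < real j * s" using that i2 by linarith+
      then have "real j - 1 < real i" "real i - 1 < real j" using s by (simp_all add: mult_less_cancel_right)
      then show ?thesis by linarith
    qed
    have "g n t = (\<Sum>j=1..n. if j = i then w (real i * s) else 0)"
    proof -
      have "w (real j * s) * indicator {(real j - 1) * s<..real j * s} t = (if j = i then w (real i * s) else 0)" for j
      proof (cases "j = i")
        case True
        then show ?thesis using i2 by simp
      next
        case False
        then have "t \<notin> {(real j - 1) * s<..real j * s}" using uniq[of j] by auto
        then show ?thesis using False by (subst indicator_simps(2)) auto
      qed
      then show ?thesis unfolding g_def s_def[symmetric] using t(1) by simp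
    qed
    also have "\<dots> = w (real i * s)" using i1 i3 by simp
    finally show ?thesis
      using i1 i2 i3 unfolding s_def[symmetric] by (intro bexI[of _ i] conjI) simp_all
  qed
  have g_out: "g n t = 0" if "t < 0 \<or> t > T" for n t
  proof -
    have z: "indicator {(real i - 1) * (T / real n)<..real i * (T / real n)} t = (0::real)" if i: "i \<in> {1..n}" for i
    proof -
      have "real i * (T / real n) \<le> T" using i T by (simp add: field_simps)
      moreover have "(real i - 1) * (T / real n) \<ge> 0" using i T by simp
      ultimately show ?thesis using \<open>t < 0 \<or> t > T\<close> by (auto simp: indicator_def)
    qed
    have "(\<Sum>i=1..n. w (real i * (T / real n)) * indicator {(real i - 1) * (T / real n)<..real i * (T / real n)} t) = 0"
      by (intro sum.neutral ballI) (subst z, auto)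
    then show ?thesis using that T unfolding g_def by auto
  qed
  have g_0: "g n 0 = w 0" for n
  proof -
    have z: "indicator {(real i - 1) * (T / real n)<..real i * (T / real n)} 0 = (0::real)" if i: "i \<in> {1..n}" for i
      using i T by (auto simp: indicator_def mult_less_0_iff divide_less_0_iff)
    have "(\<Sum>i=1..n. w (real i * (T / real n)) * indicator {(real i - 1) * (T / real n)<..real i * (T / real n)} 0) = 0"
      by (intro sum.neutral ballI) (subst z, auto)
    then show ?thesis unfolding g_def by simp
  qed
  have lim: "(\<lambda>n. g n t) \<longlonglongrightarrow> f t" for t
  proof -
    consider "t < 0 \<or> t > T" | "t = 0" | "0 < t" "t \<le> T" by linarith
    then show ?thesis
    proof cases
      case 1 then show ?thesis by (auto simp: g_out f_def)
    next
      case 2 then show ?thesis using T by (simp add: g_0 f_def)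
    next
      case 3
      from right[of t] 3 obtain b where b: "b > t" "\<And>s. t < s \<Longrightarrow> s < b \<Longrightarrow> w s = w t"
        unfolding eventually_at_right_field by auto
      have "(\<lambda>n. T / real n) \<longlonglongrightarrow> 0" by (rule lim_const_over_n)
      then have "\<forall>\<^sub>F n in sequentially. T / real n < b - t" using b(1) by (intro order_tendstoD) auto
      then have "\<forall>\<^sub>F n in sequentially. g n t = f t"
        using eventually_ge_at_top[of 1]
      proof eventually_elim
        case (elim n)
        from g_pos[OF 3 elim(2)] obtain i where i: "(real i - 1) * (T / real n) < t" 
          "t \<le> real i * (T / real n)" "g n t = w (real i * (T / real n))" by blast
        have "real i * (T / real n) < b" using i(1) elim(1) unfolding left_diff_distrib by linarith
        then have "w (real i * (T / real n)) = w t" using i(2) b(2) by (cases "t = real i * (T / real n)") auto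
        then show ?case using i(3) 3 by (simp add: f_def)
      qed
      then show ?thesis by (rule tendsto_eventually)
    qed
  qed
  have meas: "g n \<in> borel_measurable lborel" for n unfolding g_def by measurable
  have fm: "f \<in> borel_measurable lborel" by (rule borel_measurable_LIMSEQ_real[OF lim meas])
  have bd: "norm (g n t) \<le> B * indicator {0..T} t" if n: "n \<ge> 1" for n t
  proof -
    consider "t < 0 \<or> t > T" | "t = 0" | "0 < t" "t \<le> T" by linarith
    then show ?thesis
    proof cases
      case 1 then show ?thesis by (auto simp: g_out)
    next
      case 2 then show ?thesis using T B[of 0] by (simp add: g_0)
    next
      case 3
      from g_pos[OF 3 n] obtain i where i: "i \<in> {1..n}" "g n t = w (real i * (T / real n))" by blast
      have "real i * (T / real n) \<in> {0..T}" using i T by (auto simp: field_simps)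
      then show ?thesis using B i 3 by simp
    qed
  qed
  \<comment> \<open>The index is shifted because the majorant holds for n \<ge> 1 only; for n = 0
    there is no grid.\<close>
  have "(\<lambda>n. integral\<^sup>L lborel (g (Suc n))) \<longlonglongrightarrow> integral\<^sup>L lborel f"
  proof (rule integral_dominated_convergence[where w = "\<lambda>t. B * indicator {0..T} t"])
    show "integrable lborel (\<lambda>t. B * indicator {0..T} t)"
      using T by (intro integrable_mult_right integrable_real_indicator) simp_all
  qed (use meas fm lim bd in \<open>auto intro!: filterlim_compose[OF lim filterlim_Suc]\<close>)
  moreover have "integral\<^sup>L lborel (g (Suc n)) =
      T / real (Suc n) * (\<Sum>i=1..Suc n. w (real i * (T / real (Suc n))))" for n
  proof -
    let ?J = "\<lambda>i. {(real i - 1) * (T / real (Suc n))<..real i * (T / real (Suc n))}"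
    have le: "(real i - 1) * (T / real (Suc n)) \<le> real i * (T / real (Suc n))" for i
      using T by (intro mult_right_mono) auto
    have J: "integrable lborel (indicator (?J i) :: real \<Rightarrow> real)"
      "integral\<^sup>L lborel (indicator (?J i) :: real \<Rightarrow> real) = T / real (Suc n)" for i
    proof -
      show "integrable lborel (indicator (?J i) :: real \<Rightarrow> real)"
        by (intro integrable_real_indicator) (simp_all only: emeasure_lborel_Ioc[OF le] sets_lborel ennreal_less_top infinity_ennreal_def greaterThanAtMost_borel)
      have "measure lborel (?J i) = real i * (T / real (Suc n)) - (real i - 1) * (T / real (Suc n))"
        by (rule measure_lborel_Ioc[OF le])
      then show "integral\<^sup>L lborel (indicator (?J i) :: real \<Rightarrow> real) = T / real (Suc n)"
        unfolding left_diff_distrib by simp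
    qed
    have I0: "integrable lborel (\<lambda>t::real. w 0 * indicator {0} t)"
      by (intro integrable_mult_right integrable_real_indicator) auto
    have I: "integrable lborel (\<lambda>t. w (real i * (T / real (Suc n))) * indicator (?J i) t)" for i
      by (rule integrable_mult_right[OF J(1)])
    have "integral\<^sup>L lborel (g (Suc n)) = integral\<^sup>L lborel (\<lambda>t::real. w 0 * indicator {0} t)
        + (\<Sum>i=1..Suc n. integral\<^sup>L lborel (\<lambda>t. w (real i * (T / real (Suc n))) * indicator (?J i) t))"
      unfolding g_def Bochner_Integration.integral_add[OF I0 Bochner_Integration.integrable_sum[OF I]]
        Bochner_Integration.integral_sum[OF I] ..
    also have "\<dots> = (\<Sum>i=1..Suc n. w (real i * (T / real (Suc n))) * (T / real (Suc n)))"
      by (simp only: integral_mult_right_zero J(2)) simp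
    finally have "integral\<^sup>L lborel (g (Suc n)) = (\<Sum>i=1..Suc n. w (real i * (T / real (Suc n))) * (T / real (Suc n)))" .
    then show ?thesis unfolding sum_distrib_left by (simp only: mult.commute)
  qed
  ultimately have "(\<lambda>n. T / real (Suc n) * (\<Sum>i=1..Suc n. w (real i * (T / real (Suc n)))))
      \<longlonglongrightarrow> integral\<^sup>L lborel f" by simp
  then show ?thesis unfolding f_def set_lebesgue_integral_def by (rule LIMSEQ_imp_Suc)
qed

section \<open>Kernels on a finite set: short time steps and path sums\<close>

lemma sum_mult_of_bool:
  fixes f :: "'s \<Rightarrow> 'a :: semiring_1"
  assumes "finite A" "y \<in> A"
  shows "(\<Sum>x\<in>A. f x * of_bool (x = y)) = f y" "(\<Sum>x\<in>A. f x * of_bool (y = x)) = f y"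
proof -
  show 1: "(\<Sum>x\<in>A. f x * of_bool (x = y)) = f y"
    using assms by (subst sum.remove[of _ y]) (auto intro!: sum.neutral)
  then show "(\<Sum>x\<in>A. f x * of_bool (y = x)) = f y" by (simp add: eq_commute)
qed

text \<open>In the \<pi>-weighted l2 norm, the squared norm of the image of g is that of g, plus 2 s
  times the quadratic form of \<open>q\<close>, plus an error o(s). On a finite set the error is
  uniform in g, since only finitely many coefficients converge, and the slack between \<Lambda> and
  \<Lambda>' absorbs it. So one short step has norm at most exp (s \<Lambda>').\<close>

lemma small_time_contraction:
  fixes p :: "real \<Rightarrow> 's \<Rightarrow> 's \<Rightarrow> real" and q :: "'s \<Rightarrow> 's \<Rightarrow> real" and \<pi> :: "'s \<Rightarrow> real"
  assumes fin: "finite A" and pos: "\<And>x. x \<in> A \<Longrightarrow> \<pi> x > 0"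
    and lim: "\<And>x y. x \<in> A \<Longrightarrow> y \<in> A \<Longrightarrow> ((\<lambda>s. (p s x y - of_bool (x = y)) / s) \<longlongrightarrow> q x y) (at_right 0)"
    and form: "\<And>g. (\<Sum>x\<in>A. \<pi> x * g x * (\<Sum>y\<in>A. q x y * g y)) \<le> \<Lambda> * (\<Sum>x\<in>A. \<pi> x * (g x)\<^sup>2)"
    and less: "\<Lambda> < \<Lambda>'"
  shows "\<forall>\<^sub>F s in at_right 0. \<forall>g. (\<Sum>x\<in>A. \<pi> x * (\<Sum>y\<in>A. p s x y * g y)\<^sup>2)
           \<le> exp (2 * s * \<Lambda>') * (\<Sum>x\<in>A. \<pi> x * (g x)\<^sup>2)"
proof -
  let ?d = "\<lambda>x y. of_bool (x = y) :: real"
  \<comment> \<open>\<open>B s\<close> is the matrix of the quadratic form that sends g to the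
    squared norm of its image; \<open>b\<close> is its derivative at s = 0, and the quadratic form
    of \<open>b\<close> is twice that of \<open>q\<close>.\<close>
  define B where "B s y z = (\<Sum>x\<in>A. \<pi> x * p s x y * p s x z)" for s y z
  define b where "b y z = \<pi> y * q y z + \<pi> z * q z y" for y z
  obtain m where m: "m > 0" "\<And>x. x \<in> A \<Longrightarrow> m \<le> \<pi> x"
  proof (cases "A = {}")
    case False
    then show ?thesis using fin pos by (intro that[of "Min (\<pi> ` A)"]) auto
  qed (use that[of 1] in auto)
  \<comment> \<open>The error is at most s \<theta> times the squared sum of \<bar>g\<bar>.
    Cauchy--Schwarz and the least weight \<open>m\<close> turn this into 2 s (\<Lambda>' -
    \<Lambda>) times the squared norm. The added 1 keeps \<theta> positive for empty
    \<open>A\<close>.\<close>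
  define \<theta> where "\<theta> = 2 * (\<Lambda>' - \<Lambda>) * m / (real (card A) + 1)"
  have \<theta>: "\<theta> > 0" unfolding \<theta>_def using less m(1) by (auto intro!: divide_pos_pos mult_pos_pos)
  have p0: "((\<lambda>s. p s x y) \<longlongrightarrow> ?d x y) (at_right 0)" if "x \<in> A" "y \<in> A" for x y
  proof -
    have "((\<lambda>s. (p s x y - ?d x y) / s * s + ?d x y) \<longlongrightarrow> q x y * 0 + ?d x y) (at_right 0)"
      by (intro tendsto_intros lim that)
    moreover have "\<forall>\<^sub>F s in at_right 0. (p s x y - ?d x y) / s * s + ?d x y = p s x y"
      using eventually_at_right_less[of "0::real"] by eventually_elim auto
    ultimately show ?thesis by (simp add: filterlim_cong)
  qed
  have limB: "((\<lambda>s. (B s y z - \<pi> y * ?d y z) / s) \<longlongrightarrow> b y z) (at_right 0)" if yz: "y \<in> A" "z \<in> A" for y z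
  proof -
    have "((\<lambda>s. \<Sum>x\<in>A. \<pi> x * ((p s x y - ?d x y) / s) * p s x z + \<pi> x * ?d x y * ((p s x z - ?d x z) / s))
        \<longlongrightarrow> (\<Sum>x\<in>A. \<pi> x * q x y * ?d x z + \<pi> x * ?d x y * q x z)) (at_right 0)"
      by (intro tendsto_intros lim p0 yz)
    moreover have "(\<Sum>x\<in>A. \<pi> x * q x y * ?d x z + \<pi> x * ?d x y * q x z) = b y z"
      using sum_mult_of_bool(1)[OF fin yz(2), of "\<lambda>x. \<pi> x * q x y"]
        sum_mult_of_bool(1)[OF fin yz(1), of "\<lambda>x. \<pi> x * q x z"]
      unfolding b_def by (simp add: sum.distrib mult_ac)
    moreover have "(\<Sum>x\<in>A. \<pi> x * ((p s x y - ?d x y) / s) * p s x z + \<pi> x * ?d x y * ((p s x z - ?d x z) / s))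
        = (B s y z - \<pi> y * ?d y z) / s" for s
    proof -
      have "\<pi> y * ?d y z = (\<Sum>x\<in>A. \<pi> x * ?d x y * ?d x z)"
        using sum_mult_of_bool(1)[OF fin yz(1), of "\<lambda>x. \<pi> x * ?d x z"] by (simp add: mult_ac)
      then have "(B s y z - \<pi> y * ?d y z) / s = (\<Sum>x\<in>A. (\<pi> x * p s x y * p s x z - \<pi> x * ?d x y * ?d x z) / s)"
        unfolding B_def by (simp add: sum_subtractf sum_divide_distrib diff_divide_distrib)
      also have "\<dots> = (\<Sum>x\<in>A. \<pi> x * ((p s x y - ?d x y) / s) * p s x z + \<pi> x * ?d x y * ((p s x z - ?d x z) / s))"
      proof (rule sum.cong)
        fix x
        have "\<pi> x * p s x y * p s x z - \<pi> x * ?d x y * ?d x z =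
          \<pi> x * (p s x y - ?d x y) * p s x z + \<pi> x * ?d x y * (p s x z - ?d x z)" by algebra
        then show "(\<pi> x * p s x y * p s x z - \<pi> x * ?d x y * ?d x z) / s =
          \<pi> x * ((p s x y - ?d x y) / s) * p s x z + \<pi> x * ?d x y * ((p s x z - ?d x z) / s)"
          by (simp add: add_divide_distrib)
      qed simp
      finally show ?thesis by simp
    qed
    ultimately show ?thesis by simp
  qed
  have "\<forall>\<^sub>F s in at_right 0. \<forall>y\<in>A. \<forall>z\<in>A. dist ((B s y z - \<pi> y * ?d y z) / s) (b y z) < \<theta>"
    using fin limB \<theta> by (intro eventually_ball_finite ballI tendstoD) auto
  then show ?thesis using eventually_at_right_less[of "0::real"]
  proof eventually_elim
    case (elim s)
    show ?case
    proof
      fix g :: "'s \<Rightarrow> real"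
      let ?n = "\<Sum>x\<in>A. \<pi> x * (g x)\<^sup>2"
      have Bb: "B s y z * g y * g z \<le> \<pi> y * ?d y z * g y * g z + s * (b y z * g y * g z) + s * \<theta> * (\<bar>g y\<bar> * \<bar>g z\<bar>)"
        if "y \<in> A" "z \<in> A" for y z
      proof -
        define r where "r = (B s y z - \<pi> y * ?d y z) / s - b y z"
        have r: "\<bar>r\<bar> \<le> \<theta>" using elim(1)[rule_format, OF that] unfolding r_def dist_real_def by (rule less_imp_le)
        have "B s y z = \<pi> y * ?d y z + s * b y z + s * r" using elim(2) by (simp add: r_def field_simps)
        then have "B s y z * g y * g z = \<pi> y * ?d y z * g y * g z + s * (b y z * g y * g z) + s * (r * (g y * g z))"
          by (simp add: algebra_simps)
        moreover have "r * (g y * g z) \<le> \<theta> * (\<bar>g y\<bar> * \<bar>g z\<bar>)"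
        proof -
          have "r * (g y * g z) \<le> \<bar>r\<bar> * (\<bar>g y\<bar> * \<bar>g z\<bar>)" by (metis abs_ge_self abs_mult)
          also have "\<dots> \<le> \<theta> * (\<bar>g y\<bar> * \<bar>g z\<bar>)" using r by (intro mult_right_mono) auto
          finally show ?thesis .
        qed
        ultimately show ?thesis using elim(2) by (simp add: mult.assoc)
      qed
      have "(\<Sum>x\<in>A. \<pi> x * (\<Sum>y\<in>A. p s x y * g y)\<^sup>2) = (\<Sum>x\<in>A. \<Sum>y\<in>A. \<Sum>z\<in>A. \<pi> x * p s x y * p s x z * g y * g z)"
        by (simp add: power2_eq_square sum_product sum_distrib_left mult_ac)
      also have "\<dots> = (\<Sum>y\<in>A. \<Sum>z\<in>A. \<Sum>x\<in>A. \<pi> x * p s x y * p s x z * g y * g z)"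
        by (subst sum.swap, rule sum.cong[OF refl], subst sum.swap) simp
      also have "\<dots> = (\<Sum>y\<in>A. \<Sum>z\<in>A. B s y z * g y * g z)"
        unfolding B_def by (simp add: sum_distrib_right)
      also have "\<dots> \<le> (\<Sum>y\<in>A. \<Sum>z\<in>A. \<pi> y * ?d y z * g y * g z + s * (b y z * g y * g z) + s * \<theta> * (\<bar>g y\<bar> * \<bar>g z\<bar>))"
        by (intro sum_mono Bb)
      also have "\<dots> = ?n + s * (\<Sum>y\<in>A. \<Sum>z\<in>A. b y z * g y * g z) + s * \<theta> * (\<Sum>y\<in>A. \<bar>g y\<bar>)\<^sup>2"
      proof -
        have "(\<Sum>y\<in>A. \<Sum>z\<in>A. \<pi> y * ?d y z * g y * g z) = ?n"
        proof (rule sum.cong)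
          fix y assume y: "y \<in> A"
          show "(\<Sum>z\<in>A. \<pi> y * ?d y z * g y * g z) = \<pi> y * (g y)\<^sup>2"
            using sum_mult_of_bool(2)[OF fin y, of "\<lambda>z. \<pi> y * g y * g z"]
            by (simp add: power2_eq_square mult_ac)
        qed simp
        then show ?thesis
          unfolding power2_eq_square[of "\<Sum>y\<in>A. \<bar>g y\<bar>"] sum_product
          by (simp add: sum.distrib sum_distrib_left)
      qed
      also have "(\<Sum>y\<in>A. \<Sum>z\<in>A. b y z * g y * g z) = 2 * (\<Sum>x\<in>A. \<pi> x * g x * (\<Sum>y\<in>A. q x y * g y))"
      proof -
        have "(\<Sum>y\<in>A. \<Sum>z\<in>A. b y z * g y * g z) = (\<Sum>y\<in>A. \<Sum>z\<in>A. \<pi> y * q y z * g y * g z)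
          + (\<Sum>y\<in>A. \<Sum>z\<in>A. \<pi> z * q z y * g y * g z)"
          unfolding b_def by (simp add: sum.distrib algebra_simps)
        also have "(\<Sum>y\<in>A. \<Sum>z\<in>A. \<pi> z * q z y * g y * g z) = (\<Sum>y\<in>A. \<Sum>z\<in>A. \<pi> y * q y z * g y * g z)"
          by (subst sum.swap) (simp add: mult_ac)
        finally show ?thesis by (simp add: sum_distrib_left mult_ac)
      qed
      also have "?n + s * (2 * (\<Sum>x\<in>A. \<pi> x * g x * (\<Sum>y\<in>A. q x y * g y)))
          + s * \<theta> * (\<Sum>y\<in>A. \<bar>g y\<bar>)\<^sup>2 \<le> ?n + s * (2 * (\<Lambda> * ?n)) + s * (2 * (\<Lambda>' - \<Lambda>) * ?n)"
      proof (intro add_mono mult_left_mono order_refl form)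
        let ?k = "real (card A) + 1"
        have "(\<Sum>y\<in>A. \<bar>g y\<bar>)\<^sup>2 \<le> real (card A) * (\<Sum>y\<in>A. (g y)\<^sup>2)"
          using Cauchy_Schwarz_ineq_sum[of "\<lambda>_. 1" "\<lambda>y. \<bar>g y\<bar>" A] by simp
        also have "\<dots> \<le> ?k * (?n / m)"
        proof (intro mult_mono)
          have "m * (\<Sum>y\<in>A. (g y)\<^sup>2) \<le> ?n" unfolding sum_distrib_left by (intro sum_mono mult_right_mono m) auto
          then show "(\<Sum>y\<in>A. (g y)\<^sup>2) \<le> ?n / m" using m(1) by (simp add: field_simps)
        qed (auto intro!: sum_nonneg)
        finally have "\<theta> * (\<Sum>y\<in>A. \<bar>g y\<bar>)\<^sup>2 \<le> \<theta> * (?k * (?n / m))"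
          using \<theta> by (intro mult_left_mono) auto
        also have "\<dots> = (\<theta> * ?k / m) * ?n" by simp
        also have "\<theta> * ?k = 2 * (\<Lambda>' - \<Lambda>) * m" unfolding \<theta>_def by simp
        also have "2 * (\<Lambda>' - \<Lambda>) * m / m = 2 * (\<Lambda>' - \<Lambda>)" using m(1) by simp
        finally have "s * (\<theta> * (\<Sum>y\<in>A. \<bar>g y\<bar>)\<^sup>2) \<le> s * (2 * (\<Lambda>' - \<Lambda>) * ?n)"
          using elim(2) by (intro mult_left_mono) auto
        then show "s * \<theta> * (\<Sum>y\<in>A. \<bar>g y\<bar>)\<^sup>2 \<le> s * (2 * (\<Lambda>' - \<Lambda>) * ?n)"
          by (simp only: mult.assoc)
      qed (use elim(2) in auto)
      also have "?n + s * (2 * (\<Lambda> * ?n)) + s * (2 * (\<Lambda>' - \<Lambda>) * ?n) = (1 + 2 * s * \<Lambda>') * ?n"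
        by (simp add: algebra_simps)
      also have "\<dots> \<le> exp (2 * s * \<Lambda>') * ?n"
        by (intro mult_right_mono exp_ge_add_one_self sum_nonneg mult_nonneg_nonneg less_imp_le[OF pos]) simp_all
      finally show "(\<Sum>x\<in>A. \<pi> x * (\<Sum>y\<in>A. p s x y * g y)\<^sup>2) \<le> exp (2 * s * \<Lambda>') * ?n" .
    qed
  qed
qed

definition kernel_op :: "'s set \<Rightarrow> ('s \<Rightarrow> 's \<Rightarrow> real) \<Rightarrow> ('s \<Rightarrow> real) \<Rightarrow> 's \<Rightarrow> real" where
  "kernel_op A K h x = (\<Sum>y\<in>A. K x y * h y)"

lemma sum_PiE_Suc:
  fixes F :: "(nat \<Rightarrow> 's) \<Rightarrow> real"
  shows "(\<Sum>y\<in>PiE {..Suc n} (\<lambda>_. A). F y) = (\<Sum>y\<in>PiE {..n} (\<lambda>_. A). \<Sum>z\<in>A. F (y(Suc n := z)))"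
proof -
  have "{..Suc n} = insert (Suc n) {..n}" by auto
  then have eq: "PiE {..Suc n} (\<lambda>_. A) = (\<lambda>(z, y). y(Suc n := z)) ` (A \<times> PiE {..n} (\<lambda>_. A))"
    by (simp add: PiE_insert_eq)
  have inj: "inj_on (\<lambda>(z, y). y(Suc n := z)) (A \<times> PiE {..n} (\<lambda>_. A))"
    using inj_combinator[of "Suc n" "{..n}" "\<lambda>_. A"] by auto
  have "(\<Sum>y\<in>PiE {..Suc n} (\<lambda>_. A). F y) = (\<Sum>(z, y)\<in>A \<times> PiE {..n} (\<lambda>_. A). F (y(Suc n := z)))"
    unfolding eq sum.reindex[OF inj] by (simp add: case_prod_unfold)
  also have "\<dots> = (\<Sum>y\<in>PiE {..n} (\<lambda>_. A). \<Sum>z\<in>A. F (y(Suc n := z)))"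
    unfolding sum.cartesian_product[symmetric] by (rule sum.swap)
  finally show ?thesis .
qed

text \<open>The induction keeps \<open>h\<close> arbitrary: the last transition is absorbed into the
  terminal function, which becomes \<open>kernel_op A K h\<close>. Probabilities and exponential
  moments along a grid thereby become powers of one operator.\<close>

lemma path_sum_eq_kernel_op:
  assumes "finite A"
  shows "(\<Sum>y\<in>PiE {..n} (\<lambda>_. A). \<pi> (y 0) * (\<Prod>i<n. K (y i) (y (Suc i))) * h (y n))
    = (\<Sum>x\<in>A. \<pi> x * ((kernel_op A K ^^ n) h) x)"
proof (induction n arbitrary: h)
  case 0
  have eq: "PiE {..0::nat} (\<lambda>_. A) = (\<lambda>x i. if i = 0 then x else undefined) ` A"
  proof (rule set_eqI, rule iffI)
    fix y :: "nat \<Rightarrow> 'a" assume y: "y \<in> PiE {..0} (\<lambda>_. A)"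
    then have "y = (\<lambda>i. if i = 0 then y 0 else undefined)" by (auto simp: PiE_def extensional_def fun_eq_iff)
    moreover have "y 0 \<in> A" using y by auto
    ultimately show "y \<in> (\<lambda>x i. if i = 0 then x else undefined) ` A" by blast
  qed (auto simp: PiE_iff extensional_def split: if_splits)
  have "inj_on (\<lambda>x (i::nat). if i = 0 then x else undefined) A"
    by (auto simp: inj_on_def fun_eq_iff)
  then show ?case unfolding eq by (simp add: sum.reindex)
next
  case (Suc n)
  have "(\<Sum>y\<in>PiE {..Suc n} (\<lambda>_. A). \<pi> (y 0) * (\<Prod>i<Suc n. K (y i) (y (Suc i))) * h (y (Suc n)))
    = (\<Sum>y\<in>PiE {..n} (\<lambda>_. A). \<Sum>z\<in>A. \<pi> (y 0) * ((\<Prod>i<n. K (y i) (y (Suc i))) * K (y n) z) * h z)"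
  proof -
    have "(\<Prod>i<n. K ((y(Suc n := z)) i) ((y(Suc n := z)) (Suc i))) = (\<Prod>i<n. K (y i) (y (Suc i)))" for y z
      by (intro prod.cong) auto
    then show ?thesis unfolding sum_PiE_Suc by simp
  qed
  also have "\<dots> = (\<Sum>y\<in>PiE {..n} (\<lambda>_. A). \<pi> (y 0) * (\<Prod>i<n. K (y i) (y (Suc i))) * kernel_op A K h (y n))"
    unfolding kernel_op_def by (simp add: sum_distrib_left mult.assoc)
  also have "\<dots> = (\<Sum>x\<in>A. \<pi> x * ((kernel_op A K ^^ n) (kernel_op A K h)) x)"
    by (rule Suc.IH)
  finally show ?case by (simp add: funpow_swap1)
qed

section \<open>The process observed on a time grid\<close>

context
  fixes M :: "'w measure" and E :: "'s set" and G :: "('s \<Rightarrow> real) \<Rightarrow> 's \<Rightarrow> real"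
    and \<mu> :: "'s measure" and X :: "real \<Rightarrow> 'w \<Rightarrow> 's" and P :: "real \<Rightarrow> 's \<Rightarrow> 's pmf"
    and A :: "'s set"
  assumes proc: "markov_process M E G \<mu> X"
    and semi: "markov_semigroup E G P"
    and markov: "\<And>n (\<tau>::nat \<Rightarrow> real) x. 0 \<le> \<tau> 0 \<Longrightarrow> (\<forall>i\<le>n. \<tau> i \<le> \<tau> (Suc i)) \<Longrightarrow> (\<forall>i\<le>Suc n. x i \<in> E) \<Longrightarrow>
           measure M {\<omega>\<in>space M. \<forall>i\<le>Suc n. X (\<tau> i) \<omega> = x i} =
           measure M {\<omega>\<in>space M. \<forall>i\<le>n. X (\<tau> i) \<omega> = x i}
             * pmf (P (\<tau> (Suc n) - \<tau> n) (x n)) (x (Suc n))"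
    and A: "finite A" "A \<subseteq> E"
begin

lemma prob: "prob_space M"
  using proc unfolding markov_process_def by blast

lemma X_measurable: "t \<ge> 0 \<Longrightarrow> X t \<in> measurable M (count_space E)"
  using proc unfolding markov_process_def by blast

lemma path_sets:
  assumes "s \<ge> 0"
  shows "{\<omega>\<in>space M. \<forall>i\<le>n. X (real i * s) \<omega> = y i} \<in> sets M"
proof -
  have "{\<omega>\<in>space M. \<forall>i\<le>n. X (real i * s) \<omega> = y i} =
    {\<omega>\<in>space M. \<forall>i\<in>{..n}. X (real i * s) \<omega> = y i}" by auto
  also have "\<dots> \<in> sets M"
  proof (rule sets.sets_Collect_finite_All)
    fix i :: nat
    have "X (real i * s) \<in> measurable M (count_space E)" using assms by (intro X_measurable) simp
    then have "X (real i * s) -` ({y i} \<inter> E) \<inter> space M \<in> sets M"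
      by (rule measurable_sets) simp
    also have "X (real i * s) -` ({y i} \<inter> E) \<inter> space M = {\<omega>\<in>space M. X (real i * s) \<omega> = y i}"
      using measurable_space[OF X_measurable[of "real i * s"]] assms by auto
    finally show "{\<omega>\<in>space M. X (real i * s) \<omega> = y i} \<in> sets M" .
  qed simp
  finally show ?thesis .
qed

lemma path_prob:
  assumes s: "s \<ge> 0" and y: "\<And>i. i \<le> n \<Longrightarrow> y i \<in> E"
  shows "measure M {\<omega>\<in>space M. \<forall>i\<le>n. X (real i * s) \<omega> = y i} =
    measure \<mu> {y 0} * (\<Prod>i<n. pmf (P s (y i)) (y (Suc i)))"
  using y
proof (induction n)
  case 0
  have X0: "X 0 \<in> measurable M (count_space E)" by (rule X_measurable) simp
  have "\<mu> = distr M (count_space E) (X 0)" using proc unfolding markov_process_def by blast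
  then have "measure \<mu> {y 0} = measure M (X 0 -` {y 0} \<inter> space M)"
    using X0 0 by (simp add: measure_distr)
  also have "X 0 -` {y 0} \<inter> space M = {\<omega>\<in>space M. X 0 \<omega> = y 0}" by auto
  finally show ?case by simp
next
  case (Suc n)
  have "measure M {\<omega>\<in>space M. \<forall>i\<le>Suc n. X (real i * s) \<omega> = y i} =
    measure M {\<omega>\<in>space M. \<forall>i\<le>n. X (real i * s) \<omega> = y i}
      * pmf (P (real (Suc n) * s - real n * s) (y n)) (y (Suc n))"
    using s Suc.prems by (intro markov) (auto intro: mult_right_mono)
  also have "real (Suc n) * s - real n * s = s" by (simp add: algebra_simps)
  also have "measure M {\<omega>\<in>space M. \<forall>i\<le>n. X (real i * s) \<omega> = y i} =
    measure \<mu> {y 0} * (\<Prod>i<n. pmf (P s (y i)) (y (Suc i)))"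
    using Suc.prems by (intro Suc.IH) auto
  finally show ?case by simp
qed

text \<open>Requiring the path to be in \<open>A\<close> at all grid times leaves finitely many
  discrete paths, so the event is a finite disjoint union of cylinders. The condition on
  \<open>\<Phi>\<close> lets a path be replaced by its restriction to \<open>{..n}\<close>.\<close>

lemma event_prob:
  assumes s: "s \<ge> 0" and \<Phi>: "\<And>y y'. (\<And>i. i \<le> n \<Longrightarrow> y i = y' i) \<Longrightarrow> \<Phi> y = \<Phi> y'"
  defines "S \<equiv> {\<omega>\<in>space M. (\<forall>i\<le>n. X (real i * s) \<omega> \<in> A) \<and> \<Phi> (\<lambda>i. X (real i * s) \<omega>)}"
  shows "S \<in> sets M"
    and "measure M S = (\<Sum>y\<in>{y\<in>PiE {..n} (\<lambda>_. A). \<Phi> y}. measure \<mu> {y 0} * (\<Prod>i<n. pmf (P s (y i)) (y (Suc i))))"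
proof -
  interpret prob_space M by (rule prob)
  let ?I = "{y\<in>PiE {..n} (\<lambda>_. A). \<Phi> y}"
  let ?F = "\<lambda>y. {\<omega>\<in>space M. \<forall>i\<le>n. X (real i * s) \<omega> = y i}"
  have fin: "finite ?I" using A by (intro finite_subset[OF _ finite_PiE[of "{..n}" "\<lambda>_. A"]]) auto
  have S: "S = (\<Union>y\<in>?I. ?F y)"
  proof (rule set_eqI, rule iffI)
    fix \<omega> assume \<omega>: "\<omega> \<in> S"
    let ?y = "restrict (\<lambda>i. X (real i * s) \<omega>) {..n}"
    have "\<Phi> ?y = \<Phi> (\<lambda>i. X (real i * s) \<omega>)" by (rule \<Phi>) auto
    then have "?y \<in> ?I" using \<omega> unfolding S_def by auto
    moreover have "\<omega> \<in> ?F ?y" using \<omega> unfolding S_def by auto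
    ultimately show "\<omega> \<in> (\<Union>y\<in>?I. ?F y)" by blast
  next
    fix \<omega> assume "\<omega> \<in> (\<Union>y\<in>?I. ?F y)"
    then obtain y where y: "y \<in> ?I" "\<omega> \<in> ?F y" by blast
    have "\<Phi> y = \<Phi> (\<lambda>i. X (real i * s) \<omega>)" using y by (intro \<Phi>) auto
    then show "\<omega> \<in> S" using y unfolding S_def by (auto simp: PiE_iff)
  qed
  have disj: "disjoint_family_on ?F ?I"
    unfolding disjoint_family_on_def
  proof (intro ballI impI)
    fix y y' assume y: "y \<in> ?I" "y' \<in> ?I" "y \<noteq> y'"
    have "\<exists>i\<in>{..n}. y i \<noteq> y' i"
    proof (rule ccontr)
      assume "\<not> (\<exists>i\<in>{..n}. y i \<noteq> y' i)"
      then have "y = y'" using y(1,2) by (intro PiE_ext[of y "{..n}" "\<lambda>_. A" y']) blast+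
      then show False using y(3) by simp
    qed
    then obtain i where i: "i \<le> n" "y i \<noteq> y' i" by blast
    show "?F y \<inter> ?F y' = {}"
    proof (rule equals0I)
      fix \<omega> assume "\<omega> \<in> ?F y \<inter> ?F y'"
      then have "X (real i * s) \<omega> = y i" "X (real i * s) \<omega> = y' i" using i(1) by blast+
      then show False using i(2) by simp
    qed
  qed
  show "S \<in> sets M" unfolding S by (intro sets.finite_UN fin path_sets s)
  have "measure M S = (\<Sum>y\<in>?I. measure M (?F y))"
    unfolding S by (rule finite_measure_finite_Union[OF fin _ disj]) (use path_sets[OF s] in blast)
  also have "\<dots> = (\<Sum>y\<in>?I. measure \<mu> {y 0} * (\<Prod>i<n. pmf (P s (y i)) (y (Suc i))))"
    using A by (intro sum.cong refl path_prob s) (auto simp: PiE_iff)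
  finally show "measure M S = \<dots>" .
qed

text \<open>The third claim is a linearity of \<open>G\<close> that \<open>markov_semigroup\<close>
  does not postulate; it follows because expectations are linear and the limit at time 0 is
  unique.\<close>

lemma small_time_kernel:
  assumes x: "x \<in> A"
  shows "y \<in> A \<Longrightarrow> ((\<lambda>s. (pmf (P s x) y - of_bool (x = y)) / s) \<longlongrightarrow> G (indicator {y}) x) (at_right 0)"
    and "((\<lambda>s. (measure (P s x) A - 1) / s) \<longlongrightarrow> G (indicator A) x) (at_right 0)"
    and "(\<And>z. z \<notin> A \<Longrightarrow> g z = 0) \<Longrightarrow> G g x = (\<Sum>y\<in>A. G (indicator {y}) x * g y)"
proof -
  have lim: "((\<lambda>t. (measure_pmf.expectation (P t x) F - F x) / t) \<longlongrightarrow> G F x) (at_right 0)"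
    if "bounded (F ` E)" for F :: "'s \<Rightarrow> real"
    using semi x A that unfolding markov_semigroup_def by blast
  have bd: "bounded (indicator B ` E :: real set)" for B :: "'s set"
    unfolding bounded_iff by (intro exI[of _ 1]) (auto simp: indicator_def)
  have l1: "((\<lambda>s. (pmf (P s x) y - of_bool (x = y)) / s) \<longlongrightarrow> G (indicator {y}) x) (at_right 0)" for y
    using lim[OF bd, of "{y}"] by (simp add: indicator_def of_bool_def measure_pmf_single)
  then show "((\<lambda>s. (pmf (P s x) y - of_bool (x = y)) / s) \<longlongrightarrow> G (indicator {y}) x) (at_right 0)" .
  show "((\<lambda>s. (measure (P s x) A - 1) / s) \<longlongrightarrow> G (indicator A) x) (at_right 0)"
    using lim[OF bd, of A] x by simp
  assume g: "\<And>z. z \<notin> A \<Longrightarrow> g z = 0"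
  have "bounded (g ` E)"
  proof -
    have "g ` E \<subseteq> insert 0 (g ` A)" using g by auto
    then have "finite (g ` E)" by (rule finite_subset) (use A in auto)
    then show ?thesis by (rule finite_imp_bounded)
  qed
  then have "((\<lambda>t. (measure_pmf.expectation (P t x) g - g x) / t) \<longlongrightarrow> G g x) (at_right 0)" by (rule lim)
  moreover have "(measure_pmf.expectation (P t x) g - g x) / t =
    (\<Sum>y\<in>A. (pmf (P t x) y - of_bool (x = y)) / t * g y)" for t
  proof -
    have "measure_pmf.expectation (P t x) g = (\<Sum>y\<in>A. pmf (P t x) y * g y)"
      using A g by (subst integral_measure_pmf[of A]) auto
    moreover have "g x = (\<Sum>y\<in>A. of_bool (x = y) * g y)"
      using sum_mult_of_bool(2)[OF A(1) x, of g] by (simp add: mult.commute)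
    ultimately show ?thesis
      by (simp add: sum_subtractf[symmetric] sum_divide_distrib left_diff_distrib diff_divide_distrib)
  qed
  moreover have "((\<lambda>t. \<Sum>y\<in>A. (pmf (P t x) y - of_bool (x = y)) / t * g y) \<longlongrightarrow>
      (\<Sum>y\<in>A. G (indicator {y}) x * g y)) (at_right 0)"
    by (intro tendsto_intros l1)
  ultimately show "G g x = (\<Sum>y\<in>A. G (indicator {y}) x * g y)"
    by (intro tendsto_unique[of "at_right (0::real)"]) auto
qed

lemma event_prob_kernel_op:
  assumes "s \<ge> 0"
  shows "measure M {\<omega>\<in>space M. \<forall>i\<le>n. X (real i * s) \<omega> \<in> A} =
    (\<Sum>x\<in>A. measure \<mu> {x} * ((kernel_op A (\<lambda>x y. pmf (P s x) y) ^^ n) (\<lambda>_. 1)) x)"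
  using event_prob(2)[OF assms, of n "\<lambda>_. True"]
    path_sum_eq_kernel_op[OF A(1), of "\<lambda>x. measure \<mu> {x}" "\<lambda>x y. pmf (P s x) y" n "\<lambda>_. 1"] by simp

lemma sum_initial_le_1: "(\<Sum>x\<in>A. measure \<mu> {x}) \<le> 1"
  using event_prob_kernel_op[of 0 0] prob_space.prob_le_1[OF prob, of "{\<omega>\<in>space M. X 0 \<omega> \<in> A}"] by simp

text \<open>Only the derivative at time 0 is at hand, so invariance of \<open>A\<close> appears as
  follows: for every \<theta> > 0, a short step of length s leaves \<open>A\<close> with probability
  at most s \<theta>. Over n steps the loss is at most n s \<theta>, which vanishes with \<theta>
  once n s is the fixed time horizon.\<close>

lemma stay_prob:
  assumes inv: "\<And>x. x \<in> A \<Longrightarrow> G (indicator A) x = 0" and \<theta>: "\<theta> > 0"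
  shows "\<forall>\<^sub>F s in at_right 0. \<forall>n. real n * s * \<theta> \<le> 1 \<longrightarrow>
    measure M {\<omega>\<in>space M. \<forall>i\<le>n. X (real i * s) \<omega> \<in> A} \<ge> (\<Sum>x\<in>A. measure \<mu> {x}) - real n * s * \<theta>"
proof -
  have "\<forall>\<^sub>F s in at_right 0. \<forall>x\<in>A. dist ((measure (P s x) A - 1) / s) 0 < \<theta>"
    using A(1) \<theta> inv small_time_kernel(2) by (intro eventually_ball_finite ballI tendstoD) auto
  then show ?thesis using eventually_at_right_less[of "0::real"]
  proof eventually_elim
    case (elim s)
    let ?K = "kernel_op A (\<lambda>x y. pmf (P s x) y)"
    have stay: "measure (P s x) A \<ge> 1 - s * \<theta>" if "x \<in> A" for x
    proof -
      have "\<bar>measure (P s x) A - 1\<bar> / s < \<theta>" using elim that by (auto simp: dist_real_def)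
      then have "\<bar>measure (P s x) A - 1\<bar> < \<theta> * s" using elim(2) by (simp add: pos_divide_less_eq)
      then show ?thesis by (simp add: abs_if mult.commute split: if_splits)
    qed
    show ?case
    proof (intro allI impI)
      fix n :: nat assume n: "real n * s * \<theta> \<le> 1"
      have "x \<in> A \<Longrightarrow> real k * s * \<theta> \<le> 1 \<Longrightarrow> (?K ^^ k) (\<lambda>_. 1) x \<ge> 1 - real k * s * \<theta>" for k x
      proof (induction k arbitrary: x)
        case (Suc k)
        let ?r = "1 - real k * s * \<theta>"
        have p: "0 \<le> s * \<theta>" using elim(2) \<theta> by simp
        have k: "real k * s * \<theta> \<le> 1" using Suc.prems(2) p by (simp add: algebra_simps)
        have "1 - real (Suc k) * s * \<theta> \<le> ?r * (1 - s * \<theta>)"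
        proof -
          have "?r * (1 - s * \<theta>) = 1 - real (Suc k) * s * \<theta> + real k * (s * \<theta>)\<^sup>2"
            by (simp add: algebra_simps power2_eq_square)
          then show ?thesis by simp
        qed
        also have "\<dots> \<le> ?r * measure (P s x) A" using stay[OF Suc.prems(1)] k by (intro mult_left_mono) auto
        also have "\<dots> = (\<Sum>y\<in>A. pmf (P s x) y * ?r)"
          using A by (simp add: measure_measure_pmf_finite sum_distrib_right[symmetric] mult.commute)
        also have "\<dots> \<le> (\<Sum>y\<in>A. pmf (P s x) y * (?K ^^ k) (\<lambda>_. 1) y)"
          using Suc.IH k by (intro sum_mono mult_left_mono) auto
        also have "\<dots> = (?K ^^ Suc k) (\<lambda>_. 1) x" by (simp add: kernel_op_def)
        finally show ?case .
      qed simp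
      then have "(\<Sum>x\<in>A. measure \<mu> {x} * (1 - real n * s * \<theta>)) \<le>
          (\<Sum>x\<in>A. measure \<mu> {x} * ((?K ^^ n) (\<lambda>_. 1)) x)"
        using n by (intro sum_mono mult_left_mono) auto
      moreover have "(\<Sum>x\<in>A. measure \<mu> {x} * (1 - real n * s * \<theta>)) \<ge> (\<Sum>x\<in>A. measure \<mu> {x}) - real n * s * \<theta>"
      proof -
        have "(\<Sum>x\<in>A. measure \<mu> {x}) * (real n * s * \<theta>) \<le> 1 * (real n * s * \<theta>)"
          using sum_initial_le_1 elim(2) \<theta> by (intro mult_right_mono) auto
        then show ?thesis by (simp add: sum_distrib_right sum_subtractf right_diff_distrib)
      qed
      ultimately show "measure M {\<omega>\<in>space M. \<forall>i\<le>n. X (real i * s) \<omega> \<in> A} \<ge>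
          (\<Sum>x\<in>A. measure \<mu> {x}) - real n * s * \<theta>"
        using event_prob_kernel_op[of s n] elim(2) by simp
    qed
  qed
qed

text \<open>A discrete Feynman--Kac formula. The tilted kernel \<open>Q\<close> has derivative G +
  \<gamma> W at time 0, so by \<open>small_time_contraction\<close> its n-th power has norm at most
  exp (n s \<Lambda>'); the exponential Chebyshev inequality contributes exp (- \<gamma> \<delta>).
  The tilt is evaluated at the arrival state, which matches the sum over i = 1, ..., n.\<close>

lemma exponential_bound:
  fixes W :: "'s \<Rightarrow> real"
  assumes pos: "\<And>x. x \<in> A \<Longrightarrow> measure \<mu> {x} > 0" and \<gamma>: "\<gamma> > 0" and \<Lambda>: "\<Lambda> < \<Lambda>'"
    and form: "\<And>g. (\<And>z. z \<notin> A \<Longrightarrow> g z = 0) \<Longrightarrow>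
      (\<Sum>x\<in>A. measure \<mu> {x} * g x * (G g x + \<gamma> * W x * g x)) \<le> \<Lambda> * (\<Sum>x\<in>A. measure \<mu> {x} * (g x)\<^sup>2)"
  shows "\<forall>\<^sub>F s in at_right 0. \<forall>n. measure M {\<omega>\<in>space M. (\<forall>i\<le>n. X (real i * s) \<omega> \<in> A) \<and>
      s * (\<Sum>i=1..n. W (X (real i * s) \<omega>)) > \<delta>} \<le> exp (real n * s * \<Lambda>' - \<gamma> * \<delta>)"
proof -
  define \<pi> where "\<pi> x = measure \<mu> {x}" for x
  define Q where "Q s x y = pmf (P s x) y * exp (\<gamma> * s * W y)" for s x y
  define q where "q x y = G (indicator {y}) x + of_bool (x = y) * (\<gamma> * W y)" for x y
  let ?n = "\<lambda>g. \<Sum>x\<in>A. \<pi> x * (g x)\<^sup>2"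
  have "\<forall>\<^sub>F s in at_right 0. \<forall>g. (\<Sum>x\<in>A. \<pi> x * (\<Sum>y\<in>A. Q s x y * g y)\<^sup>2) \<le> exp (2 * s * \<Lambda>') * ?n g"
  proof (rule small_time_contraction[OF A(1) _ _ _ \<Lambda>])
    show "\<pi> x > 0" if "x \<in> A" for x using pos[OF that] by (simp add: \<pi>_def)
    fix x y assume xy: "x \<in> A" "y \<in> A"
    have "((\<lambda>s. exp (\<gamma> * s * W y)) has_real_derivative (\<gamma> * W y)) (at 0)"
      by (auto intro!: derivative_eq_intros)
    then have "((\<lambda>s. (exp (\<gamma> * s * W y) - 1) / s) \<longlongrightarrow> \<gamma> * W y) (at 0)"
      by (simp add: has_field_derivative_iff)
    then have e: "((\<lambda>s. (exp (\<gamma> * s * W y) - 1) / s) \<longlongrightarrow> \<gamma> * W y) (at_right 0)"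
      by (rule filterlim_mono) (auto simp: at_within_le_at)
    have "((\<lambda>s. exp (\<gamma> * s * W y)) \<longlongrightarrow> exp (\<gamma> * 0 * W y)) (at_right 0)"
      by (intro tendsto_intros)
    then have "((\<lambda>s. (pmf (P s x) y - of_bool (x = y)) / s * exp (\<gamma> * s * W y)
        + of_bool (x = y) * ((exp (\<gamma> * s * W y) - 1) / s)) \<longlongrightarrow>
        G (indicator {y}) x * exp (\<gamma> * 0 * W y) + of_bool (x = y) * (\<gamma> * W y)) (at_right 0)"
      using e by (intro tendsto_intros small_time_kernel xy)
    moreover have "(pmf (P s x) y - of_bool (x = y)) / s * exp (\<gamma> * s * W y)
        + of_bool (x = y) * ((exp (\<gamma> * s * W y) - 1) / s) = (Q s x y - of_bool (x = y)) / s" for s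
    proof -
      have "(pmf (P s x) y - of_bool (x = y)) * exp (\<gamma> * s * W y)
        + of_bool (x = y) * (exp (\<gamma> * s * W y) - 1) = Q s x y - of_bool (x = y)"
        unfolding Q_def by (simp add: algebra_simps)
      then show ?thesis by (simp add: add_divide_distrib[symmetric])
    qed
    ultimately show "((\<lambda>s. (Q s x y - of_bool (x = y)) / s) \<longlongrightarrow> q x y) (at_right 0)"
      by (simp add: q_def)
  next
    fix g :: "'s \<Rightarrow> real"
    \<comment> \<open>All sums run over \<open>A\<close>, so cutting g off outside \<open>A\<close>
      changes none of them and makes \<open>form\<close> applicable.\<close>
    define h where "h z = (if z \<in> A then g z else 0)" for z
    have "(\<Sum>x\<in>A. \<pi> x * g x * (\<Sum>y\<in>A. q x y * g y)) = (\<Sum>x\<in>A. \<pi> x * h x * (G h x + \<gamma> * W x * h x))"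
    proof (rule sum.cong)
      fix x assume x: "x \<in> A"
      have "G h x = (\<Sum>y\<in>A. G (indicator {y}) x * h y)"
        by (rule small_time_kernel(3)[OF x]) (simp add: h_def)
      then have "(\<Sum>y\<in>A. q x y * g y) = G h x + \<gamma> * W x * h x"
        using sum_mult_of_bool(2)[OF A(1) x, of "\<lambda>y. \<gamma> * W y * g y"] x
        unfolding q_def by (simp add: h_def sum.distrib algebra_simps)
      then show "\<pi> x * g x * (\<Sum>y\<in>A. q x y * g y) = \<pi> x * h x * (G h x + \<gamma> * W x * h x)"
        using x by (simp add: h_def)
    qed simp
    also have "\<dots> \<le> \<Lambda> * ?n h" unfolding \<pi>_def by (rule form) (simp add: h_def)
    also have "?n h = ?n g" by (simp add: h_def)
    finally show "(\<Sum>x\<in>A. \<pi> x * g x * (\<Sum>y\<in>A. q x y * g y)) \<le> \<Lambda> * ?n g" .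
  qed
  then show ?thesis using eventually_at_right_less[of "0::real"]
  proof eventually_elim
    case (elim s)
    show ?case
    proof
      fix n :: nat
      let ?S = "\<lambda>y. s * (\<Sum>i=1..n. W (y i))"
      let ?Q = "kernel_op A (Q s)"
      have iter: "?n ((?Q ^^ k) (\<lambda>_. 1)) \<le> exp (2 * (real k * s * \<Lambda>'))" for k
      proof (induction k)
        case 0
        show ?case using sum_initial_le_1 by (simp add: \<pi>_def)
      next
        case (Suc k)
        have "?n ((?Q ^^ Suc k) (\<lambda>_. 1)) \<le> exp (2 * s * \<Lambda>') * ?n ((?Q ^^ k) (\<lambda>_. 1))"
          using elim(1)[rule_format, of "(?Q ^^ k) (\<lambda>_. 1)"] by (simp add: kernel_op_def)
        also have "\<dots> \<le> exp (2 * s * \<Lambda>') * exp (2 * (real k * s * \<Lambda>'))"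
          using Suc.IH by (intro mult_left_mono) auto
        also have "\<dots> = exp (2 * (real (Suc k) * s * \<Lambda>'))" by (simp add: exp_add[symmetric] algebra_simps)
        finally show ?case .
      qed
      have \<pi>0: "\<pi> x \<ge> 0" for x by (simp add: \<pi>_def)
      \<comment> \<open>Cauchy--Schwarz against the constant 1 passes from the l2 norm to the
        expectation; the total weight of \<open>A\<close> is at most 1.\<close>
      have "(\<Sum>x\<in>A. \<pi> x * ((?Q ^^ n) (\<lambda>_. 1)) x)\<^sup>2 \<le> (\<Sum>x\<in>A. \<pi> x) * ?n ((?Q ^^ n) (\<lambda>_. 1))"
        using Cauchy_Schwarz_ineq_sum[of "\<lambda>x. sqrt (\<pi> x)" "\<lambda>x. sqrt (\<pi> x) * ((?Q ^^ n) (\<lambda>_. 1)) x" A] \<pi>0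
        by (simp add: mult.assoc[symmetric] power_mult_distrib)
      also have "\<dots> \<le> 1 * exp (2 * (real n * s * \<Lambda>'))"
        using iter \<pi>0 sum_initial_le_1 by (intro mult_mono sum_nonneg mult_nonneg_nonneg) (auto simp: \<pi>_def)
      also have "\<dots> = (exp (real n * s * \<Lambda>'))\<^sup>2" by (simp add: power2_eq_square exp_add[symmetric])
      finally have norm: "(\<Sum>x\<in>A. \<pi> x * ((?Q ^^ n) (\<lambda>_. 1)) x) \<le> exp (real n * s * \<Lambda>')"
        by (rule power2_le_imp_le) simp
      let ?w = "\<lambda>y. \<pi> (y 0) * (\<Prod>i<n. pmf (P s (y i)) (y (Suc i)))"
      have Qw: "\<pi> (y 0) * (\<Prod>i<n. Q s (y i) (y (Suc i))) = ?w y * exp (\<gamma> * ?S y)" for y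
      proof -
        have "(\<Prod>i<n. exp (\<gamma> * s * W (y (Suc i)))) = exp (\<gamma> * ?S y)"
          by (simp add: exp_sum[symmetric] sum_distrib_left mult.assoc sum.atLeast1_atMost_eq)
        then show ?thesis unfolding Q_def by (simp add: prod.distrib)
      qed
      have w0: "?w y \<ge> 0" for y using \<pi>0 by (intro mult_nonneg_nonneg prod_nonneg) auto
      have "measure M {\<omega>\<in>space M. (\<forall>i\<le>n. X (real i * s) \<omega> \<in> A) \<and> ?S (\<lambda>i. X (real i * s) \<omega>) > \<delta>}
        = (\<Sum>y\<in>{y\<in>PiE {..n} (\<lambda>_. A). ?S y > \<delta>}. ?w y)"
        unfolding \<pi>_def
      proof (rule event_prob(2))
        fix y y' :: "nat \<Rightarrow> 's" assume "\<And>i. i \<le> n \<Longrightarrow> y i = y' i"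
        then have "(\<Sum>i=1..n. W (y i)) = (\<Sum>i=1..n. W (y' i))" by (intro sum.cong) auto
        then show "(\<delta> < ?S y) = (\<delta> < ?S y')" by simp
      qed (use elim(2) in simp)
      also have "\<dots> \<le> (\<Sum>y\<in>{y\<in>PiE {..n} (\<lambda>_. A). ?S y > \<delta>}. exp (- \<gamma> * \<delta>) * (?w y * exp (\<gamma> * ?S y)))"
      proof (rule sum_mono)
        fix y assume "y \<in> {y\<in>PiE {..n} (\<lambda>_. A). ?S y > \<delta>}"
        then have "\<gamma> * \<delta> \<le> \<gamma> * ?S y" using \<gamma> by (intro mult_left_mono) auto
        then have "1 \<le> exp (- \<gamma> * \<delta>) * exp (\<gamma> * ?S y)" by (simp add: exp_add[symmetric])
        from mult_left_mono[OF this w0[of y]]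
        show "?w y \<le> exp (- \<gamma> * \<delta>) * (?w y * exp (\<gamma> * ?S y))" by (simp only: mult_ac mult_1_right)
      qed
      also have "\<dots> \<le> (\<Sum>y\<in>PiE {..n} (\<lambda>_. A). exp (- \<gamma> * \<delta>) * (?w y * exp (\<gamma> * ?S y)))"
        using A(1) by (intro sum_mono2 mult_nonneg_nonneg w0 finite_PiE) auto
      also have "\<dots> = exp (- \<gamma> * \<delta>) * (\<Sum>x\<in>A. \<pi> x * ((?Q ^^ n) (\<lambda>_. 1)) x)"
        using path_sum_eq_kernel_op[OF A(1), of \<pi> "Q s" n "\<lambda>_. 1"]
        unfolding Qw mult_1_right sum_distrib_left[symmetric] by simp
      also have "\<dots> \<le> exp (- \<gamma> * \<delta>) * exp (real n * s * \<Lambda>')" using norm by (intro mult_left_mono) auto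
      also have "\<dots> = exp (real n * s * \<Lambda>' - \<gamma> * \<delta>)" by (simp add: exp_add[symmetric])
      finally show "measure M {\<omega>\<in>space M. (\<forall>i\<le>n. X (real i * s) \<omega> \<in> A) \<and>
        s * (\<Sum>i=1..n. W (X (real i * s) \<omega>)) > \<delta>} \<le> exp (real n * s * \<Lambda>' - \<gamma> * \<delta>)" .
    qed
  qed
qed

end

text \<open>A union bound: either the path is outside \<open>A\<close> at some grid time, or it
  stays and its Riemann sum is large. The grid is refined first; then the auxiliary \<theta> and the
  slack \<Lambda>' - \<Lambda> tend to 0.\<close>

theorem markov_exponential_chebyshev:
  fixes W :: "'s \<Rightarrow> real"
  assumes proc: "markov_process M E G \<mu> X" and A: "finite A" "A \<subseteq> E"
    and pos: "\<And>x. x \<in> A \<Longrightarrow> measure \<mu> {x} > 0" and inv: "\<And>x. x \<in> A \<Longrightarrow> G (indicator A) x = 0"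
    and \<gamma>: "\<gamma> > 0" and T: "T > 0"
    and form: "\<And>g. (\<And>z. z \<notin> A \<Longrightarrow> g z = 0) \<Longrightarrow>
      (\<Sum>x\<in>A. measure \<mu> {x} * g x * (G g x + \<gamma> * W x * g x)) \<le> \<Lambda> * (\<Sum>x\<in>A. measure \<mu> {x} * (g x)\<^sup>2)"
  shows "measure M {\<omega>\<in>space M. (LINT t:{0..T}|lborel. W (X t \<omega>)) > \<delta>}
    \<le> measure \<mu> (E - A) + exp (T * \<Lambda> - \<gamma> * \<delta>)"
proof -
  interpret prob_space M using proc unfolding markov_process_def by blast
  obtain P where P: "markov_semigroup E G P"
    "\<And>n (\<tau>::nat \<Rightarrow> real) x. 0 \<le> \<tau> 0 \<Longrightarrow> (\<forall>i\<le>n. \<tau> i \<le> \<tau> (Suc i)) \<Longrightarrow> (\<forall>i\<le>Suc n. x i \<in> E) \<Longrightarrow>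
           measure M {\<omega>\<in>space M. \<forall>i\<le>Suc n. X (\<tau> i) \<omega> = x i} =
           measure M {\<omega>\<in>space M. \<forall>i\<le>n. X (\<tau> i) \<omega> = x i}
             * pmf (P (\<tau> (Suc n) - \<tau> n) (x n)) (x (Suc n))"
    using proc unfolding markov_process_def by blast
  have Xm: "X t \<in> measurable M (count_space E)" if "t \<ge> 0" for t
    using that proc unfolding markov_process_def by blast
  have \<mu>: "\<mu> = distr M (count_space E) (X 0)" using proc unfolding markov_process_def by blast
  have out: "measure \<mu> (E - A) = 1 - (\<Sum>x\<in>A. measure \<mu> {x})"
  proof -
    interpret \<mu>: prob_space \<mu> unfolding \<mu> by (rule prob_space_distr) (simp add: Xm)
    have sets: "B \<in> sets \<mu>" if "B \<subseteq> E" for B using that by (simp add: \<mu>)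
    have "space \<mu> = E" by (simp add: \<mu>)
    then have "measure \<mu> (E - A) = 1 - measure \<mu> A" using \<mu>.prob_compl[of A] sets A(2) by simp
    also have "measure \<mu> A = (\<Sum>x\<in>A. measure \<mu> {x})"
      using A sets by (intro \<mu>.finite_measure_eq_sum_singleton) auto
    finally show ?thesis .
  qed
  let ?s = "\<lambda>n. T / real n"
  define R where "R n \<omega> = ?s n * (\<Sum>i=1..n. W (X (real i * ?s n) \<omega>))" for n \<omega>
  have Rm: "R n \<in> borel_measurable M" for n
  proof -
    have "(\<lambda>\<omega>. W (X t \<omega>)) \<in> borel_measurable M" if "t \<ge> 0" for t
      by (rule measurable_compose[OF Xm[OF that]]) simp
    then show ?thesis unfolding R_def using T by (intro borel_measurable_times borel_measurable_sum borel_measurable_const) auto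
  qed
  have bound: "measure M {\<omega>\<in>space M. (LINT t:{0..T}|lborel. W (X t \<omega>)) > \<delta>}
      \<le> measure \<mu> (E - A) + T * \<theta> + exp (T * \<Lambda>' - \<gamma> * \<delta>)"
    if \<theta>: "\<theta> > 0" "T * \<theta> \<le> 1" and \<Lambda>': "\<Lambda> < \<Lambda>'" for \<theta> \<Lambda>'
  proof -
    let ?b = "measure \<mu> (E - A) + T * \<theta> + exp (T * \<Lambda>' - \<gamma> * \<delta>)"
    have s0: "filterlim ?s (at_right 0) sequentially"
    proof -
      have "\<forall>\<^sub>F n in sequentially. ?s n > 0"
        using eventually_gt_at_top[of 0] by eventually_elim (use T in simp)
      then show ?thesis by (intro filterlim_at_withinI lim_const_over_n) (auto elim: eventually_mono)
    qed
    have stay: "\<forall>\<^sub>F n in sequentially. \<forall>k. real k * ?s n * \<theta> \<le> 1 \<longrightarrow>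
        prob {\<omega>\<in>space M. \<forall>i\<le>k. X (real i * ?s n) \<omega> \<in> A} \<ge> (\<Sum>x\<in>A. measure \<mu> {x}) - real k * ?s n * \<theta>"
      by (rule eventually_compose_filterlim[OF _ s0], rule stay_prob[OF proc P A inv \<theta>(1)])
    have large: "\<forall>\<^sub>F n in sequentially. \<forall>k. prob {\<omega>\<in>space M. (\<forall>i\<le>k. X (real i * ?s n) \<omega> \<in> A) \<and>
        ?s n * (\<Sum>i=1..k. W (X (real i * ?s n) \<omega>)) > \<delta>} \<le> exp (real k * ?s n * \<Lambda>' - \<gamma> * \<delta>)"
      by (rule eventually_compose_filterlim[OF _ s0], rule exponential_bound[OF proc P A pos \<gamma> \<Lambda>' form])
    have "\<forall>\<^sub>F n in sequentially. prob {\<omega>\<in>space M. R n \<omega> > \<delta>} \<le> ?b"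
      using stay large
        eventually_gt_at_top[of 0]
    proof eventually_elim
      case (elim n)
      have ns: "real n * ?s n = T" using elim(3) by simp
      let ?C = "{\<omega>\<in>space M. \<forall>i\<le>n. X (real i * ?s n) \<omega> \<in> A}"
      let ?B = "{\<omega>\<in>space M. (\<forall>i\<le>n. X (real i * ?s n) \<omega> \<in> A) \<and> R n \<omega> > \<delta>}"
      have "{\<omega>\<in>space M. (\<forall>i\<le>n. X (real i * ?s n) \<omega> \<in> A) \<and> True} \<in> sets M"
        by (rule event_prob(1)[OF proc P A, where \<Phi> = "\<lambda>_. True"]) (use T in simp_all)
      then have C: "?C \<in> sets M" by (simp only: simp_thms)
      have "?B = ?C \<inter> {\<omega>\<in>space M. R n \<omega> > \<delta>}" by blast
      moreover have "{\<omega>\<in>space M. R n \<omega> > \<delta>} \<in> sets M" using Rm by measurable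
      ultimately have B: "?B \<in> sets M" using sets.Int[OF C] by (simp only:)
      have "prob ?B \<le> exp (T * \<Lambda>' - \<gamma> * \<delta>)"
        using elim(2)[rule_format, of n] unfolding R_def ns .
      moreover have "prob ?C \<ge> (\<Sum>x\<in>A. measure \<mu> {x}) - T * \<theta>"
        using elim(1)[rule_format, of n] \<theta>(2) unfolding ns by simp
      moreover have "prob {\<omega>\<in>space M. R n \<omega> > \<delta>} \<le> prob ((space M - ?C) \<union> ?B)"
        using B C by (intro finite_measure_mono) blast+
      moreover have "prob ((space M - ?C) \<union> ?B) \<le> prob (space M - ?C) + prob ?B"
        using B C by (intro measure_Un_le) blast+
      moreover have "prob (space M - ?C) = 1 - prob ?C" using C by (rule prob_compl)
      ultimately show ?case using out by linarith
    qed
    then obtain n0 where n0: "\<And>n. n \<ge> n0 \<Longrightarrow> prob {\<omega>\<in>space M. R n \<omega> > \<delta>} \<le> ?b"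
      unfolding eventually_sequentially by blast
    \<comment> \<open>On \<open>F m\<close> all Riemann sums from index m on exceed \<delta>. These
      events increase in m, and each lies inside an event of index at least \<open>n0\<close>, for
      which the bound is known.\<close>
    define F where "F m = (\<Inter>n\<in>{m..}. {\<omega>\<in>space M. R n \<omega> > \<delta>})" for m
    have Rs: "{\<omega>\<in>space M. R n \<omega> > \<delta>} \<in> sets M" for n
      using Rm by measurable
    have F: "F m \<in> sets M" for m unfolding F_def using Rs by (intro sets.countable_INT') auto
    have "incseq F" unfolding F_def incseq_def by (auto simp: Ball_def)
    then have lim: "(\<lambda>m. prob (F m)) \<longlonglongrightarrow> prob (\<Union>m. F m)"
      using F by (intro finite_Lim_measure_incseq) auto
    have "prob (F m) \<le> ?b" for m
    proof -
      have "prob (F m) \<le> prob {\<omega>\<in>space M. R (max m n0) \<omega> > \<delta>}"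
        using Rs by (intro finite_measure_mono) (auto simp: F_def)
      also have "\<dots> \<le> ?b" by (rule n0) simp
      finally show ?thesis .
    qed
    then have "prob (\<Union>m. F m) \<le> ?b" by (intro LIMSEQ_le_const2[OF lim]) auto
    \<comment> \<open>The strict inequality passes from the limit to all late Riemann sums.
      Monotonicity of the measure asks only that the larger set be measurable.\<close>
    moreover have "{\<omega>\<in>space M. (LINT t:{0..T}|lborel. W (X t \<omega>)) > \<delta>} \<subseteq> (\<Union>m. F m)"
    proof safe
      fix \<omega> assume \<omega>: "\<omega> \<in> space M" "(LINT t:{0..T}|lborel. W (X t \<omega>)) > \<delta>"
      have right: "\<forall>\<^sub>F s in at_right t. X s \<omega> = X t \<omega>" if "0 \<le> t" for t
        using proc \<omega>(1) that unfolding markov_process_def by blast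
      have left: "\<exists>y. \<forall>\<^sub>F s in at_left t. X s \<omega> = y" if "0 < t" for t
        using proc \<omega>(1) that unfolding markov_process_def by blast
      have "finite ((\<lambda>t. X t \<omega>) ` {0..T})"
        by (rule finite_range_if_piecewise_constant[OF right left])
      then have fin: "finite ((\<lambda>t. W (X t \<omega>)) ` {0..T})"
        using finite_imageI[of "(\<lambda>t. X t \<omega>) ` {0..T}" W] by (simp add: image_image)
      have "(\<lambda>n. R n \<omega>) \<longlonglongrightarrow> (LINT t:{0..T}|lborel. W (X t \<omega>))"
        unfolding R_def
        by (rule riemann_sums_right_continuous[OF T fin], rule eventually_mono[OF right]) simp_all
      then have "\<forall>\<^sub>F n in sequentially. R n \<omega> > \<delta>" using \<omega>(2) by (rule order_tendstoD)
      then obtain m where "\<And>n. n \<ge> m \<Longrightarrow> R n \<omega> > \<delta>" unfolding eventually_sequentially by blast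
      then show "\<omega> \<in> (\<Union>m. F m)" using \<omega>(1) by (auto simp: F_def)
    qed
    then have "measure M {\<omega>\<in>space M. (LINT t:{0..T}|lborel. W (X t \<omega>)) > \<delta>} \<le> prob (\<Union>m. F m)"
      using F by (intro finite_measure_mono) auto
    ultimately show ?thesis by linarith
  qed
  have "((\<lambda>\<theta>. measure \<mu> (E - A) + T * \<theta> + exp (T * (\<Lambda> + \<theta>) - \<gamma> * \<delta>)) \<longlongrightarrow>
      measure \<mu> (E - A) + T * 0 + exp (T * (\<Lambda> + 0) - \<gamma> * \<delta>)) (at_right 0)"
    by (intro tendsto_intros)
  moreover have "\<forall>\<^sub>F \<theta> in at_right 0. measure M {\<omega>\<in>space M. (LINT t:{0..T}|lborel. W (X t \<omega>)) > \<delta>} \<le>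
      measure \<mu> (E - A) + T * \<theta> + exp (T * (\<Lambda> + \<theta>) - \<gamma> * \<delta>)"
  proof -
    \<comment> \<open>One parameter serves for both losses, with \<Lambda> + \<theta> in the role of
      \<Lambda>'; \<theta> < 1/T ensures T \<theta> \<le> 1.\<close>
    have "\<forall>\<^sub>F \<theta> in at_right 0. \<theta> \<in> {0<..<1 / T}" using T by (intro eventually_at_right_real) simp
    then show ?thesis
    proof eventually_elim
      case (elim \<theta>)
      then have "T * \<theta> \<le> 1" using T by (simp add: field_simps)
      then show ?case using elim by (intro bound) auto
    qed
  qed
  ultimately have "measure M {\<omega>\<in>space M. (LINT t:{0..T}|lborel. W (X t \<omega>)) > \<delta>} \<le>
      measure \<mu> (E - A) + T * 0 + exp (T * (\<Lambda> + 0) - \<gamma> * \<delta>)"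
    by (intro tendsto_lowerbound) auto
  then show ?thesis by simp
qed

section \<open>Translations of the discrete torus\<close>

text \<open>Displacements are integer vectors, so that shifts become an action of an additive group
  (\<open>translate_translate\<close>) and unit steps can be counted.\<close>

definition translate :: "nat \<Rightarrow> real ^ 'd \<Rightarrow> int ^ 'd \<Rightarrow> real ^ 'd" where
  "translate N x z = wrap (x + (1 / real N) *\<^sub>R (\<chi> i. of_int (z $ i)))"

definition int_box :: "int set \<Rightarrow> (int ^ 'd) set" where
  "int_box I = {z. \<forall>i. z $ i \<in> I}"

lemma translate_nth: "translate N x z $ i = frac (x $ i + of_int (z $ i) / real N)"
  by (simp add: translate_def wrap_def)

lemma frac_add_of_int [simp]: "frac (a + of_int k) = frac (a :: real)"
  by (simp add: frac_def)

lemma frac_frac_add: "frac (frac a + b) = frac (a + b :: real)"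
  using frac_add_of_int[of "a + b" "- \<lfloor>a\<rfloor>"] by (simp add: frac_def algebra_simps)

lemma translate_translate: "translate N (translate N x z) w = translate N x (z + w)"
  by (simp add: vec_eq_iff translate_nth frac_frac_add add_divide_distrib add.assoc)

lemma torus_nth_bounds:
  assumes "x \<in> torus N" shows "0 \<le> x $ i" "x $ i < 1"
proof -
  obtain k where "k < N" "x $ i = real k / real N" using assms by (auto simp: torus_def)
  then show "0 \<le> x $ i" "x $ i < 1" by auto
qed

lemma translate_0: "x \<in> torus N \<Longrightarrow> translate N x 0 = x"
  using torus_nth_bounds[of x N] by (simp add: vec_eq_iff translate_nth frac_eq)

lemma translate_in_torus:
  assumes N: "N \<ge> 1" and x: "x \<in> torus N"
  shows "translate N x z \<in> torus N"
proof -
  have "\<exists>k<N. translate N x z $ i = real k / real N" for i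
  proof -
    obtain k where k: "x $ i = real k / real N" using x by (auto simp: torus_def)
    define m where "m = (int k + z $ i) mod int N"
    have m: "0 \<le> m" "m < int N" using N by (simp_all add: m_def)
    have "x $ i + of_int (z $ i) / real N = of_int (int k + z $ i) / real N"
      by (simp add: k add_divide_distrib)
    also have "of_int (int k + z $ i) = real N * of_int ((int k + z $ i) div int N) + of_int m"
      unfolding m_def by (metis mult_div_mod_eq of_int_add of_int_mult of_int_of_nat_eq)
    also have "\<dots> / real N = of_int m / real N + of_int ((int k + z $ i) div int N)"
      using N by (simp add: add_divide_distrib)
    finally have "translate N x z $ i = frac (of_int m / real N)" by (simp add: translate_nth)
    also have "\<dots> = of_int m / real N" using m N by (simp add: frac_eq)
    also have "\<dots> = real (nat m) / real N" using m by simp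
    finally show ?thesis using m by (intro exI[of _ "nat m"]) auto
  qed
  then show ?thesis by (simp add: torus_def)
qed

lemma bij_betw_translate:
  assumes "N \<ge> 1"
  shows "bij_betw (\<lambda>x. translate N x z) (torus N) (torus N)"
  by (rule bij_betwI[where g = "\<lambda>x. translate N x (- z)"])
    (auto simp: translate_translate translate_0 intro!: translate_in_torus assms)

lemma sum_translate:
  assumes "N \<ge> 1"
  shows "(\<Sum>x\<in>torus N. F (translate N x z)) = (\<Sum>x\<in>torus N. F x)"
  by (rule sum.reindex_bij_betw[OF bij_betw_translate[OF assms]])

lemma translate_eq_imp_dvd:
  assumes N: "N \<ge> 1" and eq: "translate N x z = translate N x w"
  shows "int N dvd z $ i - w $ i"
proof -
  let ?a = "x $ i + of_int (z $ i) / real N" and ?b = "x $ i + of_int (w $ i) / real N"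
  have "frac ?a = frac ?b" using arg_cong[OF eq, of "\<lambda>v. v $ i"] by (simp add: translate_nth)
  then have "of_int (z $ i) / real N - of_int (w $ i) / real N = of_int (\<lfloor>?a\<rfloor> - \<lfloor>?b\<rfloor>)"
    by (simp add: frac_def)
  then have "(of_int (z $ i) - of_int (w $ i) :: real) = of_int (\<lfloor>?a\<rfloor> - \<lfloor>?b\<rfloor>) * real N"
    using N by (simp add: field_simps)
  then have "real_of_int (z $ i - w $ i) = of_int ((\<lfloor>?a\<rfloor> - \<lfloor>?b\<rfloor>) * int N)" by simp
  then have "z $ i - w $ i = (\<lfloor>?a\<rfloor> - \<lfloor>?b\<rfloor>) * int N" by (simp only: of_int_eq_iff)
  then show ?thesis by simp
qed

text \<open>Displacements with the same image differ by multiples of N in every coordinate, while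
  within the box they differ by less than N.\<close>

lemma inj_on_translate:
  assumes N: "N \<ge> 1" and I: "\<And>k l. k \<in> I \<Longrightarrow> l \<in> I \<Longrightarrow> \<bar>k - l\<bar> < int N"
  shows "inj_on (translate N x) (int_box I)"
proof (rule inj_onI)
  fix z w assume zw: "z \<in> int_box I" "w \<in> int_box I" "translate N x z = translate N x w"
  have "z $ i = w $ i" for i
  proof -
    have "\<bar>z $ i - w $ i\<bar> < int N" using zw I by (simp add: int_box_def)
    then show ?thesis using translate_eq_imp_dvd[OF N zw(3), of i] dvd_imp_le_int[of "z $ i - w $ i" "int N"] by auto
  qed
  then show "z = w" by (simp add: vec_eq_iff)
qed

section \<open>Counting displacements; boxes and pairs of sites\<close>

lemma int_box_eq_image: "int_box I = vec_lambda ` (UNIV \<rightarrow>\<^sub>E I)"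
proof (rule set_eqI)
  fix z :: "int ^ 'd"
  have "z = vec_lambda (\<lambda>i. z $ i)" by simp
  then show "z \<in> int_box I \<longleftrightarrow> z \<in> vec_lambda ` (UNIV \<rightarrow>\<^sub>E I)"
    by (auto simp: int_box_def PiE_iff image_iff intro!: bexI[of _ "\<lambda>i. z $ i"])
qed

lemma finite_int_box: "finite I \<Longrightarrow> finite (int_box I :: (int ^ 'd) set)"
  unfolding int_box_eq_image by (intro finite_imageI finite_PiE) auto

lemma card_int_box:
  assumes "finite I" shows "card (int_box I :: (int ^ 'd) set) = card I ^ CARD('d)"
proof -
  have "card (int_box I :: (int ^ 'd) set) = card ((UNIV :: 'd set) \<rightarrow>\<^sub>E I)"
    unfolding int_box_eq_image by (rule card_image) (metis inj_onI vec_lambda_inject UNIV_I)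
  then show ?thesis by (simp add: card_PiE)
qed

lemma torus_eq_translate_image:
  assumes N: "N \<ge> 1"
  shows "torus N = translate N 0 ` int_box {0..<int N}"
proof (rule set_eqI, rule iffI)
  fix x :: "real ^ 'd" assume "x \<in> torus N"
  then have "\<forall>i. \<exists>k<N. x $ i = real k / real N" unfolding torus_def by blast
  then obtain k where k: "\<And>i. k i < N \<and> x $ i = real (k i) / real N" by metis
  have "translate N 0 (\<chi> i. int (k i)) = x" using k N by (simp add: vec_eq_iff translate_nth frac_eq divide_less_eq)
  moreover have "(\<chi> i. int (k i)) \<in> int_box {0..<int N}" using k by (simp add: int_box_def)
  ultimately show "x \<in> translate N 0 ` int_box {0..<int N}" by (metis imageI)
next
  fix x :: "real ^ 'd" assume "x \<in> translate N 0 ` int_box {0..<int N}"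
  moreover have "(0 :: real ^ 'd) \<in> torus N" using N by (auto simp: torus_def intro!: exI[of _ 0])
  ultimately show "x \<in> torus N" using translate_in_torus[OF N] by blast
qed

lemma finite_torus: "N \<ge> 1 \<Longrightarrow> finite (torus N :: (real ^ 'd) set)"
  by (simp add: torus_eq_translate_image finite_int_box)

lemma card_torus:
  assumes N: "N \<ge> 1" shows "card (torus N :: (real ^ 'd) set) = N ^ CARD('d)"
proof -
  have "card (torus N :: (real ^ 'd) set) = card (int_box {0..<int N} :: (int ^ 'd) set)"
    unfolding torus_eq_translate_image[OF N] by (rule card_image, rule inj_on_translate[OF N]) auto
  then show ?thesis by (simp add: card_int_box)
qed

text \<open>Surjectivity comes from counting: the map is injective into the torus, and both sets
  have \<open>N ^ CARD('d)\<close> elements.\<close>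

lemma bij_betw_translate_int_box:
  assumes N: "N \<ge> 1" and x: "x \<in> torus N"
  shows "bij_betw (translate N x) (int_box {0..<int N}) (torus N :: (real ^ 'd) set)"
proof -
  have inj: "inj_on (translate N x) (int_box {0..<int N})" by (rule inj_on_translate[OF N]) auto
  have "translate N x ` int_box {0..<int N} = torus N"
    using translate_in_torus[OF N x] card_image[OF inj] finite_torus[OF N, where 'd = 'd]
    by (intro card_subset_eq) (auto simp: card_int_box card_torus[OF N])
  then show ?thesis using inj by (simp add: bij_betw_def)
qed

text \<open>Energy bounds are available for a fixed displacement summed over all positions, which is
  the inner sum on the right.\<close>

lemma sum_torus_pairs:
  fixes F :: "real ^ 'd \<Rightarrow> real ^ 'd \<Rightarrow> real"
  assumes N: "N \<ge> 1"
  shows "(\<Sum>x\<in>torus N. \<Sum>y\<in>torus N. F x y) = (\<Sum>z\<in>int_box {0..<int N}. \<Sum>x\<in>torus N. F x (translate N x z))"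
proof -
  have "(\<Sum>x\<in>torus N. \<Sum>y\<in>torus N. F x y) = (\<Sum>x\<in>torus N. \<Sum>z\<in>int_box {0..<int N}. F x (translate N x z))"
    by (intro sum.cong refl sum.reindex_bij_betw[symmetric] bij_betw_translate_int_box N)
  also have "\<dots> = (\<Sum>z\<in>int_box {0..<int N}. \<Sum>x\<in>torus N. F x (translate N x z))" by (rule sum.swap)
  finally show ?thesis .
qed

lemma lattice_box_eq: "lattice_box N L x = translate N x ` int_box {- int L..int L}"
proof (rule set_eqI, rule iffI)
  fix y assume "y \<in> lattice_box N L x"
  then obtain z where z: "y = wrap (x + (1 / real N) *\<^sub>R z)" "\<And>i. z $ i \<in> \<int> \<and> \<bar>z $ i\<bar> \<le> real L"
    by (auto simp: lattice_box_def)
  have f: "of_int \<lfloor>z $ i\<rfloor> = z $ i" for i using z(2)[of i] by simp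
  have "\<bar>\<lfloor>z $ i\<rfloor>\<bar> \<le> int L" for i
  proof -
    have "real_of_int \<bar>\<lfloor>z $ i\<rfloor>\<bar> \<le> of_int (int L)" using z(2)[of i] f[of i] by simp
    then show ?thesis by (simp only: of_int_le_iff)
  qed
  then have "(\<chi> i. \<lfloor>z $ i\<rfloor>) \<in> int_box {- int L..int L}" by (auto simp: int_box_def abs_le_iff minus_le_iff)
  moreover have "y = translate N x (\<chi> i. \<lfloor>z $ i\<rfloor>)"
  proof -
    have "(\<chi> i. of_int ((\<chi> i. \<lfloor>z $ i\<rfloor>) $ i)) = z" using f by (simp add: vec_eq_iff)
    then show ?thesis by (simp only: z(1) translate_def)
  qed
  ultimately show "y \<in> translate N x ` int_box {- int L..int L}" by blast
next
  fix y assume "y \<in> translate N x ` int_box {- int L..int L}"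
  then obtain w :: "int ^ 'a" where w: "w \<in> int_box {- int L..int L}" "y = translate N x w" by blast
  have "\<bar>real_of_int (w $ i)\<bar> \<le> real L" for i
  proof -
    have "\<bar>w $ i\<bar> \<le> int L" using w(1) by (auto simp: int_box_def abs_le_iff minus_le_iff)
    then have "real_of_int \<bar>w $ i\<bar> \<le> real_of_int (int L)" by (simp only: of_int_le_iff)
    then show ?thesis by simp
  qed
  then show "y \<in> lattice_box N L x"
    unfolding lattice_box_def w(2) translate_def by (intro CollectI exI[of _ "\<chi> i. of_int (w $ i)"]) auto
qed

text \<open>For 2 L + 1 \<le> N the box does not wrap onto itself, so the sum has
  \<open>(2 * L + 1) ^ CARD('d)\<close> terms and \<open>local_avg\<close> is a genuine
  average.\<close>

lemma sum_lattice_box: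
  fixes x :: "real ^ 'd"
  assumes N: "N \<ge> 1" and L: "2 * L + 1 \<le> N"
  shows "(\<Sum>y\<in>lattice_box N L x. f y) = (\<Sum>z\<in>int_box {- int L..int L}. f (translate N x z))"
  unfolding lattice_box_eq
  by (rule sum.reindex_cong[OF inj_on_translate[OF N]]) (use L in auto)

text \<open>Walk from 0 to z along the coordinate axes: each unit step costs the value at a unit
  vector, and evenness covers backward steps. The intended f is the l2 norm of the change of g when
  a particle is displaced by z.\<close>

lemma subadditive_int_vec_bound:
  fixes f :: "int ^ 'd \<Rightarrow> real"
  assumes zero: "f 0 \<le> 0" and add: "\<And>z w. f (z + w) \<le> f z + f w" and minus: "\<And>z. f (- z) = f z"
  shows "f z \<le> (\<Sum>i\<in>UNIV. \<bar>of_int (z $ i)\<bar> * f (axis i 1))"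
proof -
  have nat: "f (axis i (int n)) \<le> real n * f (axis i 1)" for i n
  proof (induction n)
    case 0
    have "axis i (int 0) = (0 :: int ^ 'd)" by (simp add: vec_eq_iff axis_def)
    from arg_cong[OF this, of f] show ?case using zero by simp
  next
    case (Suc n)
    have "axis i (int (Suc n)) = axis i (int n) + (axis i 1 :: int ^ 'd)" by (simp add: vec_eq_iff axis_def)
    then show ?case using Suc.IH add[of "axis i (int n)" "axis i 1"] by (simp add: algebra_simps)
  qed
  have int: "f (axis i k) \<le> \<bar>of_int k\<bar> * f (axis i 1)" for i k
  proof (cases "k \<ge> 0")
    case True
    then show ?thesis using nat[of i "nat k"] by simp
  next
    case False
    have "f (axis i k) = f (axis i (- k))"
    proof -
      have "axis i k = - (axis i (- k) :: int ^ 'd)" by (simp add: vec_eq_iff axis_def)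
      then show ?thesis by (simp only: minus)
    qed
    then show ?thesis using False nat[of i "nat (- k)"] by simp
  qed
  have "f (\<Sum>i\<in>S. axis i (z $ i)) \<le> (\<Sum>i\<in>S. \<bar>of_int (z $ i)\<bar> * f (axis i 1))" if "finite S" for S
    using that
  proof (induction S)
    case empty
    show ?case using zero by simp
  next
    case (insert i S)
    then show ?case using add[of "axis i (z $ i)" "\<Sum>i\<in>S. axis i (z $ i)"] int[of i "z $ i"] by simp
  qed
  from this[of UNIV] have "f (\<Sum>i\<in>UNIV. axis i (z $ i)) \<le> (\<Sum>i\<in>UNIV. \<bar>of_int (z $ i)\<bar> * f (axis i 1))" by simp
  moreover have "(\<Sum>i\<in>UNIV. axis i (z $ i)) = z"
    by (simp add: vec_eq_iff sum_component axis_def)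
  ultimately show ?thesis by simp
qed

lemma neighbour_eq_translate:
  "wrap (x + (1 / real N) *\<^sub>R axis i 1) = translate N x (axis i 1)"
  "wrap (x - (1 / real N) *\<^sub>R axis i 1) = translate N x (- axis i 1)"
  by (simp_all add: vec_eq_iff translate_nth wrap_def axis_def)

section \<open>The Dirichlet form\<close>

text \<open>The sites are an arbitrary finite set, because exchange energies are needed also between
  sites that are not neighbours; the geometry enters later. \<open>Z\<close> is a free positive
  constant, to be instantiated with \<open>Z_norm\<close>.\<close>

locale zrp_sites =
  fixes S :: "'s set" and \<alpha> c a Z :: real
  assumes finite_S: "finite S" and \<alpha>: "\<alpha> > 0" and c: "c > 0" and a: "a > 0" and Z: "Z > 0"
begin

definition configs :: "('s \<Rightarrow> real) set" where
  "configs = PiE_dflt S 0 (\<lambda>_. {c * real k | k :: nat. True})"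

definition low_mass :: "real \<Rightarrow> ('s \<Rightarrow> real) set" where
  "low_mass R = {\<eta>\<in>configs. (\<Sum>x\<in>S. \<eta> x) \<le> R}"

definition site_weight :: "real \<Rightarrow> real" where
  "site_weight u = (a / c) powr (\<alpha> * u / c) / ((fact (nat \<lfloor>u / c\<rfloor>)) powr \<alpha> * Z)"

definition weight :: "('s \<Rightarrow> real) \<Rightarrow> real" where
  "weight \<eta> = (\<Prod>x\<in>S. site_weight (\<eta> x))"

definition add :: "'s \<Rightarrow> ('s \<Rightarrow> real) \<Rightarrow> 's \<Rightarrow> real" where
  "add x \<eta> = (\<lambda>z. \<eta> z + c * indicator {x} z)"

lemma add_same: "add x \<eta> x = \<eta> x + c"
  and add_other: "y \<noteq> x \<Longrightarrow> add x \<eta> y = \<eta> y"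
  by (simp_all add: add_def)

lemma configs_nth: "\<eta> \<in> configs \<Longrightarrow> x \<in> S \<Longrightarrow> \<exists>k::nat. \<eta> x = c * real k"
  and configs_outside: "\<eta> \<in> configs \<Longrightarrow> x \<notin> S \<Longrightarrow> \<eta> x = 0"
  and configsI: "(\<And>x. x \<in> S \<Longrightarrow> \<exists>k::nat. \<eta> x = c * real k) \<Longrightarrow> (\<And>x. x \<notin> S \<Longrightarrow> \<eta> x = 0) \<Longrightarrow> \<eta> \<in> configs"
  unfolding configs_def PiE_dflt_def by auto

lemma configs_nonneg: "\<eta> \<in> configs \<Longrightarrow> \<eta> x \<ge> 0"
  using configs_nth[of \<eta> x] configs_outside[of \<eta> x] c by (cases "x \<in> S") auto

lemma finite_low: "finite (low_mass R)"
proof -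
  have "low_mass R \<subseteq> PiE_dflt S 0 (\<lambda>_. (\<lambda>k. c * real k) ` {..nat \<lfloor>R / c\<rfloor>})"
  proof
    fix \<eta> assume \<eta>: "\<eta> \<in> low_mass R"
    then have conf: "\<eta> \<in> configs" by (simp add: low_mass_def)
    have "\<eta> x \<in> (\<lambda>k. c * real k) ` {..nat \<lfloor>R / c\<rfloor>}" if x: "x \<in> S" for x
    proof -
      obtain k :: nat where k: "\<eta> x = c * real k" using configs_nth[OF conf x] by blast
      have "\<eta> x \<le> (\<Sum>x\<in>S. \<eta> x)" using x configs_nonneg[OF conf] finite_S by (intro member_le_sum) auto
      then have "c * real k \<le> R" using \<eta> k by (simp add: low_mass_def)
      then have "real k \<le> R / c" using c by (simp add: field_simps)
      then have "k \<le> nat \<lfloor>R / c\<rfloor>" by (simp add: le_nat_floor)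
      then show ?thesis using k by auto
    qed
    then show "\<eta> \<in> PiE_dflt S 0 (\<lambda>_. (\<lambda>k. c * real k) ` {..nat \<lfloor>R / c\<rfloor>})"
      using configs_outside[OF conf] by (auto simp: PiE_dflt_def)
  qed
  then show ?thesis by (rule finite_subset) (intro finite_PiE_dflt finite_S, auto)
qed

section \<open>Equilibrium weight and adding a particle\<close>

lemma weight_pos: "weight \<eta> > 0"
  unfolding weight_def site_weight_def using a c Z
  by (intro prod_pos) (auto intro!: divide_pos_pos mult_pos_pos)

lemma site_weight_Suc:
  "site_weight (c * real k + c) * (c * real k + c) powr \<alpha> = site_weight (c * real k) * a powr \<alpha>"
proof -
  have e: "(c * real k + c) / c = real (Suc k)" "c * real k / c = real k"
    "\<alpha> * (c * real k + c) / c = \<alpha> * real k + \<alpha>" "\<alpha> * (c * real k) / c = \<alpha> * real k"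
    using c by (simp_all add: field_simps)
  have f: "(fact (Suc k) :: real) powr \<alpha> = (real (Suc k)) powr \<alpha> * fact k powr \<alpha>"
    by (simp add: powr_mult)
  have g: "(c * real k + c) powr \<alpha> = c powr \<alpha> * real (Suc k) powr \<alpha>"
    using c by (simp add: powr_mult[symmetric] algebra_simps)
  have h: "(a / c) powr (\<alpha> * real k + \<alpha>) * c powr \<alpha> = (a / c) powr (\<alpha> * real k) * a powr \<alpha>"
  proof -
    have "(a / c) powr \<alpha> * c powr \<alpha> = a powr \<alpha>" using a c by (simp add: powr_mult[symmetric])
    then show ?thesis by (simp add: powr_add mult.assoc)
  qed
  have n: "nat \<lfloor>real (Suc k)\<rfloor> = Suc k" "nat \<lfloor>real k\<rfloor> = k" by (simp_all only: floor_of_nat nat_int)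
  have r: "real (Suc k) powr \<alpha> > 0" by simp
  have "site_weight (c * real k + c) * (c * real k + c) powr \<alpha> =
    ((a / c) powr (\<alpha> * real k + \<alpha>) * c powr \<alpha>) / (fact k powr \<alpha> * Z)"
    unfolding site_weight_def e n f g using r by (simp add: field_simps)
  also have "\<dots> = site_weight (c * real k) * a powr \<alpha>"
    unfolding h unfolding site_weight_def e n by simp
  finally show ?thesis .
qed

text \<open>Detailed balance: the weight of \<open>add x \<zeta>\<close> times the rate at which a
  particle leaves x does not depend on x, so moving the extra particle between any two sites is
  symmetric.\<close>

lemma weight_add:
  assumes \<zeta>: "\<zeta> \<in> configs" and x: "x \<in> S"
  shows "weight (add x \<zeta>) * (\<zeta> x + c) powr \<alpha> = weight \<zeta> * a powr \<alpha>"
proof -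
  obtain k :: nat where k: "\<zeta> x = c * real k" using configs_nth[OF \<zeta> x] by blast
  have r: "(\<Prod>y\<in>S - {x}. site_weight (add x \<zeta> y)) = (\<Prod>y\<in>S - {x}. site_weight (\<zeta> y))"
    by (intro prod.cong) (auto simp: add_other)
  have "weight (add x \<zeta>) * (\<zeta> x + c) powr \<alpha> =
    (site_weight (c * real k + c) * (c * real k + c) powr \<alpha>) * (\<Prod>y\<in>S - {x}. site_weight (\<zeta> y))"
    unfolding weight_def using prod.remove[OF finite_S x, of "\<lambda>y. site_weight (add x \<zeta> y)"] r k
    by (simp add: add_same)
  also have "\<dots> = weight \<zeta> * a powr \<alpha>"
    unfolding site_weight_Suc weight_def using prod.remove[OF finite_S x, of "\<lambda>y. site_weight (\<zeta> y)"] k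
    by simp
  finally show ?thesis .
qed

lemma add_configs:
  assumes "\<zeta> \<in> configs" "x \<in> S" shows "add x \<zeta> \<in> configs"
proof (rule configsI)
  fix y assume y: "y \<in> S"
  obtain k :: nat where k: "\<zeta> y = c * real k" using configs_nth[OF assms(1) y] by blast
  then have "add x \<zeta> y = c * real (if y = x then Suc k else k)"
    by (simp add: add_def algebra_simps)
  then show "\<exists>k::nat. add x \<zeta> y = c * real k" by blast
qed (use assms in \<open>auto simp: add_def indicator_def configs_outside\<close>)

lemma sum_add: "x \<in> S \<Longrightarrow> (\<Sum>y\<in>S. add x \<zeta> y) = (\<Sum>y\<in>S. \<zeta> y) + c"
  using finite_S by (simp add: add_def sum.distrib sum_distrib_left[symmetric] indicator_def)

lemma bij_betw_add:
  assumes x: "x \<in> S"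
  shows "bij_betw (add x) (low_mass (R - c)) {\<eta>\<in>low_mass R. \<eta> x \<noteq> 0}"
proof (rule bij_betwI[where g = "\<lambda>\<eta> z. \<eta> z - c * indicator {x} z"])
  show "add x \<in> low_mass (R - c) \<rightarrow> {\<eta>\<in>low_mass R. \<eta> x \<noteq> 0}"
  proof
    fix \<zeta> assume \<zeta>: "\<zeta> \<in> low_mass (R - c)"
    then have "\<zeta> x \<ge> 0" by (auto simp: low_mass_def intro: configs_nonneg)
    then show "add x \<zeta> \<in> {\<eta>\<in>low_mass R. \<eta> x \<noteq> 0}"
      using \<zeta> x c add_configs by (auto simp: low_mass_def sum_add add_same)
  qed
  show "(\<lambda>\<eta> z. \<eta> z - c * indicator {x} z) \<in> {\<eta>\<in>low_mass R. \<eta> x \<noteq> 0} \<rightarrow> low_mass (R - c)"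
  proof
    fix \<eta> assume \<eta>: "\<eta> \<in> {\<eta>\<in>low_mass R. \<eta> x \<noteq> 0}"
    then have conf: "\<eta> \<in> configs" by (simp add: low_mass_def)
    let ?\<zeta> = "\<lambda>z. \<eta> z - c * indicator {x} z"
    have "?\<zeta> \<in> configs"
    proof (rule configsI)
      fix y assume y: "y \<in> S"
      obtain k :: nat where k: "\<eta> y = c * real k" using configs_nth[OF conf y] by blast
      show "\<exists>k::nat. ?\<zeta> y = c * real k"
      proof (cases "y = x")
        case True
        then have "k \<noteq> 0" using \<eta> k by auto
        then have "?\<zeta> y = c * real (k - 1)" using True k by (simp add: of_nat_diff algebra_simps)
        then show ?thesis by blast
      qed (use k in auto)
    qed (use x configs_outside[OF conf] in \<open>auto simp: indicator_def\<close>)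
    moreover have "(\<Sum>y\<in>S. ?\<zeta> y) = (\<Sum>y\<in>S. \<eta> y) - c"
      using finite_S x by (simp add: sum_subtractf sum_distrib_left[symmetric] indicator_def)
    ultimately show "?\<zeta> \<in> low_mass (R - c)" using \<eta> by (simp add: low_mass_def)
  qed
qed (auto simp: add_def)

text \<open>Removing the particle lowers the mass bound by \<open>c\<close>. States without a
  particle at x have no preimage; in the application their terms vanish because the rate at an empty
  site is 0.\<close>

lemma sum_low_eq_sum_add:
  fixes h :: "('s \<Rightarrow> real) \<Rightarrow> real"
  assumes x: "x \<in> S" and h: "\<And>\<eta>. \<eta> x = 0 \<Longrightarrow> h \<eta> = 0"
  shows "(\<Sum>\<eta>\<in>low_mass R. h \<eta>) = (\<Sum>\<zeta>\<in>low_mass (R - c). h (add x \<zeta>))"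
proof -
  have "(\<Sum>\<eta>\<in>low_mass R. h \<eta>) = (\<Sum>\<eta>\<in>{\<eta>\<in>low_mass R. \<eta> x \<noteq> 0}. h \<eta>)"
    using h by (intro sum.mono_neutral_right finite_low) auto
  also have "\<dots> = (\<Sum>\<zeta>\<in>low_mass (R - c). h (add x \<zeta>))"
    by (rule sum.reindex_bij_betw[symmetric, OF bij_betw_add[OF x]])
  finally show ?thesis .
qed

lemma weighted_sum_low:
  assumes x: "x \<in> S"
  shows "(\<Sum>\<eta>\<in>low_mass R. weight \<eta> * (\<eta> x) powr \<alpha> * h \<eta>) = a powr \<alpha> * (\<Sum>\<zeta>\<in>low_mass (R - c). weight \<zeta> * h (add x \<zeta>))"
proof -
  have "(\<Sum>\<eta>\<in>low_mass R. weight \<eta> * (\<eta> x) powr \<alpha> * h \<eta>)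
    = (\<Sum>\<zeta>\<in>low_mass (R - c). weight (add x \<zeta>) * (add x \<zeta> x) powr \<alpha> * h (add x \<zeta>))"
    by (rule sum_low_eq_sum_add[OF x]) simp
  also have "\<dots> = (\<Sum>\<zeta>\<in>low_mass (R - c). (weight \<zeta> * a powr \<alpha>) * h (add x \<zeta>))"
    using weight_add[OF _ x] by (intro sum.cong) (auto simp: low_mass_def add_same)
  finally show ?thesis by (simp add: sum_distrib_left mult_ac)
qed

text \<open>The energy of exchanges between two arbitrary sites. The factor 1/c of the jump rate is
  left out here and reappears in \<open>generator_quadratic_form\<close>.\<close>

definition dirichlet :: "real \<Rightarrow> (('s \<Rightarrow> real) \<Rightarrow> real) \<Rightarrow> 's \<Rightarrow> 's \<Rightarrow> real" where
  "dirichlet R g x y = a powr \<alpha> * (\<Sum>\<zeta>\<in>low_mass (R - c). weight \<zeta> * (g (add x \<zeta>) - g (add y \<zeta>))\<^sup>2)"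

text \<open>For distinct x and y this is minus the exchange generator applied to the inverse square
  root of \<open>weight\<close>, divided by that function: expanded, it is \<open>(\<eta> x) powr
  \<alpha> - (\<eta> x) powr (\<alpha> / 2) * (\<eta> y + c) powr (\<alpha> / 2)\<close> plus the
  same with x and y swapped. The form chosen shows a square and two corrections that vanish with
  \<open>c\<close>.\<close>

definition gap :: "'s \<Rightarrow> 's \<Rightarrow> ('s \<Rightarrow> real) \<Rightarrow> real" where
  "gap x y \<eta> = ((\<eta> x) powr (\<alpha> / 2) - (\<eta> y) powr (\<alpha> / 2))\<^sup>2
     - (\<eta> x) powr (\<alpha> / 2) * ((\<eta> y + c) powr (\<alpha> / 2) - (\<eta> y) powr (\<alpha> / 2))
     - (\<eta> y) powr (\<alpha> / 2) * ((\<eta> x + c) powr (\<alpha> / 2) - (\<eta> x) powr (\<alpha> / 2))"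

lemma powr_half_square: "u powr (\<alpha> / 2) * u powr (\<alpha> / 2) = u powr \<alpha>" for u :: real
  by (simp add: powr_add[symmetric])

text \<open>
  Bounding the cross term \<open>2 g (add x \<zeta>) g (add y \<zeta>)\<close> by \<open>r g (add x \<zeta>)\<^sup>2 + g (add y \<zeta>)\<^sup>2 / r\<close>,
  where \<open>r\<close> is the \<open>\<alpha>/2\<close>-th power of the ratio of the occupations after the jump, is optimal for
  \<open>g\<close> proportional to the inverse square root of the equilibrium weight.
\<close>

lemma dirichlet_ge_gap:
  assumes x: "x \<in> S" and y: "y \<in> S"
  shows "(\<Sum>\<eta>\<in>low_mass R. weight \<eta> * (g \<eta>)\<^sup>2 * gap x y \<eta>) \<le> dirichlet R g x y"
proof (cases "x = y")
  \<comment> \<open>A displacement may wrap around to the same site; then the square in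
    \<open>gap\<close> vanishes and only the nonpositive corrections remain, while the energy is
    nonnegative.\<close>
  case True
  have "weight \<eta> * (g \<eta>)\<^sup>2 * gap x y \<eta> \<le> 0" if "\<eta> \<in> low_mass R" for \<eta>
  proof -
    have "\<eta> x \<ge> 0" using that by (auto simp: low_mass_def intro: configs_nonneg)
    then have "(\<eta> x) powr (\<alpha> / 2) \<le> (\<eta> x + c) powr (\<alpha> / 2)" using \<alpha> c by (intro powr_mono2) auto
    then have "gap x y \<eta> \<le> 0" unfolding gap_def True[symmetric] by (simp add: mult_nonneg_nonneg)
    then show ?thesis using weight_pos[of \<eta>] by (intro mult_nonneg_nonpos) auto
  qed
  then have "(\<Sum>\<eta>\<in>low_mass R. weight \<eta> * (g \<eta>)\<^sup>2 * gap x y \<eta>) \<le> 0" by (rule sum_nonpos)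
  also have "0 \<le> dirichlet R g x y"
    unfolding dirichlet_def using weight_pos by (intro mult_nonneg_nonneg sum_nonneg) (auto intro: less_imp_le)
  finally show ?thesis .
next
  case False
  let ?p = "\<alpha> / 2"
  define r where "r \<zeta> = (\<zeta> y + c) powr ?p / (\<zeta> x + c) powr ?p" for \<zeta> :: "'s \<Rightarrow> real"
  \<comment> \<open>Pulling out the full rate at the departure site u prepares the change of
    variables \<open>weighted_sum_low\<close>; where u is empty, both sides of \<open>half\<close>
    vanish.\<close>
  define G where "G u w \<eta> = 1 - (\<eta> w + c) powr ?p / (\<eta> u) powr ?p" for u w :: 's and \<eta> :: "'s \<Rightarrow> real"
  have half: "weight \<eta> * (\<eta> u) powr \<alpha> * ((g \<eta>)\<^sup>2 * G u w \<eta>) =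
      weight \<eta> * (g \<eta>)\<^sup>2 * ((\<eta> u) powr \<alpha> - (\<eta> u) powr ?p * (\<eta> w + c) powr ?p)" for u w \<eta>
  proof -
    have *: "(\<eta> u) powr \<alpha> - (\<eta> u) powr ?p * (\<eta> w + c) powr ?p = (\<eta> u) powr \<alpha> * G u w \<eta>"
      unfolding G_def powr_half_square[symmetric] by (cases "\<eta> u = 0") (auto simp: field_simps)
    show ?thesis unfolding * by (simp only: mult_ac)
  qed
  have "(\<Sum>\<eta>\<in>low_mass R. weight \<eta> * (g \<eta>)\<^sup>2 * gap x y \<eta>) =
    (\<Sum>\<eta>\<in>low_mass R. weight \<eta> * (\<eta> x) powr \<alpha> * ((g \<eta>)\<^sup>2 * G x y \<eta>))
    + (\<Sum>\<eta>\<in>low_mass R. weight \<eta> * (\<eta> y) powr \<alpha> * ((g \<eta>)\<^sup>2 * G y x \<eta>))"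
    unfolding half sum.distrib[symmetric]
  proof (intro sum.cong refl)
    fix \<eta>
    have "gap x y \<eta> = ((\<eta> x) powr \<alpha> - (\<eta> x) powr ?p * (\<eta> y + c) powr ?p)
        + ((\<eta> y) powr \<alpha> - (\<eta> y) powr ?p * (\<eta> x + c) powr ?p)"
      unfolding gap_def powr_half_square[symmetric] by (simp add: power2_eq_square algebra_simps)
    then show "weight \<eta> * (g \<eta>)\<^sup>2 * gap x y \<eta> =
      weight \<eta> * (g \<eta>)\<^sup>2 * ((\<eta> x) powr \<alpha> - (\<eta> x) powr ?p * (\<eta> y + c) powr ?p)
      + weight \<eta> * (g \<eta>)\<^sup>2 * ((\<eta> y) powr \<alpha> - (\<eta> y) powr ?p * (\<eta> x + c) powr ?p)"
      by (simp only: distrib_left)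
  qed
  also have "\<dots> = a powr \<alpha> * (\<Sum>\<zeta>\<in>low_mass (R - c). weight \<zeta> *
      ((g (add x \<zeta>))\<^sup>2 * (1 - r \<zeta>) + (g (add y \<zeta>))\<^sup>2 * (1 - 1 / r \<zeta>)))"
    unfolding weighted_sum_low[OF x] weighted_sum_low[OF y] distrib_left[symmetric] sum.distrib[symmetric]
    using False by (simp add: G_def r_def add_same add_other)
  also have "\<dots> \<le> dirichlet R g x y"
    unfolding dirichlet_def
  proof (intro mult_left_mono sum_mono)
    fix \<zeta> assume "\<zeta> \<in> low_mass (R - c)"
    then have "\<zeta> x \<ge> 0" "\<zeta> y \<ge> 0" by (auto simp: low_mass_def intro: configs_nonneg)
    then have r: "r \<zeta> > 0" unfolding r_def using c by (intro divide_pos_pos) auto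
    let ?u = "g (add x \<zeta>)" and ?w = "g (add y \<zeta>)"
    have "0 \<le> (r \<zeta> * ?u - ?w)\<^sup>2 / r \<zeta>" using r by simp
    also have "\<dots> = r \<zeta> * ?u\<^sup>2 - 2 * ?u * ?w + ?w\<^sup>2 / r \<zeta>"
      using r by (simp add: power2_eq_square field_simps)
    finally show "?u\<^sup>2 * (1 - r \<zeta>) + ?w\<^sup>2 * (1 - 1 / r \<zeta>) \<le> (?u - ?w)\<^sup>2"
      by (simp add: power2_eq_square algebra_simps)
  qed (use weight_pos in \<open>auto intro: less_imp_le\<close>)
  finally show ?thesis .
qed

text \<open>One directed edge contributes one of the two halves (v - w) v and (w - v) w of the
  square (v - w)(v - w); by \<open>dirichlet_eq\<close> the opposite direction supplies the
  other.\<close>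

lemma generator_term:
  assumes x: "x \<in> S"
  shows "(\<Sum>\<eta>\<in>low_mass R. weight \<eta> * g \<eta> * ((\<eta> x) powr \<alpha> * (g (\<lambda>z. \<eta> z + c * indicator {y} z - c * indicator {x} z) - g \<eta>)))
    = - (a powr \<alpha> * (\<Sum>\<zeta>\<in>low_mass (R - c). weight \<zeta> * ((g (add x \<zeta>) - g (add y \<zeta>)) * g (add x \<zeta>))))"
proof -
  have j: "(\<lambda>z. add x \<zeta> z + c * indicator {y} z - c * indicator {x} z) = add y \<zeta>" for \<zeta>
    by (simp add: add_def fun_eq_iff)
  let ?j = "\<lambda>\<eta>. \<lambda>z. \<eta> z + c * indicator {y} z - c * indicator {x} z"
  have "(\<Sum>\<eta>\<in>low_mass R. weight \<eta> * g \<eta> * ((\<eta> x) powr \<alpha> * (g (?j \<eta>) - g \<eta>))) =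
    (\<Sum>\<eta>\<in>low_mass R. weight \<eta> * (\<eta> x) powr \<alpha> * (g \<eta> * (g (?j \<eta>) - g \<eta>)))"
    by (simp add: mult_ac)
  also have "\<dots> = a powr \<alpha> * (\<Sum>\<zeta>\<in>low_mass (R - c). weight \<zeta> * (g (add x \<zeta>) * (g (add y \<zeta>) - g (add x \<zeta>))))"
    unfolding weighted_sum_low[OF x] j ..
  also have "\<dots> = - (a powr \<alpha> * (\<Sum>\<zeta>\<in>low_mass (R - c). weight \<zeta> * ((g (add x \<zeta>) - g (add y \<zeta>)) * g (add x \<zeta>))))"
    by (simp add: sum_negf[symmetric] sum_distrib_left algebra_simps)
  finally show ?thesis .
qed

lemma dirichlet_sym: "dirichlet R g x y = dirichlet R g y x"
  unfolding dirichlet_def by (simp add: power2_commute)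

lemma dirichlet_eq: 
  "dirichlet R g x y = a powr \<alpha> * (\<Sum>\<zeta>\<in>low_mass (R - c). weight \<zeta> * ((g (add x \<zeta>) - g (add y \<zeta>)) * g (add x \<zeta>)))
    + a powr \<alpha> * (\<Sum>\<zeta>\<in>low_mass (R - c). weight \<zeta> * ((g (add y \<zeta>) - g (add x \<zeta>)) * g (add y \<zeta>)))"
proof -
  have "weight \<zeta> * (u - w)\<^sup>2 = weight \<zeta> * ((u - w) * u) + weight \<zeta> * ((w - u) * w)" for \<zeta> u w
    by (simp add: power2_eq_square algebra_simps)
  then show ?thesis unfolding dirichlet_def distrib_left[symmetric] sum.distrib[symmetric] by (simp only:)
qed

end

section \<open>Energy estimates on the torus\<close>

text \<open>Convexity by way of Young's inequality with weights 1/p and 1 - 1/p. At u = 0 and p = 1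
  the convention 0 powr 0 = 0 replaces the slope 1 by 0, which still gives a supporting line on w
  \<ge> 0.\<close>

lemma powr_tangent:
  fixes u w p :: real
  assumes p: "p \<ge> 1" and u: "u \<ge> 0" and w: "w \<ge> 0"
  shows "u powr p + p * u powr (p - 1) * (w - u) \<le> w powr p"
proof (cases "u = 0 \<or> w = 0")
  case True
  have "u powr p + p * u powr (p - 1) * (0 - u) \<le> 0"
  proof (cases "u = 0")
    case False
    then have "u powr p = u powr (p - 1) * u" using u powr_add[of u "p - 1" 1] by simp
    then have "u powr p + p * u powr (p - 1) * (0 - u) = - ((p - 1) * u powr p)" by (simp add: algebra_simps)
    then show ?thesis using p by simp
  qed simp
  then show ?thesis using True by auto
next
  case False
  then have uw: "u > 0" "w > 0" using u w by auto
  have "(w powr p) powr (1 / p) * (u powr p) powr (1 - 1 / p) \<le> 1 / p * w powr p + (1 - 1 / p) * u powr p"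
    using p uw by (intro Youngs_inequality_0) auto
  also have "(w powr p) powr (1 / p) * (u powr p) powr (1 - 1 / p) = w * u powr (p - 1)"
    using p uw by (simp add: powr_powr right_diff_distrib)
  finally have "p * (w * u powr (p - 1)) \<le> p * (1 / p * w powr p + (1 - 1 / p) * u powr p)"
    using p by (intro mult_left_mono) auto
  also have "\<dots> = w powr p + (p - 1) * u powr p" using p by (simp add: field_simps)
  finally have "p * u powr (p - 1) * w \<le> w powr p + (p - 1) * u powr p" by (simp add: mult_ac)
  moreover have "u powr p = u powr (p - 1) * u" using uw powr_add[of u "p - 1" 1] by simp
  ultimately show ?thesis by (simp add: algebra_simps)
qed

text \<open>Comparison with an average reduces to comparison with single values. If the average is
  larger, the tangent at \<open>A\<close> gives Jensen's inequality; if u is larger, the tangent at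
  u together with \<open>u powr (p - 1) * (u - b i) \<le> \<bar>u powr p - b i powr p\<bar>\<close>
  costs the factor p.\<close>

lemma abs_powr_diff_average_le:
  fixes b :: "'i \<Rightarrow> real" and u p :: real
  assumes p: "p \<ge> 1" and u: "u \<ge> 0" and b: "\<And>i. i \<in> I \<Longrightarrow> b i \<ge> 0" and I: "finite I" "I \<noteq> {}"
  defines "A \<equiv> (\<Sum>i\<in>I. b i) / card I"
  shows "\<bar>u powr p - A powr p\<bar> \<le> p * ((\<Sum>i\<in>I. \<bar>u powr p - b i powr p\<bar>) / card I)"
proof -
  have n: "real (card I) > 0" using I by (simp add: card_gt_0_iff)
  have A0: "A \<ge> 0" unfolding A_def using b by (intro divide_nonneg_nonneg sum_nonneg) auto
  have 1: "A powr p - u powr p \<le> (\<Sum>i\<in>I. \<bar>u powr p - b i powr p\<bar>) / card I"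
  proof -
    have "(\<Sum>i\<in>I. A powr p + p * A powr (p - 1) * (b i - A)) \<le> (\<Sum>i\<in>I. b i powr p)"
      using p A0 b by (intro sum_mono powr_tangent) auto
    also have "(\<Sum>i\<in>I. A powr p + p * A powr (p - 1) * (b i - A)) = real (card I) * A powr p
        + p * A powr (p - 1) * ((\<Sum>i\<in>I. b i) - real (card I) * A)"
      by (simp add: sum.distrib sum_distrib_left[symmetric] sum_subtractf)
    also have "(\<Sum>i\<in>I. b i) - real (card I) * A = 0" using n by (simp add: A_def)
    finally have "real (card I) * (A powr p - u powr p) \<le> (\<Sum>i\<in>I. b i powr p - u powr p)"
      by (simp add: sum_subtractf right_diff_distrib)
    also have "\<dots> \<le> (\<Sum>i\<in>I. \<bar>u powr p - b i powr p\<bar>)" by (intro sum_mono) auto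
    finally show ?thesis using n by (simp add: field_simps)
  qed
  have 2: "u powr p - A powr p \<le> p * ((\<Sum>i\<in>I. \<bar>u powr p - b i powr p\<bar>) / card I)"
  proof -
    have le: "u powr (p - 1) * (u - b i) \<le> \<bar>u powr p - b i powr p\<bar>" if i: "i \<in> I" for i
    proof (cases "b i \<le> u \<and> b i > 0")
      case True
      then have "b i powr p = b i powr (p - 1) * b i" "u powr p = u powr (p - 1) * u"
        using powr_add[of "b i" "p - 1" 1] powr_add[of u "p - 1" 1] by simp_all
      moreover have "b i powr (p - 1) * b i \<le> u powr (p - 1) * b i"
        using True p by (intro mult_right_mono powr_mono2) auto
      ultimately show ?thesis by (simp add: right_diff_distrib)
    next
      case False
      then consider "b i > u" | "b i = 0" using b[OF i] by fastforce
      then show ?thesis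
      proof cases
        case 1
        then have "u powr (p - 1) * (u - b i) \<le> 0" by (simp add: mult_nonneg_nonpos)
        then show ?thesis by linarith
      next
        case 2
        then show ?thesis using u powr_add[of u "p - 1" 1] by (cases "u = 0") auto
      qed
    qed
    have "u powr p + p * u powr (p - 1) * (A - u) \<le> A powr p" by (rule powr_tangent[OF p u A0])
    then have "u powr p - A powr p \<le> p * (u powr (p - 1) * (u - A))" by (simp add: algebra_simps)
    also have "u powr (p - 1) * (u - A) = (\<Sum>i\<in>I. u powr (p - 1) * (u - b i)) / card I"
    proof -
      have "u - A = (\<Sum>i\<in>I. u - b i) / card I"
        unfolding A_def using n by (simp add: sum_subtractf field_simps)
      then show ?thesis by (simp add: sum_distrib_left[symmetric])
    qed
    also have "p * \<dots> \<le> p * ((\<Sum>i\<in>I. \<bar>u powr p - b i powr p\<bar>) / card I)"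
      using p n by (intro mult_left_mono divide_right_mono sum_mono le) auto
    finally show ?thesis .
  qed
  have "(\<Sum>i\<in>I. \<bar>u powr p - b i powr p\<bar>) / card I \<le> p * ((\<Sum>i\<in>I. \<bar>u powr p - b i powr p\<bar>) / card I)"
    using p mult_right_mono[of 1 p "(\<Sum>i\<in>I. \<bar>u powr p - b i powr p\<bar>) / card I"]
    by (simp add: sum_nonneg)
  then show ?thesis using 1 2 by linarith
qed

text \<open>At least half of the sites carry mass at most \<open>2K\<close>; each site is compared with those.\<close>

lemma sum_powr_le_variation:
  fixes u :: "'s \<Rightarrow> real" and K p :: real
  assumes S: "finite S" "S \<noteq> {}" and u: "\<And>x. x \<in> S \<Longrightarrow> u x \<ge> 0"
    and K: "K > 0" and mass: "(\<Sum>x\<in>S. u x) \<le> K * card S" and p: "p \<ge> 0"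
  shows "(\<Sum>x\<in>S. (u x powr p)\<^sup>2) \<le> 4 / card S * (\<Sum>x\<in>S. \<Sum>y\<in>S. (u x powr p - u y powr p)\<^sup>2)
      + 4 * card S * ((2 * K) powr p)\<^sup>2"
proof -
  let ?n = "real (card S)"
  have n: "?n > 0" using S by (simp add: card_gt_0_iff)
  define H where "H = {y\<in>S. u y \<le> 2 * K}"
  have H: "finite H" "H \<subseteq> S" using S by (auto simp: H_def)
  \<comment> \<open>Chebyshev: a site outside \<open>H\<close> carries more than 2 K, while the
    total mass is at most K per site.\<close>
  have half: "?n / 2 \<le> real (card H)"
  proof -
    have "2 * K * real (card (S - H)) = (\<Sum>x\<in>S - H. 2 * K)" by simp
    also have "\<dots> \<le> (\<Sum>x\<in>S - H. u x)" by (intro sum_mono) (auto simp: H_def)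
    also have "\<dots> \<le> (\<Sum>x\<in>S. u x)" using S u by (intro sum_mono2) auto
    also have "\<dots> \<le> K * ?n" by (rule mass)
    finally have "2 * real (card (S - H)) \<le> ?n" using K by simp
    moreover have "real (card (S - H)) = ?n - real (card H)"
      using H S by (simp add: card_Diff_subset card_mono of_nat_diff)
    ultimately show ?thesis by linarith
  qed
  have pt: "(u x powr p)\<^sup>2 \<le> 4 / ?n * (\<Sum>y\<in>S. (u x powr p - u y powr p)\<^sup>2) + 4 * ((2 * K) powr p)\<^sup>2" if "x \<in> S" for x
  proof -
    let ?v = "u x powr p" and ?k = "((2 * K) powr p)\<^sup>2"
    have "?n / 2 * ?v\<^sup>2 \<le> real (card H) * ?v\<^sup>2" using half by (intro mult_right_mono) auto
    also have "\<dots> = (\<Sum>y\<in>H. ?v\<^sup>2)" by simp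
    also have "\<dots> \<le> (\<Sum>y\<in>H. 2 * (?v - u y powr p)\<^sup>2 + 2 * ?k)"
    proof (rule sum_mono)
      fix y assume y: "y \<in> H"
      then have "u y powr p \<le> (2 * K) powr p" using u p by (intro powr_mono2) (auto simp: H_def)
      then have "(u y powr p)\<^sup>2 \<le> ?k" by (intro power_mono) auto
      \<comment> \<open>The difference of the two sides is the square of v - 2 w, where w is the
        value at y. This factor 2 and the one from \<open>half\<close> make the constant 4.\<close>
      moreover have "?v\<^sup>2 \<le> 2 * (?v - u y powr p)\<^sup>2 + 2 * (u y powr p)\<^sup>2"
        using zero_le_power2[of "?v - 2 * u y powr p"] by (simp add: power2_eq_square algebra_simps)
      ultimately show "?v\<^sup>2 \<le> 2 * (?v - u y powr p)\<^sup>2 + 2 * ?k" by linarith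
    qed
    also have "\<dots> \<le> (\<Sum>y\<in>S. 2 * (?v - u y powr p)\<^sup>2 + 2 * ?k)" using S H by (intro sum_mono2) auto
    also have "\<dots> = 2 * (\<Sum>y\<in>S. (?v - u y powr p)\<^sup>2) + 2 * (?n * ?k)"
      by (simp add: sum.distrib sum_distrib_left)
    finally show ?thesis using n by (simp add: field_simps)
  qed
  have "(\<Sum>x\<in>S. (u x powr p)\<^sup>2) \<le> (\<Sum>x\<in>S. 4 / ?n * (\<Sum>y\<in>S. (u x powr p - u y powr p)\<^sup>2) + 4 * ((2 * K) powr p)\<^sup>2)"
    by (intro sum_mono pt)
  then show ?thesis by (simp add: sum.distrib sum_distrib_left mult_ac)
qed

section \<open>Exchange energies and the generator on the torus\<close>

locale zrp_torus = zrp_sites "torus N :: (real ^ 'd) set" \<alpha> c a Z for N :: nat and \<alpha> c a Z +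
  assumes N: "N \<ge> 1"
begin

definition total_dirichlet :: "real \<Rightarrow> ((real ^ 'd \<Rightarrow> real) \<Rightarrow> real) \<Rightarrow> real" where
  "total_dirichlet R g = (\<Sum>i\<in>UNIV. \<Sum>x\<in>torus N. dirichlet R g x (translate N x (axis i 1)))"

lemma dirichlet_nonneg: "dirichlet R g x y \<ge> 0"
  unfolding dirichlet_def using weight_pos by (intro mult_nonneg_nonneg sum_nonneg) (auto intro: less_imp_le)

lemma total_dirichlet_nonneg: "total_dirichlet R g \<ge> 0"
  unfolding total_dirichlet_def by (intro sum_nonneg dirichlet_nonneg)

text \<open>The moving-particle argument. The weight in \<open>dirichlet\<close> is that of \<zeta>,
  without the moving particle, so one l2 space serves all displacements and shifting x leaves its
  norm unchanged. Hence \<open>n\<close> is even and subadditive in z: at most d L unit steps give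
  the square of d L in the energy.\<close>

lemma dirichlet_translate_le:
  assumes z: "\<And>i. \<bar>z $ i\<bar> \<le> int L"
  shows "(\<Sum>x\<in>torus N. dirichlet R g x (translate N x z)) \<le> (real CARD('d) * real L)\<^sup>2 * total_dirichlet R g"
proof -
  define I where "I = (torus N :: (real ^ 'd) set) \<times> low_mass (R - c)"
  define f where "f z = (\<lambda>(x, \<zeta>). sqrt (weight \<zeta>) * (g (add x \<zeta>) - g (add (translate N x z) \<zeta>)))" for z
  define n where "n z = L2_set (f z) I" for z
  have n2: "(\<Sum>x\<in>torus N. dirichlet R g x (translate N x z)) = a powr \<alpha> * (n z)\<^sup>2" for z
  proof -
    have "(n z)\<^sup>2 = (\<Sum>p\<in>I. (f z p)\<^sup>2)" unfolding n_def L2_set_def by (simp add: sum_nonneg)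
    also have "\<dots> = (\<Sum>x\<in>torus N. \<Sum>\<zeta>\<in>low_mass (R - c). weight \<zeta> * (g (add x \<zeta>) - g (add (translate N x z) \<zeta>))\<^sup>2)"
      unfolding I_def f_def sum.cartesian_product
      by (intro sum.cong) (auto simp: power_mult_distrib weight_pos less_imp_le)
    finally show ?thesis by (simp add: dirichlet_def sum_distrib_left)
  qed
  have n0: "n z \<ge> 0" for z by (simp add: n_def)
  have "n z \<le> (\<Sum>i\<in>UNIV. \<bar>of_int (z $ i)\<bar> * n (axis i 1))" for z
  proof (rule subadditive_int_vec_bound)
    have "f 0 p = 0" if "p \<in> I" for p using that by (auto simp: f_def I_def translate_0)
    then show "n 0 \<le> 0" unfolding n_def by (simp add: L2_set_def)
  next
    fix z w
    have "n (z + w) = L2_set (\<lambda>p. f z p + f w (translate N (fst p) z, snd p)) I"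
      unfolding n_def by (intro L2_set_cong) (auto simp: f_def translate_translate algebra_simps)
    also have "\<dots> \<le> n z + L2_set (\<lambda>p. f w (translate N (fst p) z, snd p)) I"
      unfolding n_def by (rule L2_set_triangle_ineq)
    also have "L2_set (\<lambda>p. f w (translate N (fst p) z, snd p)) I = n w"
    proof -
      have "(\<Sum>x\<in>torus N. \<Sum>\<zeta>\<in>low_mass (R - c). (f w (translate N x z, \<zeta>))\<^sup>2) =
        (\<Sum>x\<in>torus N. \<Sum>\<zeta>\<in>low_mass (R - c). (f w (x, \<zeta>))\<^sup>2)" by (rule sum_translate[OF N])
      then show ?thesis unfolding n_def L2_set_def I_def sum.cartesian_product by (simp add: case_prod_unfold)
    qed
    finally show "n (z + w) \<le> n z + n w" .
  next
    fix z
    have "(\<Sum>x\<in>torus N. dirichlet R g x (translate N x (- z)))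
      = (\<Sum>x\<in>torus N. dirichlet R g (translate N x z) (translate N (translate N x z) (- z)))"
      by (rule sum_translate[OF N, symmetric])
    also have "\<dots> = (\<Sum>x\<in>torus N. dirichlet R g x (translate N x z))"
      by (intro sum.cong refl) (simp add: translate_translate translate_0 dirichlet_sym)
    finally have "(n (- z))\<^sup>2 = (n z)\<^sup>2" unfolding n2 using a by simp
    then show "n (- z) = n z" using n0 by (simp add: power2_eq_iff_nonneg)
  qed
  also have "(\<Sum>i\<in>UNIV. \<bar>of_int (z $ i)\<bar> * n (axis i 1)) \<le>
      (\<Sum>i\<in>(UNIV :: 'd set). real L * sqrt (\<Sum>j\<in>UNIV. (n (axis j 1))\<^sup>2))"
  proof (intro sum_mono mult_mono)
    fix i
    have "\<bar>z $ i\<bar> \<le> int L" by (rule z)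
    then have "real_of_int \<bar>z $ i\<bar> \<le> real_of_int (int L)" by (simp only: of_int_le_iff)
    then show "\<bar>real_of_int (z $ i)\<bar> \<le> real L" by simp
    have "n (axis i 1) = sqrt ((n (axis i 1))\<^sup>2)" using n0 by simp
    also have "\<dots> \<le> sqrt (\<Sum>j\<in>UNIV. (n (axis j 1))\<^sup>2)" by (intro real_sqrt_le_mono member_le_sum) auto
    finally show "n (axis i 1) \<le> sqrt (\<Sum>j\<in>UNIV. (n (axis j 1))\<^sup>2)" .
  qed (use n0 in auto)
  also have "\<dots> = (real CARD('d) * real L) * sqrt (\<Sum>j\<in>UNIV. (n (axis j 1))\<^sup>2)" by simp
  finally have "(n z)\<^sup>2 \<le> ((real CARD('d) * real L) * sqrt (\<Sum>j\<in>UNIV. (n (axis j 1))\<^sup>2))\<^sup>2"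
    using n0 by (intro power_mono)
  also have "\<dots> = (real CARD('d) * real L)\<^sup>2 * (\<Sum>j\<in>UNIV. (n (axis j 1))\<^sup>2)"
    unfolding power_mult_distrib by (subst real_sqrt_pow2) (auto intro!: sum_nonneg)
  finally have "a powr \<alpha> * (n z)\<^sup>2 \<le> a powr \<alpha> * ((real CARD('d) * real L)\<^sup>2 * (\<Sum>j\<in>UNIV. (n (axis j 1))\<^sup>2))"
    by (intro mult_left_mono) auto
  also have "\<dots> = (real CARD('d) * real L)\<^sup>2 * total_dirichlet R g"
    unfolding total_dirichlet_def n2 by (simp add: sum_distrib_left mult_ac)
  finally show ?thesis unfolding n2 .
qed

text \<open>Backward directions, shifted by one step, complete the forward halves to
  \<open>dirichlet\<close>. What remains is the prefactor 1/2 of the generator and the rate factor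
  1/c.\<close>

lemma generator_quadratic_form:
  "(\<Sum>\<eta>\<in>low_mass R. weight \<eta> * g \<eta> * zrp_generator \<alpha> N c g \<eta>) = - (1 / (2 * c)) * total_dirichlet R g"
proof -
  define b where "b x y = a powr \<alpha> * (\<Sum>\<zeta>\<in>low_mass (R - c). weight \<zeta> * ((g (add x \<zeta>) - g (add y \<zeta>)) * g (add x \<zeta>)))" for x y
  have dir: "dirichlet R g x y = b x y + b y x" for x y
    unfolding b_def by (rule dirichlet_eq)
  let ?r = "\<lambda>\<eta> x y. (\<eta> x) powr \<alpha> * (g (\<lambda>z. \<eta> z + c * indicator {y} z - c * indicator {x} z) - g \<eta>)"
  have "zrp_generator \<alpha> N c g \<eta> = 1 / (2 * c) * (\<Sum>x\<in>torus N. \<Sum>i\<in>UNIV.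
      ?r \<eta> x (translate N x (axis i 1)) + ?r \<eta> x (translate N x (- axis i 1)))" for \<eta>
    unfolding zrp_generator_def jump_def sum_distrib_left
    by (intro sum.cong refl) (simp add: neighbour_eq_translate distrib_left)
  then have "(\<Sum>\<eta>\<in>low_mass R. weight \<eta> * g \<eta> * zrp_generator \<alpha> N c g \<eta>) =
    (\<Sum>\<eta>\<in>low_mass R. \<Sum>x\<in>torus N. \<Sum>i\<in>UNIV. 1 / (2 * c) * (weight \<eta> * g \<eta> * ?r \<eta> x (translate N x (axis i 1))
      + weight \<eta> * g \<eta> * ?r \<eta> x (translate N x (- axis i 1))))"
    by (simp add: sum_distrib_left distrib_left mult_ac)
  also have "\<dots> = (\<Sum>x\<in>torus N. \<Sum>i\<in>UNIV. \<Sum>\<eta>\<in>low_mass R. 1 / (2 * c) * (weight \<eta> * g \<eta> * ?r \<eta> x (translate N x (axis i 1))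
      + weight \<eta> * g \<eta> * ?r \<eta> x (translate N x (- axis i 1))))"
    by (subst sum.swap, rule sum.cong[OF refl], subst sum.swap, rule refl)
  also have "\<dots> = (\<Sum>x\<in>torus N. \<Sum>i\<in>UNIV. 1 / (2 * c) * (- b x (translate N x (axis i 1)) - b x (translate N x (- axis i 1))))"
  proof (intro sum.cong refl)
    fix x :: "real ^ 'd" and i assume x: "x \<in> torus N"
    have "(\<Sum>\<eta>\<in>low_mass R. weight \<eta> * g \<eta> * ?r \<eta> x y) = - b x y" for y
      unfolding b_def by (rule generator_term[OF x])
    then show "(\<Sum>\<eta>\<in>low_mass R. 1 / (2 * c) * (weight \<eta> * g \<eta> * ?r \<eta> x (translate N x (axis i 1))
      + weight \<eta> * g \<eta> * ?r \<eta> x (translate N x (- axis i 1)))) =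
      1 / (2 * c) * (- b x (translate N x (axis i 1)) - b x (translate N x (- axis i 1)))"
      unfolding sum_distrib_left[symmetric] sum.distrib by simp
  qed
  also have "\<dots> = (\<Sum>i\<in>UNIV. - (1 / (2 * c)) * ((\<Sum>x\<in>torus N. b x (translate N x (axis i 1)))
      + (\<Sum>x\<in>torus N. b x (translate N x (- axis i 1)))))"
  proof -
    have e: "1 / (2 * c) * (- u - w) = - (1 / (2 * c)) * (u + w)" for u w
      by (simp add: diff_divide_distrib add_divide_distrib)
    show ?thesis unfolding e by (subst sum.swap) (simp only: sum_distrib_left[symmetric] sum.distrib)
  qed
  also have "\<dots> = (\<Sum>i\<in>UNIV. - (1 / (2 * c)) * (\<Sum>x\<in>torus N. dirichlet R g x (translate N x (axis i 1))))"
  proof (intro sum.cong refl arg_cong2[of _ _ _ _ "(*)"])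
    fix i
    have "(\<Sum>x\<in>torus N. b x (translate N x (- axis i 1))) =
      (\<Sum>x\<in>torus N. b (translate N x (axis i 1)) (translate N (translate N x (axis i 1)) (- axis i 1)))"
      by (rule sum_translate[OF N, symmetric])
    also have "\<dots> = (\<Sum>x\<in>torus N. b (translate N x (axis i 1)) x)"
      by (intro sum.cong refl) (simp add: translate_translate translate_0)
    finally show "(\<Sum>x\<in>torus N. b x (translate N x (axis i 1))) + (\<Sum>x\<in>torus N. b x (translate N x (- axis i 1)))
      = (\<Sum>x\<in>torus N. dirichlet R g x (translate N x (axis i 1)))"
      by (simp add: dir sum.distrib)
  qed
  also have "\<dots> = - (1 / (2 * c)) * total_dirichlet R g"
    by (simp add: total_dirichlet_def sum_distrib_left)
  finally show ?thesis .
qed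

text \<open>Integration against the density g squared with respect to the weight on
  \<open>low_mass R\<close>. It is not normalised, so the estimates stay homogeneous in g.\<close>

definition mean :: "real \<Rightarrow> ((real ^ 'd \<Rightarrow> real) \<Rightarrow> real) \<Rightarrow> ((real ^ 'd \<Rightarrow> real) \<Rightarrow> real) \<Rightarrow> real" where
  "mean R g h = (\<Sum>\<eta>\<in>low_mass R. weight \<eta> * (g \<eta>)\<^sup>2 * h \<eta>)"

lemma mean_mono: "(\<And>\<eta>. \<eta> \<in> low_mass R \<Longrightarrow> h \<eta> \<le> h' \<eta>) \<Longrightarrow> mean R g h \<le> mean R g h'"
  unfolding mean_def using weight_pos
  by (intro sum_mono mult_left_mono mult_nonneg_nonneg) (auto intro: less_imp_le)

lemma mean_add: "mean R g (\<lambda>\<eta>. h \<eta> + h' \<eta>) = mean R g h + mean R g h'"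
  and mean_cmult: "mean R g (\<lambda>\<eta>. k * h \<eta>) = k * mean R g h"
  and mean_sum: "mean R g (\<lambda>\<eta>. \<Sum>i\<in>I. f i \<eta>) = (\<Sum>i\<in>I. mean R g (f i))"
proof -
  show "mean R g (\<lambda>\<eta>. h \<eta> + h' \<eta>) = mean R g h + mean R g h'"
    by (simp add: mean_def distrib_left sum.distrib)
  show "mean R g (\<lambda>\<eta>. k * h \<eta>) = k * mean R g h"
    unfolding mean_def sum_distrib_left by (intro sum.cong refl) simp
  show "mean R g (\<lambda>\<eta>. \<Sum>i\<in>I. f i \<eta>) = (\<Sum>i\<in>I. mean R g (f i))"
    unfolding mean_def sum_distrib_left by (rule sum.swap)
qed

lemma mean_nonneg: "(\<And>\<eta>. \<eta> \<in> low_mass R \<Longrightarrow> 0 \<le> h \<eta>) \<Longrightarrow> 0 \<le> mean R g h"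
  using mean_mono[of R "\<lambda>_. 0" h g] by (simp add: mean_def)

lemma low_nonneg: "\<eta> \<in> low_mass R \<Longrightarrow> \<eta> x \<ge> 0"
  by (auto simp: low_mass_def intro: configs_nonneg)

text \<open>\<omega> measures the effect of one more particle on the \<alpha>/2-th power, relative
  to 1 plus that power: for \<alpha> > 2 the increment is not uniformly small at large occupations.
  The price is an error containing \<alpha>-th moments, which has to be absorbed later.\<close>

lemma gradient_le_gap:
  assumes \<omega>: "\<omega> \<ge> 0" "\<And>u. u \<ge> 0 \<Longrightarrow> (u + c) powr (\<alpha> / 2) \<le> u powr (\<alpha> / 2) + \<omega> * (1 + u powr (\<alpha> / 2))"
    and nonneg: "\<eta> x \<ge> 0" "\<eta> y \<ge> 0"
  shows "((\<eta> x) powr (\<alpha> / 2) - (\<eta> y) powr (\<alpha> / 2))\<^sup>2 \<le>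
    gap x y \<eta> + 2 * \<omega> * (1 + (\<eta> x) powr \<alpha> + (\<eta> y) powr \<alpha>)"
proof -
  let ?v = "(\<eta> x) powr (\<alpha> / 2)" and ?w = "(\<eta> y) powr (\<alpha> / 2)"
  have "?v * ((\<eta> y + c) powr (\<alpha> / 2) - ?w) \<le> ?v * (\<omega> * (1 + ?w))"
    "?w * ((\<eta> x + c) powr (\<alpha> / 2) - ?v) \<le> ?w * (\<omega> * (1 + ?v))"
    using \<omega>(2)[OF nonneg(1)] \<omega>(2)[OF nonneg(2)] by (intro mult_left_mono; simp)+
  then have 1: "(?v - ?w)\<^sup>2 \<le> gap x y \<eta> + \<omega> * (?v + ?w + 2 * (?v * ?w))"
    unfolding gap_def by (simp add: algebra_simps)
  have "?v + ?w + 2 * (?v * ?w) \<le> 2 * (1 + ?v\<^sup>2 + ?w\<^sup>2)"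
  proof -
    have "2 * (1 + ?v\<^sup>2 + ?w\<^sup>2) - (?v + ?w + 2 * (?v * ?w)) = (?v - ?w)\<^sup>2 + (?v - 1 / 2)\<^sup>2 + (?w - 1 / 2)\<^sup>2 + 3 / 2"
      by (simp add: power2_eq_square algebra_simps)
    moreover have "\<dots> \<ge> 0" by simp
    ultimately show ?thesis by linarith
  qed
  then have 2: "\<omega> * (?v + ?w + 2 * (?v * ?w)) \<le> \<omega> * (2 * (1 + ?v\<^sup>2 + ?w\<^sup>2))" using \<omega>(1) by (rule mult_left_mono)
  have 3: "?v\<^sup>2 = (\<eta> x) powr \<alpha>" "?w\<^sup>2 = (\<eta> y) powr \<alpha>"
    by (simp_all only: power2_eq_square powr_half_square)
  have "(?v - ?w)\<^sup>2 \<le> gap x y \<eta> + \<omega> * (2 * (1 + (\<eta> x) powr \<alpha> + (\<eta> y) powr \<alpha>))"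
    using order_trans[OF 1 add_left_mono[OF 2]] unfolding 3 .
  then show ?thesis by (simp only: mult_ac)
qed

lemma sum_gradient_le:
  assumes \<omega>: "\<omega> \<ge> 0" "\<And>u. u \<ge> 0 \<Longrightarrow> (u + c) powr (\<alpha> / 2) \<le> u powr (\<alpha> / 2) + \<omega> * (1 + u powr (\<alpha> / 2))"
    and z: "\<And>i. \<bar>z $ i\<bar> \<le> int L"
  shows "mean R g (\<lambda>\<eta>. \<Sum>x\<in>torus N. ((\<eta> x) powr (\<alpha> / 2) - (\<eta> (translate N x z)) powr (\<alpha> / 2))\<^sup>2)
    \<le> (real CARD('d) * real L)\<^sup>2 * total_dirichlet R g
      + 2 * \<omega> * (real N ^ CARD('d) * mean R g (\<lambda>_. 1) + 2 * mean R g (\<lambda>\<eta>. \<Sum>x\<in>torus N. (\<eta> x) powr \<alpha>))"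
proof -
  have "mean R g (\<lambda>\<eta>. \<Sum>x\<in>torus N. ((\<eta> x) powr (\<alpha> / 2) - (\<eta> (translate N x z)) powr (\<alpha> / 2))\<^sup>2)
    \<le> mean R g (\<lambda>\<eta>. (\<Sum>x\<in>torus N. gap x (translate N x z) \<eta>)
      + 2 * \<omega> * (real N ^ CARD('d) * 1 + 2 * (\<Sum>x\<in>torus N. (\<eta> x) powr \<alpha>)))"
  proof (rule mean_mono)
    fix \<eta> assume \<eta>: "\<eta> \<in> low_mass R"
    have "(\<Sum>x\<in>torus N. ((\<eta> x) powr (\<alpha> / 2) - (\<eta> (translate N x z)) powr (\<alpha> / 2))\<^sup>2) \<le>
      (\<Sum>x\<in>torus N. gap x (translate N x z) \<eta> + 2 * \<omega> * (1 + (\<eta> x) powr \<alpha> + (\<eta> (translate N x z)) powr \<alpha>))"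
      by (intro sum_mono gradient_le_gap \<omega> low_nonneg[OF \<eta>])
    also have "\<dots> = (\<Sum>x\<in>torus N. gap x (translate N x z) \<eta>)
      + 2 * \<omega> * (real (card (torus N :: (real ^ 'd) set)) + (\<Sum>x\<in>torus N. (\<eta> x) powr \<alpha>)
        + (\<Sum>x\<in>torus N. (\<eta> (translate N x z)) powr \<alpha>))"
      by (simp only: sum.distrib sum_distrib_left[symmetric]) simp
    also have "(\<Sum>x\<in>torus N. (\<eta> (translate N x z)) powr \<alpha>) = (\<Sum>x\<in>torus N. (\<eta> x) powr \<alpha>)"
      by (rule sum_translate[OF N])
    finally show "(\<Sum>x\<in>torus N. ((\<eta> x) powr (\<alpha> / 2) - (\<eta> (translate N x z)) powr (\<alpha> / 2))\<^sup>2) \<le>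
      (\<Sum>x\<in>torus N. gap x (translate N x z) \<eta>)
      + 2 * \<omega> * (real N ^ CARD('d) * 1 + 2 * (\<Sum>x\<in>torus N. (\<eta> x) powr \<alpha>))"
      by (simp only: card_torus[OF N] mult_1_right of_nat_power mult_2 add.assoc)
  qed
  also have "\<dots> = (\<Sum>x\<in>torus N. mean R g (gap x (translate N x z)))
      + 2 * \<omega> * (real N ^ CARD('d) * mean R g (\<lambda>_. 1) + 2 * mean R g (\<lambda>\<eta>. \<Sum>x\<in>torus N. (\<eta> x) powr \<alpha>))"
    by (simp only: mean_add mean_cmult mean_sum)
  also have "(\<Sum>x\<in>torus N. mean R g (gap x (translate N x z))) \<le> (\<Sum>x\<in>torus N. dirichlet R g x (translate N x z))"
    unfolding mean_def by (intro sum_mono dirichlet_ge_gap translate_in_torus N)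
  also have "\<dots> \<le> (real CARD('d) * real L)\<^sup>2 * total_dirichlet R g"
    by (rule dirichlet_translate_le[OF z])
  finally show ?thesis by simp
qed

text \<open>All displacements have coordinates below N, so the energy cost, the square of d N,
  matches the time scale of the generator. The moment \<open>s\<close> also occurs on the right,
  with coefficient 16 \<omega>; \<omega> \<le> 1/32 makes this at most 1/2, and \<open>s\<close>, a
  finite sum, can be absorbed.\<close>

lemma moment_le_energy:
  assumes \<omega>: "\<omega> \<ge> 0" "\<omega> \<le> 1 / 32"
      "\<And>u. u \<ge> 0 \<Longrightarrow> (u + c) powr (\<alpha> / 2) \<le> u powr (\<alpha> / 2) + \<omega> * (1 + u powr (\<alpha> / 2))"
    and K: "K > 0" and R: "R = K * real N ^ CARD('d)"
  shows "mean R g (\<lambda>\<eta>. \<Sum>x\<in>torus N. (\<eta> x) powr \<alpha>) \<le> (8 * (real CARD('d))\<^sup>2 + 1 + 8 * (2 * K) powr \<alpha>)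
      * ((real N)\<^sup>2 * total_dirichlet R g + real N ^ CARD('d) * mean R g (\<lambda>_. 1))"
proof -
  let ?n = "real N ^ CARD('d)" and ?p = "\<alpha> / 2"
  define D where "D = (real N)\<^sup>2 * total_dirichlet R g"
  define m where "m = ?n * mean R g (\<lambda>_. 1)"
  define s where "s = mean R g (\<lambda>\<eta>. \<Sum>x\<in>torus N. (\<eta> x) powr \<alpha>)"
  have n: "?n > 0" using N by simp
  have D0: "D \<ge> 0" unfolding D_def using total_dirichlet_nonneg by simp
  have m0: "m \<ge> 0" unfolding m_def by (intro mult_nonneg_nonneg mean_nonneg) auto
  have s0: "s \<ge> 0" unfolding s_def by (intro mean_nonneg sum_nonneg) auto
  have ne: "torus N \<noteq> ({} :: (real ^ 'd) set)" using card_torus[OF N, where 'd = 'd] N by auto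
  have "s \<le> mean R g (\<lambda>\<eta>. 4 / ?n * (\<Sum>z\<in>int_box {0..<int N}. \<Sum>x\<in>torus N. ((\<eta> x) powr ?p - (\<eta> (translate N x z)) powr ?p)\<^sup>2)
      + 4 * ?n * (2 * K) powr \<alpha> * 1)"
    unfolding s_def
  proof (rule mean_mono)
    fix \<eta> assume \<eta>: "\<eta> \<in> low_mass R"
    have "(\<Sum>x\<in>torus N. (\<eta> x powr ?p)\<^sup>2) \<le> 4 / card (torus N :: (real ^ 'd) set) *
        (\<Sum>x\<in>torus N. \<Sum>y\<in>torus N. (\<eta> x powr ?p - \<eta> y powr ?p)\<^sup>2)
      + 4 * card (torus N :: (real ^ 'd) set) * ((2 * K) powr ?p)\<^sup>2"
      using \<eta> R \<alpha> by (intro sum_powr_le_variation finite_S ne K low_nonneg[OF \<eta>])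
        (auto simp: low_mass_def card_torus[OF N])
    then show "(\<Sum>x\<in>torus N. (\<eta> x) powr \<alpha>) \<le>
      4 / ?n * (\<Sum>z\<in>int_box {0..<int N}. \<Sum>x\<in>torus N. ((\<eta> x) powr ?p - (\<eta> (translate N x z)) powr ?p)\<^sup>2)
      + 4 * ?n * (2 * K) powr \<alpha> * 1"
      unfolding sum_torus_pairs[OF N] card_torus[OF N] power2_eq_square[of "_ powr _"] powr_half_square by simp
  qed
  also have "\<dots> = 4 / ?n * (\<Sum>z\<in>int_box {0..<int N}. mean R g (\<lambda>\<eta>. \<Sum>x\<in>torus N. ((\<eta> x) powr ?p - (\<eta> (translate N x z)) powr ?p)\<^sup>2))
      + 4 * (2 * K) powr \<alpha> * m"
    unfolding mean_add mean_cmult mean_sum[where I = "int_box {0..<int N}"] m_def by simp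
  also have "(\<Sum>z\<in>int_box {0..<int N}. mean R g (\<lambda>\<eta>. \<Sum>x\<in>torus N. ((\<eta> x) powr ?p - (\<eta> (translate N x z)) powr ?p)\<^sup>2))
      \<le> (\<Sum>z\<in>(int_box {0..<int N} :: (int ^ 'd) set). (real CARD('d))\<^sup>2 * D + 2 * \<omega> * (m + 2 * s))"
  proof (rule sum_mono)
    fix z :: "int ^ 'd" assume "z \<in> int_box {0..<int N}"
    then have "\<bar>z $ i\<bar> \<le> int N" for i by (auto simp: int_box_def less_imp_le)
    from sum_gradient_le[OF \<omega>(1,3) this]
    show "mean R g (\<lambda>\<eta>. \<Sum>x\<in>torus N. ((\<eta> x) powr ?p - (\<eta> (translate N x z)) powr ?p)\<^sup>2)
      \<le> (real CARD('d))\<^sup>2 * D + 2 * \<omega> * (m + 2 * s)"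
      unfolding D_def m_def s_def by (simp add: power_mult_distrib mult.assoc)
  qed
  also have "\<dots> = ?n * ((real CARD('d))\<^sup>2 * D + 2 * \<omega> * (m + 2 * s))" by (simp add: card_int_box)
  finally have "s \<le> 4 / ?n * (?n * ((real CARD('d))\<^sup>2 * D + 2 * \<omega> * (m + 2 * s))) + 4 * (2 * K) powr \<alpha> * m"
    by (simp add: divide_right_mono)
  also have "4 / ?n * (?n * ((real CARD('d))\<^sup>2 * D + 2 * \<omega> * (m + 2 * s))) =
      4 * ((real CARD('d))\<^sup>2 * D) + 8 * (\<omega> * (m + 2 * s))" using n by simp
  also have "8 * (\<omega> * (m + 2 * s)) \<le> m / 4 + s / 2"
    using mult_right_mono[OF \<omega>(2), of "m + 2 * s"] m0 s0 by simp
  finally have *: "s \<le> 4 * ((real CARD('d))\<^sup>2 * D) + (m / 4 + s / 2) + 4 * ((2 * K) powr \<alpha> * m)"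
    by simp
  have "s \<le> 8 * p + 1 * m + 8 * q" if "s \<le> 4 * p + (m / 4 + s / 2) + 4 * q" for p q
    using that m0 by linarith
  from this[OF *] have "s \<le> 8 * ((real CARD('d))\<^sup>2 * D) + 1 * m + 8 * ((2 * K) powr \<alpha> * m)" .
  also have "\<dots> \<le> (8 * (real CARD('d))\<^sup>2 + 1 + 8 * (2 * K) powr \<alpha>) * (D + m)"
    using D0 m0 by (simp add: algebra_simps)
  finally show ?thesis unfolding s_def D_def m_def .
qed

text \<open>A difference of \<alpha>-th powers is the difference times the sum of \<alpha>/2-th
  powers. Young's inequality with parameter \<beta> separates a gradient, paid for by energy at
  distance L, from a small multiple of the moment.\<close>

lemma sum_V_le:
  fixes \<eta> :: "real ^ 'd \<Rightarrow> real"
  assumes \<alpha>1: "\<alpha> \<ge> 1" and L: "L = nat \<lfloor>\<epsilon> * real N\<rfloor>" "2 * L + 1 \<le> N" and \<beta>: "\<beta> > 0"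
    and \<eta>: "\<And>x. \<eta> x \<ge> 0"
  shows "(\<Sum>x\<in>torus N. V \<alpha> N \<eta> \<epsilon> x) \<le> \<alpha> / (2 * real L + 1) ^ CARD('d) *
    (\<Sum>z\<in>int_box {- int L..int L}. 1 / (2 * \<beta>) *
      (\<Sum>x\<in>torus N. ((\<eta> x) powr (\<alpha> / 2) - (\<eta> (translate N x z)) powr (\<alpha> / 2))\<^sup>2)
      + 2 * \<beta> * (\<Sum>x\<in>torus N. (\<eta> x) powr \<alpha>))"
proof -
  let ?I = "int_box {- int L..int L} :: (int ^ 'd) set" and ?n = "(2 * real L + 1) ^ CARD('d)"
  let ?v = "\<lambda>x. (\<eta> x) powr (\<alpha> / 2)"
  have "card {- int L..int L} = 2 * L + 1" by simp
  then have card: "real (card ?I) = ?n" by (simp add: card_int_box add.commute)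
  have I: "finite ?I" "?I \<noteq> {}" using card by (auto intro: finite_int_box)
  have diff: "\<bar>(\<eta> x) powr \<alpha> - (\<eta> y) powr \<alpha>\<bar> \<le> 1 / (2 * \<beta>) * (?v x - ?v y)\<^sup>2 + \<beta> * ((\<eta> x) powr \<alpha> + (\<eta> y) powr \<alpha>)" for x y
  proof -
    have "(\<eta> x) powr \<alpha> - (\<eta> y) powr \<alpha> = (?v x - ?v y) * (?v x + ?v y)"
      unfolding powr_half_square[symmetric] by (simp add: algebra_simps)
    then have "\<bar>(\<eta> x) powr \<alpha> - (\<eta> y) powr \<alpha>\<bar> = \<bar>?v x - ?v y\<bar> * (?v x + ?v y)" by (simp add: abs_mult)
    also have "\<dots> \<le> 1 / (2 * \<beta>) * (?v x - ?v y)\<^sup>2 + \<beta> / 2 * (?v x + ?v y)\<^sup>2"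
    proof -
      have "0 \<le> (\<bar>?v x - ?v y\<bar> - \<beta> * (?v x + ?v y))\<^sup>2 / (2 * \<beta>)" using \<beta> by simp
      also have "\<dots> = 1 / (2 * \<beta>) * (?v x - ?v y)\<^sup>2 + \<beta> / 2 * (?v x + ?v y)\<^sup>2 - \<bar>?v x - ?v y\<bar> * (?v x + ?v y)"
        unfolding power2_diff power2_abs power_mult_distrib using \<beta>
        by (simp add: diff_divide_distrib add_divide_distrib power2_eq_square)
      finally show ?thesis by simp
    qed
    also have "\<beta> / 2 * (?v x + ?v y)\<^sup>2 \<le> \<beta> * ((\<eta> x) powr \<alpha> + (\<eta> y) powr \<alpha>)"
    proof -
      have "(?v x + ?v y)\<^sup>2 \<le> 2 * (?v x * ?v x + ?v y * ?v y)"
        using zero_le_power2[of "?v x - ?v y"] by (simp add: power2_eq_square algebra_simps)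
      then have "\<beta> / 2 * (?v x + ?v y)\<^sup>2 \<le> \<beta> / 2 * (2 * ((\<eta> x) powr \<alpha> + (\<eta> y) powr \<alpha>))"
        unfolding powr_half_square using \<beta> by (intro mult_left_mono) auto
      then show ?thesis by (simp add: algebra_simps)
    qed
    finally show ?thesis by simp
  qed
  have "V \<alpha> N \<eta> \<epsilon> x \<le> \<alpha> / ?n * (\<Sum>z\<in>?I. \<bar>(\<eta> x) powr \<alpha> - (\<eta> (translate N x z)) powr \<alpha>\<bar>)" for x :: "real ^ 'd"
  proof -
    have "local_avg N \<epsilon> \<eta> x = (\<Sum>z\<in>?I. \<eta> (translate N x z)) / card ?I"
      unfolding local_avg_def L(1)[symmetric] Let_def sum_lattice_box[OF N L(2)] card by simp
    then show ?thesis
      unfolding V_def using abs_powr_diff_average_le[OF \<alpha>1 \<eta> \<eta> I, of x "\<lambda>z. translate N x z"] card by simp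
  qed
  then have "(\<Sum>x\<in>torus N. V \<alpha> N \<eta> \<epsilon> x) \<le>
      (\<Sum>x\<in>torus N. \<alpha> / ?n * (\<Sum>z\<in>?I. \<bar>(\<eta> x) powr \<alpha> - (\<eta> (translate N x z)) powr \<alpha>\<bar>))"
    by (intro sum_mono)
  also have "\<dots> = \<alpha> / ?n * (\<Sum>z\<in>?I. \<Sum>x\<in>torus N. \<bar>(\<eta> x) powr \<alpha> - (\<eta> (translate N x z)) powr \<alpha>\<bar>)"
    unfolding sum_distrib_left by (rule sum.swap)
  also have "\<dots> \<le> \<alpha> / ?n * (\<Sum>z\<in>?I. 1 / (2 * \<beta>) * (\<Sum>x\<in>torus N. (?v x - ?v (translate N x z))\<^sup>2)
      + 2 * \<beta> * (\<Sum>x\<in>torus N. (\<eta> x) powr \<alpha>))"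
  proof (intro mult_left_mono sum_mono)
    fix z
    have "(\<Sum>x\<in>torus N. \<bar>(\<eta> x) powr \<alpha> - (\<eta> (translate N x z)) powr \<alpha>\<bar>) \<le>
      (\<Sum>x\<in>torus N. 1 / (2 * \<beta>) * (?v x - ?v (translate N x z))\<^sup>2 + \<beta> * ((\<eta> x) powr \<alpha> + (\<eta> (translate N x z)) powr \<alpha>))"
      by (intro sum_mono diff)
    also have "\<dots> = 1 / (2 * \<beta>) * (\<Sum>x\<in>torus N. (?v x - ?v (translate N x z))\<^sup>2)
      + \<beta> * ((\<Sum>x\<in>torus N. (\<eta> x) powr \<alpha>) + (\<Sum>x\<in>torus N. (\<eta> (translate N x z)) powr \<alpha>))"
      by (simp only: sum.distrib sum_distrib_left[symmetric])
    also have "(\<Sum>x\<in>torus N. (\<eta> (translate N x z)) powr \<alpha>) = (\<Sum>x\<in>torus N. (\<eta> x) powr \<alpha>)"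
      by (rule sum_translate[OF N])
    finally show "(\<Sum>x\<in>torus N. \<bar>(\<eta> x) powr \<alpha> - (\<eta> (translate N x z)) powr \<alpha>\<bar>) \<le>
      1 / (2 * \<beta>) * (\<Sum>x\<in>torus N. (?v x - ?v (translate N x z))\<^sup>2) + 2 * \<beta> * (\<Sum>x\<in>torus N. (\<eta> x) powr \<alpha>)"
      by simp
  qed (use \<alpha>1 in simp)
  finally show ?thesis .
qed

text \<open>The generator supplies - D / (2 c). After the moment is replaced by C (D + m), the
  potential produces D three times, from the gradient, from the error \<omega> and from the moment,
  each with coefficient at most 1/6. The last two also produce m, each with coefficient at most
  \<kappa>/2.\<close>

lemma form_bound:
  assumes \<alpha>1: "\<alpha> \<ge> 1" and \<epsilon>: "\<epsilon> > 0" and L: "L = nat \<lfloor>\<epsilon> * real N\<rfloor>" "2 * L + 1 \<le> N" and \<beta>: "\<beta> > 0"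
    and \<omega>: "\<omega> \<ge> 0" "\<omega> \<le> 1 / 32"
      "\<And>u. u \<ge> 0 \<Longrightarrow> (u + c) powr (\<alpha> / 2) \<le> u powr (\<alpha> / 2) + \<omega> * (1 + u powr (\<alpha> / 2))"
    and K: "K > 0" and R: "R = K * real N ^ CARD('d)" and \<gamma>: "\<gamma> > 0"
  defines "C \<equiv> 8 * (real CARD('d))\<^sup>2 + 1 + 8 * (2 * K) powr \<alpha>"
  assumes small: "\<gamma> * \<alpha> * ((real CARD('d) * \<epsilon>)\<^sup>2 / (2 * \<beta>)) \<le> 1 / 6"
    "\<gamma> * \<alpha> * (\<omega> * (1 + 2 * C) / \<beta>) \<le> min (\<kappa> / 2) (1 / 6)" "\<gamma> * \<alpha> * (2 * \<beta> * C) \<le> min (\<kappa> / 2) (1 / 6)"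
  shows "(\<Sum>\<eta>\<in>low_mass R. weight \<eta> * g \<eta> * ((real N)\<^sup>2 * zrp_generator \<alpha> N c g \<eta>
      + \<gamma> / c * (\<Sum>x\<in>torus N. V \<alpha> N \<eta> \<epsilon> x) * g \<eta>))
    \<le> \<kappa> * real N ^ CARD('d) / c * (\<Sum>\<eta>\<in>low_mass R. weight \<eta> * (g \<eta>)\<^sup>2)"
proof -
  let ?d = "real CARD('d)" and ?n = "(2 * real L + 1) ^ CARD('d)"
  let ?I = "int_box {- int L..int L} :: (int ^ 'd) set"
  define D where "D = (real N)\<^sup>2 * total_dirichlet R g"
  define m where "m = real N ^ CARD('d) * mean R g (\<lambda>_. 1)"
  define s where "s = mean R g (\<lambda>\<eta>. \<Sum>x\<in>torus N. (\<eta> x) powr \<alpha>)"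
  have D0: "D \<ge> 0" unfolding D_def using total_dirichlet_nonneg by simp
  have m0: "m \<ge> 0" unfolding m_def by (intro mult_nonneg_nonneg mean_nonneg) auto
  have C0: "C \<ge> 0" unfolding C_def by simp
  have s: "s \<le> C * (D + m)" unfolding s_def D_def m_def C_def by (rule moment_le_energy[OF \<omega> K R])
  have n: "?n > 0" by simp
  have "card {- int L..int L} = 2 * L + 1" by simp
  then have card: "real (card ?I) = ?n" by (simp add: card_int_box add.commute)
  have "real L \<le> \<epsilon> * real N" unfolding L(1) using \<epsilon> by simp
  then have L2: "(real L)\<^sup>2 \<le> (\<epsilon> * real N)\<^sup>2" by (intro power_mono) auto
  define B where "B = (?d * \<epsilon>)\<^sup>2 * D + 2 * \<omega> * (m + 2 * s)"
  have grad: "mean R g (\<lambda>\<eta>. \<Sum>x\<in>torus N. ((\<eta> x) powr (\<alpha> / 2) - (\<eta> (translate N x z)) powr (\<alpha> / 2))\<^sup>2) \<le> B"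
    if z: "z \<in> ?I" for z
  proof -
    have "\<bar>z $ i\<bar> \<le> int L" for i using z by (auto simp: int_box_def abs_le_iff minus_le_iff)
    from sum_gradient_le[OF \<omega>(1,3) this]
    have "mean R g (\<lambda>\<eta>. \<Sum>x\<in>torus N. ((\<eta> x) powr (\<alpha> / 2) - (\<eta> (translate N x z)) powr (\<alpha> / 2))\<^sup>2)
      \<le> (?d * real L)\<^sup>2 * total_dirichlet R g + 2 * \<omega> * (m + 2 * s)" unfolding m_def s_def .
    also have "(?d * real L)\<^sup>2 * total_dirichlet R g \<le> (?d * \<epsilon>)\<^sup>2 * D"
    proof -
      have "(?d * real L)\<^sup>2 * total_dirichlet R g \<le> (?d\<^sup>2 * (\<epsilon> * real N)\<^sup>2) * total_dirichlet R g"
        unfolding power_mult_distrib[of ?d] using L2 total_dirichlet_nonneg by (intro mult_right_mono mult_left_mono) auto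
      then show ?thesis unfolding D_def power_mult_distrib by (simp only: mult_ac)
    qed
    finally show ?thesis unfolding B_def by simp
  qed
  have "mean R g (\<lambda>\<eta>. \<Sum>x\<in>torus N. V \<alpha> N \<eta> \<epsilon> x) \<le> mean R g (\<lambda>\<eta>. \<alpha> / ?n * (\<Sum>z\<in>?I. 1 / (2 * \<beta>) *
      (\<Sum>x\<in>torus N. ((\<eta> x) powr (\<alpha> / 2) - (\<eta> (translate N x z)) powr (\<alpha> / 2))\<^sup>2)
      + 2 * \<beta> * (\<Sum>x\<in>torus N. (\<eta> x) powr \<alpha>)))"
    by (intro mean_mono sum_V_le \<alpha>1 L \<beta> low_nonneg)
  also have "\<dots> = \<alpha> / ?n * (\<Sum>z\<in>?I. 1 / (2 * \<beta>) *
      mean R g (\<lambda>\<eta>. \<Sum>x\<in>torus N. ((\<eta> x) powr (\<alpha> / 2) - (\<eta> (translate N x z)) powr (\<alpha> / 2))\<^sup>2)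
      + 2 * \<beta> * s)"
    unfolding s_def by (simp only: mean_cmult mean_sum[where I = ?I] mean_add)
  also have "\<dots> \<le> \<alpha> / ?n * (\<Sum>z\<in>?I. 1 / (2 * \<beta>) * B + 2 * \<beta> * s)"
    using \<alpha>1 \<beta> by (intro mult_left_mono sum_mono add_right_mono grad) auto
  also have "\<dots> = \<alpha> * (B / (2 * \<beta>) + 2 * \<beta> * s)" using n card by simp
  finally have "mean R g (\<lambda>\<eta>. \<Sum>x\<in>torus N. V \<alpha> N \<eta> \<epsilon> x) \<le> \<alpha> * (B / (2 * \<beta>) + 2 * \<beta> * s)" .
  then have "\<gamma> * mean R g (\<lambda>\<eta>. \<Sum>x\<in>torus N. V \<alpha> N \<eta> \<epsilon> x) \<le> \<gamma> * (\<alpha> * (B / (2 * \<beta>) + 2 * \<beta> * s))"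
    using \<gamma> by (intro mult_left_mono) auto
  also have "\<dots> \<le> \<gamma> * (\<alpha> * (((?d * \<epsilon>)\<^sup>2 * D + 2 * \<omega> * ((1 + 2 * C) * (D + m))) / (2 * \<beta>) + 2 * \<beta> * (C * (D + m))))"
  proof -
    have "m + 2 * s \<le> (1 + 2 * C) * (D + m)" using s D0 by (simp add: algebra_simps)
    then have "B \<le> (?d * \<epsilon>)\<^sup>2 * D + 2 * \<omega> * ((1 + 2 * C) * (D + m))"
      unfolding B_def using \<omega>(1) by (intro add_left_mono mult_left_mono) auto
    then show ?thesis using \<gamma> \<alpha>1 \<beta> s by (intro mult_left_mono add_mono divide_right_mono) auto
  qed
  also have "\<dots> = \<gamma> * \<alpha> * ((?d * \<epsilon>)\<^sup>2 / (2 * \<beta>)) * D + \<gamma> * \<alpha> * (\<omega> * (1 + 2 * C) / \<beta>) * (D + m)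
      + \<gamma> * \<alpha> * (2 * \<beta> * C) * (D + m)"
  proof -
    have "\<gamma> * (\<alpha> * ((e * D + 2 * \<omega> * (k * X)) / (2 * \<beta>) + 2 * \<beta> * (C * X))) =
      \<gamma> * \<alpha> * (e / (2 * \<beta>)) * D + \<gamma> * \<alpha> * (\<omega> * k / \<beta>) * X + \<gamma> * \<alpha> * (2 * \<beta> * C) * X" for e k X
      using \<beta> by (simp add: field_simps)
    then show ?thesis .
  qed
  also have "\<dots> \<le> 1 / 6 * D + (1 / 6 * D + \<kappa> / 2 * m) + (1 / 6 * D + \<kappa> / 2 * m)"
  proof -
    have k: "q * (D + m) \<le> 1 / 6 * D + \<kappa> / 2 * m" if "q \<le> min (\<kappa> / 2) (1 / 6)" for q
      unfolding distrib_left using that D0 m0 by (intro add_mono mult_right_mono) auto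
    show ?thesis by (intro add_mono k small mult_right_mono[OF small(1)] D0)
  qed
  finally have main: "\<gamma> * mean R g (\<lambda>\<eta>. \<Sum>x\<in>torus N. V \<alpha> N \<eta> \<epsilon> x) - D / 2 \<le> \<kappa> * m" by simp
  have "(\<Sum>\<eta>\<in>low_mass R. weight \<eta> * g \<eta> * ((real N)\<^sup>2 * zrp_generator \<alpha> N c g \<eta>
      + \<gamma> / c * (\<Sum>x\<in>torus N. V \<alpha> N \<eta> \<epsilon> x) * g \<eta>)) =
    (real N)\<^sup>2 * (\<Sum>\<eta>\<in>low_mass R. weight \<eta> * g \<eta> * zrp_generator \<alpha> N c g \<eta>)
    + \<gamma> / c * mean R g (\<lambda>\<eta>. \<Sum>x\<in>torus N. V \<alpha> N \<eta> \<epsilon> x)"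
    unfolding mean_def sum_distrib_left[of _ _ "low_mass R"] sum.distrib[symmetric]
    by (intro sum.cong refl) (simp add: distrib_left power2_eq_square mult_ac)
  also have "\<dots> = (\<gamma> * mean R g (\<lambda>\<eta>. \<Sum>x\<in>torus N. V \<alpha> N \<eta> \<epsilon> x) - D / 2) / c"
    unfolding generator_quadratic_form D_def by (simp add: diff_divide_distrib)
  also have "\<dots> \<le> \<kappa> * m / c" using main c by (intro divide_right_mono) auto
  also have "\<dots> = \<kappa> * real N ^ CARD('d) / c * (\<Sum>\<eta>\<in>low_mass R. weight \<eta> * (g \<eta>)\<^sup>2)"
    by (simp add: m_def mean_def)
  finally show ?thesis .
qed

end

section \<open>The superexponential estimate\<close>

text \<open>Two regimes. If c \<le> k u, the occupation grows by a factor of at most 1 + k, and k is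
  chosen with \<open>(1 + k) powr p = 1 + \<omega>\<close>. Otherwise u + c \<le> c (1/k + 1), and
  \<open>c0\<close> makes the p-th power of this at most \<omega>.\<close>

lemma powr_modulus:
  fixes p \<omega> :: real
  assumes p: "p > 0" and \<omega>: "\<omega> > 0"
  shows "\<exists>c0>0. \<forall>c u. 0 < c \<longrightarrow> c \<le> c0 \<longrightarrow> 0 \<le> u \<longrightarrow> (u + c) powr p \<le> u powr p + \<omega> * (1 + u powr p)"
proof -
  define k where "k = (1 + \<omega>) powr (1 / p) - 1"
  have "1 powr (1 / p) < (1 + \<omega>) powr (1 / p)" using p \<omega> by (intro powr_less_mono2) auto
  then have k: "k > 0" by (simp add: k_def)
  have kp: "(1 + k) powr p = 1 + \<omega>" using p \<omega> by (simp add: k_def powr_powr)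
  define c0 where "c0 = \<omega> powr (1 / p) / (1 / k + 1)"
  have k1: "1 / k + 1 > 0" using k by (simp add: add_pos_pos)
  then have c0: "c0 > 0" using \<omega> by (simp add: c0_def)
  have "(u + c) powr p \<le> u powr p + \<omega> * (1 + u powr p)" if c: "0 < c" "c \<le> c0" and u: "0 \<le> u" for c u
  proof (cases "c \<le> k * u")
    case True
    have "(u + c) powr p \<le> ((1 + k) * u) powr p"
      using True c u p by (intro powr_mono2) (auto simp: algebra_simps)
    also have "\<dots> = (1 + \<omega>) * u powr p" using k u by (simp add: powr_mult kp)
    also have "\<dots> \<le> u powr p + \<omega> * (1 + u powr p)" using \<omega> by (simp add: algebra_simps)
    finally show ?thesis .
  next
    case False
    then have "u \<le> c * (1 / k)" using k by (simp add: field_simps)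
    then have "u + c \<le> c * (1 / k + 1)" by (simp add: algebra_simps)
    also have "\<dots> \<le> c0 * (1 / k + 1)" using c k1 by (intro mult_right_mono) auto
    also have "\<dots> = \<omega> powr (1 / p)" using k1 by (simp add: c0_def)
    finally have "(u + c) powr p \<le> (\<omega> powr (1 / p)) powr p" using c u p by (intro powr_mono2) auto
    also have "\<dots> = \<omega>" using p \<omega> by (simp add: powr_powr)
    also have "\<dots> \<le> u powr p + \<omega> * (1 + u powr p)" using \<omega> by (simp add: algebra_simps)
    finally show ?thesis .
  qed
  then show ?thesis using c0 by blast
qed

text \<open>Each term is the \<alpha>-th power of a term of the exponential series. Such a term is
  at most exp \<phi>, so its surplus power \<alpha> - 1 costs at most exp ((\<alpha> - 1)
  \<phi>).\<close>

lemma Z_norm_bounds: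
  assumes \<alpha>: "\<alpha> \<ge> 1" and \<phi>: "\<phi> > 0"
  shows "summable (\<lambda>n. \<phi> powr (\<alpha> * real n) / (fact n) powr \<alpha>)"
    and "1 \<le> Z_norm \<alpha> \<phi>" and "Z_norm \<alpha> \<phi> \<le> exp (\<alpha> * \<phi>)"
proof -
  let ?t = "\<lambda>n. \<phi> powr (\<alpha> * real n) / (fact n) powr \<alpha>"
  let ?s = "\<lambda>n. \<phi> ^ n / fact n"
  have t: "?t n = ?s n powr \<alpha>" for n
    using \<phi> by (simp add: powr_divide powr_powr mult.commute flip: powr_realpow)
  have sums: "?s sums exp \<phi>" using exp_converges[of \<phi>] by (simp add: divide_inverse mult.commute)
  have s0: "?s n > 0" for n using \<phi> by simp
  have s1: "?s n \<le> exp \<phi>" for n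
    using sum_le_suminf[OF sums_summable[OF sums], of "{n}"] s0 sums_unique[OF sums] by (simp add: less_imp_le)
  have le: "?t n \<le> exp ((\<alpha> - 1) * \<phi>) * ?s n" for n
  proof -
    have "u powr \<alpha> = u powr (\<alpha> - 1) * u" if "u > 0" for u :: real
      using that powr_add[of u "\<alpha> - 1" 1] by simp
    from this[OF s0[of n]] have "?s n powr \<alpha> = ?s n powr (\<alpha> - 1) * ?s n" .
    also have "\<dots> \<le> (exp \<phi>) powr (\<alpha> - 1) * ?s n"
      using s0[of n] s1[of n] \<alpha> by (intro mult_right_mono powr_mono2) (auto intro: less_imp_le)
    also have "(exp \<phi>) powr (\<alpha> - 1) = exp ((\<alpha> - 1) * \<phi>)" by (simp add: powr_def)
    finally show ?thesis unfolding t .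
  qed
  have bs: "(\<lambda>n. exp ((\<alpha> - 1) * \<phi>) * ?s n) sums (exp ((\<alpha> - 1) * \<phi>) * exp \<phi>)" by (rule sums_mult[OF sums])
  have t0: "0 \<le> ?t n" for n by simp
  show summ: "summable ?t"
    by (rule summable_comparison_test[OF _ sums_summable[OF bs]]) (use le t0 in auto)
  have "suminf ?t \<le> exp ((\<alpha> - 1) * \<phi>) * exp \<phi>"
    using suminf_le[OF le summ sums_summable[OF bs]] sums_unique[OF bs] by simp
  also have "\<dots> = exp (\<alpha> * \<phi>)" by (simp add: exp_add[symmetric] algebra_simps)
  finally show "Z_norm \<alpha> \<phi> \<le> exp (\<alpha> * \<phi>)" unfolding Z_norm_def .
  show "1 \<le> Z_norm \<alpha> \<phi>"
    unfolding Z_norm_def using sum_le_suminf[OF summ, of "{0}"] t0 \<phi> by simp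
qed

text \<open>Independence of the sites: normalised by s, f is a probability mass function on the
  multiples of c, and the product of these is a \<open>Pi_pmf\<close>, whose mass on the
  configurations is at most 1.\<close>

lemma nn_integral_prod_configs_le:
  fixes f :: "real \<Rightarrow> real" and c :: real
  assumes S: "finite S" and c: "c > 0" and f: "\<And>u. f u \<ge> 0" and sums: "(\<lambda>k::nat. f (c * real k)) sums s" and s: "s > 0"
  shows "(\<integral>\<^sup>+ \<eta>. ennreal (\<Prod>x\<in>S. f (\<eta> x)) \<partial>count_space (PiE_dflt S 0 (\<lambda>_. {c * real k | k :: nat. True}))) \<le> ennreal (s ^ card S)"
proof -
  let ?E = "PiE_dflt S 0 (\<lambda>_. {c * real k | k :: nat. True})"
  define q where "q = embed_pmf (\<lambda>k::nat. f (c * real k) / s)"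
  have "(\<lambda>k. f (c * real k) / s) sums 1" using sums_divide[OF sums, of s] s by simp
  then have "(\<integral>\<^sup>+ k. ennreal (f (c * real k) / s) \<partial>count_space UNIV) = 1"
    using f s by (simp add: nn_integral_count_space_nat suminf_ennreal2 sums_iff)
  then have q: "pmf q k = f (c * real k) / s" for k
    unfolding q_def using f s by (intro pmf_embed_pmf) auto
  define p where "p = Pi_pmf S 0 (\<lambda>_. map_pmf (\<lambda>k. c * real k) q)"
  have inj: "inj (\<lambda>k::nat. c * real k)" using c by (auto simp: inj_on_def)
  have eq: "(\<Prod>x\<in>S. f (\<eta> x)) = s ^ card S * pmf p \<eta>" if \<eta>: "\<eta> \<in> ?E" for \<eta>
  proof -
    have "pmf p \<eta> = (\<Prod>x\<in>S. pmf (map_pmf (\<lambda>k. c * real k) q) (\<eta> x))"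
      unfolding p_def using S \<eta> by (intro pmf_Pi') (auto simp: PiE_dflt_def)
    also have "\<dots> = (\<Prod>x\<in>S. f (\<eta> x) / s)"
    proof (intro prod.cong refl)
      fix x assume "x \<in> S"
      then obtain k :: nat where k: "\<eta> x = c * real k" using \<eta> by (auto simp: PiE_dflt_def)
      have "pmf (map_pmf (\<lambda>k. c * real k) q) (c * real k) = pmf q k" by (rule pmf_map_inj'[OF inj])
      then show "pmf (map_pmf (\<lambda>k. c * real k) q) (\<eta> x) = f (\<eta> x) / s" by (simp add: k q)
    qed
    finally show ?thesis using s by (simp add: prod_dividef)
  qed
  have "(\<integral>\<^sup>+ \<eta>. ennreal (\<Prod>x\<in>S. f (\<eta> x)) \<partial>count_space ?E) = (\<integral>\<^sup>+ \<eta>. ennreal (s ^ card S) * ennreal (pmf p \<eta>) \<partial>count_space ?E)"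
    using s by (intro nn_integral_cong) (simp add: eq ennreal_mult)
  also have "\<dots> = ennreal (s ^ card S) * (\<integral>\<^sup>+ \<eta>. ennreal (pmf p \<eta>) \<partial>count_space ?E)"
    by (rule nn_integral_cmult) simp
  also have "(\<integral>\<^sup>+ \<eta>. ennreal (pmf p \<eta>) \<partial>count_space ?E) = emeasure p ?E" by (rule nn_integral_pmf)
  also have "ennreal (s ^ card S) * emeasure p ?E \<le> ennreal (s ^ card S) * 1"
    by (intro mult_left_mono) (auto simp: measure_pmf.emeasure_le_1)
  finally show ?thesis by simp
qed

section \<open>The equilibrium measure and low-mass configurations\<close>

context zrp_torus
begin

lemma configs_eq: "config_space N c = configs"
  by (simp add: config_space_def configs_def)

lemma equilibrium_weight_eq: "Z = Z_norm \<alpha> (a / c) \<Longrightarrow> equilibrium_weight \<alpha> N c a \<eta> = weight \<eta>"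
  unfolding equilibrium_weight_def weight_def site_weight_def by simp

lemma measure_equilibrium_singleton:
  assumes "Z = Z_norm \<alpha> (a / c)" "\<eta> \<in> configs"
  shows "measure (equilibrium \<alpha> N c a) {\<eta>} = weight \<eta>"
proof -
  have "emeasure (equilibrium \<alpha> N c a) {\<eta>} = ennreal (weight \<eta>)"
    unfolding equilibrium_def configs_eq equilibrium_weight_eq[OF assms(1)] using assms(2)
    by (subst emeasure_density) (auto simp: nn_integral_indicator_singleton)
  then show ?thesis using weight_pos[of \<eta>] by (simp add: measure_def)
qed

text \<open>Exponential Chebyshev with one factor e per particle. The tilt replaces a by a exp
  (1/\<alpha>), since the (\<alpha> k)-th power of exp (1/\<alpha>) is exp k. The tilted partition
  function is bounded by \<open>Z_norm_bounds\<close>, and the original one is at least 1.\<close>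

lemma equilibrium_tail:
  assumes \<alpha>1: "\<alpha> \<ge> 1" and Zeq: "Z = Z_norm \<alpha> (a / c)"
  shows "measure (equilibrium \<alpha> N c a) (configs - low_mass R)
    \<le> exp (\<alpha> * a * exp (1 / \<alpha>) * real N ^ CARD('d) / c - R / c)"
proof -
  let ?b = "exp (1 / \<alpha>)" and ?E = "configs" and ?S = "torus N :: (real ^ 'd) set"
  define f where "f u = exp (u / c) * site_weight u" for u
  define s where "s = Z_norm \<alpha> (a / c * ?b) / Z"
  have f0: "f u \<ge> 0" for u unfolding f_def site_weight_def using Z by simp
  have \<phi>: "a / c > 0" "a / c * ?b > 0" using a c by auto
  have fk: "f (c * real k) = (a / c * ?b) powr (\<alpha> * real k) / (fact k) powr \<alpha> / Z" for k
  proof -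
    have "(a / c * ?b) powr (\<alpha> * real k) = (a / c) powr (\<alpha> * real k) * exp (real k)"
    proof -
      have "?b powr (\<alpha> * real k) = exp (real k)" using \<alpha> by (simp add: powr_def)
      then show ?thesis using \<phi>(1) by (subst powr_mult) auto
    qed
    moreover have "\<alpha> * (c * real k) / c = \<alpha> * real k" "c * real k / c = real k" using c by simp_all
    moreover have "nat \<lfloor>real k\<rfloor> = k" by simp
    ultimately show ?thesis unfolding f_def site_weight_def by simp
  qed
  have sums: "(\<lambda>k. f (c * real k)) sums s"
    unfolding fk s_def Z_norm_def
    by (intro sums_divide summable_sums Z_norm_bounds(1)[OF \<alpha>1 \<phi>(2)])
  have Z1: "Z \<ge> 1" unfolding Zeq by (rule Z_norm_bounds(2)[OF \<alpha>1 \<phi>(1)])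
  have s: "s > 0" unfolding s_def using Z Z_norm_bounds(2)[OF \<alpha>1 \<phi>(2)] by simp
  have "s \<le> Z_norm \<alpha> (a / c * ?b) / 1"
    unfolding s_def using Z1 Z_norm_bounds(2)[OF \<alpha>1 \<phi>(2)] by (intro divide_left_mono) auto
  also have "\<dots> \<le> exp (\<alpha> * (a / c * ?b))" using Z_norm_bounds(3)[OF \<alpha>1 \<phi>(2)] by simp
  finally have s_le: "s \<le> exp (\<alpha> * (a / c * ?b))" .
  have "emeasure (equilibrium \<alpha> N c a) (?E - low_mass R) =
    (\<integral>\<^sup>+ \<eta>. ennreal (weight \<eta>) * indicator (?E - low_mass R) \<eta> \<partial>count_space ?E)"
    unfolding equilibrium_def configs_eq
    by (subst emeasure_density) (auto simp: equilibrium_weight_eq[OF Zeq])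
  also have "\<dots> \<le> (\<integral>\<^sup>+ \<eta>. ennreal (exp (- R / c)) * ennreal (\<Prod>x\<in>?S. f (\<eta> x)) \<partial>count_space ?E)"
  proof (rule nn_integral_mono)
    fix \<eta> assume "\<eta> \<in> space (count_space ?E)"
    then have \<eta>: "\<eta> \<in> ?E" by simp
    have prod: "(\<Prod>x\<in>?S. f (\<eta> x)) = exp ((\<Sum>x\<in>?S. \<eta> x) / c) * weight \<eta>"
      unfolding f_def weight_def prod.distrib by (simp add: exp_sum finite_S sum_divide_distrib)
    show "ennreal (weight \<eta>) * indicator (?E - low_mass R) \<eta> \<le> ennreal (exp (- R / c)) * ennreal (\<Prod>x\<in>?S. f (\<eta> x))"
    proof (cases "\<eta> \<in> low_mass R")
      case False
      then have "R < (\<Sum>x\<in>?S. \<eta> x)" using \<eta> by (simp add: low_mass_def)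
      then have "0 \<le> - R / c + (\<Sum>x\<in>?S. \<eta> x) / c" using c by (simp add: divide_right_mono)
      then have "1 \<le> exp (- R / c) * exp ((\<Sum>x\<in>?S. \<eta> x) / c)" by (simp add: exp_add[symmetric] del: minus_divide_left)
      then have "1 * weight \<eta> \<le> exp (- R / c) * exp ((\<Sum>x\<in>?S. \<eta> x) / c) * weight \<eta>"
        using weight_pos[of \<eta>] by (intro mult_right_mono) auto
      then have "ennreal (weight \<eta>) \<le> ennreal (exp (- R / c) * (\<Prod>x\<in>?S. f (\<eta> x)))"
        unfolding prod by (intro ennreal_leI) (simp add: mult.assoc)
      then show ?thesis using False \<eta> f0 by (simp add: ennreal_mult prod_nonneg)
    qed simp
  qed
  also have "\<dots> = ennreal (exp (- R / c)) * (\<integral>\<^sup>+ \<eta>. ennreal (\<Prod>x\<in>?S. f (\<eta> x)) \<partial>count_space ?E)"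
    by (rule nn_integral_cmult) simp
  also have "\<dots> \<le> ennreal (exp (- R / c)) * ennreal (s ^ card ?S)"
    unfolding configs_def by (intro mult_left_mono nn_integral_prod_configs_le finite_S c f0 sums s) simp
  also have "\<dots> = ennreal (exp (- R / c) * s ^ card ?S)" using s by (simp add: ennreal_mult)
  also have "\<dots> \<le> ennreal (exp (- R / c) * exp (\<alpha> * (a / c * ?b)) ^ card ?S)"
    using s s_le by (intro ennreal_leI mult_left_mono power_mono) auto
  also have "exp (- R / c) * exp (\<alpha> * (a / c * ?b)) ^ card ?S = exp (\<alpha> * a * ?b * real N ^ CARD('d) / c - R / c)"
    by (simp add: exp_add[symmetric] exp_of_nat_mult[symmetric] card_torus[OF N] algebra_simps)
  finally show ?thesis by (simp add: measure_def enn2real_leI)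
qed

text \<open>A jump from an occupied site keeps the remaining configuration \<zeta>, hence the mass;
  from an empty site the rate is 0.\<close>

lemma generator_indicator_low:
  assumes \<eta>: "\<eta> \<in> low_mass R"
  shows "zrp_generator \<alpha> N c (indicator (low_mass R)) \<eta> = 0"
proof -
  have "(\<eta> x) powr \<alpha> / c * (indicator (low_mass R) (jump c \<eta> x y) - indicator (low_mass R) \<eta>) = (0::real)"
    if x: "x \<in> torus N" and y: "y \<in> torus N" for x y
  proof (cases "\<eta> x = 0")
    case False
    then have "\<eta> \<in> add x ` low_mass (R - c)" using bij_betw_add[OF x, of R] \<eta> by (auto simp: bij_betw_def)
    then obtain \<zeta> where \<zeta>: "\<zeta> \<in> low_mass (R - c)" "\<eta> = add x \<zeta>" by blast
    have "jump c \<eta> x y = add y \<zeta>" unfolding jump_def \<zeta>(2) by (simp add: add_def fun_eq_iff)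
    also have "\<dots> \<in> low_mass R" using bij_betw_add[OF y, of R] \<zeta>(1) by (auto simp: bij_betw_def)
    finally show ?thesis using \<eta> by simp
  qed simp
  moreover have "wrap (x + (\<sigma> / real N) *\<^sub>R axis i 1) \<in> torus N" if "x \<in> torus N" "\<sigma> \<in> {1, -1}" for x :: "real ^ 'd" and \<sigma> i
    using that translate_in_torus[OF N that(1)] neighbour_eq_translate[of x N i] by auto
  ultimately show ?thesis unfolding zrp_generator_def by (simp add: sum.neutral)
qed

end

text \<open>The exponential bound with \<gamma> scaled by \<open>real N ^ CARD('d) / c\<close> and
  the mass bounded by K per site, so that both exponents carry this speed. The conditions
  \<open>small\<close> do not involve N, and involve \<open>c\<close> only through \<omega>.\<close>

lemma replacement_bound:
  fixes \<eta> :: "real \<Rightarrow> 'w \<Rightarrow> (real ^ 'd \<Rightarrow> real)"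
  assumes \<alpha>1: "\<alpha> \<ge> 1" and N: "N \<ge> 1" and c: "c > 0" and a: "a > 0" and T: "T > 0"
    and zrp: "equilibrium_zrp \<alpha> N c a M \<eta>"
    and \<epsilon>: "\<epsilon> > 0" and L: "2 * nat \<lfloor>\<epsilon> * real N\<rfloor> + 1 \<le> N" and \<beta>: "\<beta> > 0"
    and \<omega>: "\<omega> \<ge> 0" "\<omega> \<le> 1 / 32"
      "\<And>u. u \<ge> 0 \<Longrightarrow> (u + c) powr (\<alpha> / 2) \<le> u powr (\<alpha> / 2) + \<omega> * (1 + u powr (\<alpha> / 2))"
    and K: "K > 0" and \<gamma>: "\<gamma> > 0"
  defines "C \<equiv> 8 * (real CARD('d))\<^sup>2 + 1 + 8 * (2 * K) powr \<alpha>"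
  assumes small: "\<gamma> * \<alpha> * ((real CARD('d) * \<epsilon>)\<^sup>2 / (2 * \<beta>)) \<le> 1 / 6"
    "\<gamma> * \<alpha> * (\<omega> * (1 + 2 * C) / \<beta>) \<le> min (\<kappa> / 2) (1 / 6)" "\<gamma> * \<alpha> * (2 * \<beta> * C) \<le> min (\<kappa> / 2) (1 / 6)"
  shows "measure M {\<omega>\<in>space M. (LINT t:{0..T}|lborel. 1 / real N ^ CARD('d) * (\<Sum>x\<in>torus N. V \<alpha> N (\<eta> t \<omega>) \<epsilon> x)) > \<delta>}
    \<le> exp ((\<alpha> * a * exp (1 / \<alpha>) - K) * (real N ^ CARD('d) / c)) + exp ((T * \<kappa> - \<gamma> * \<delta>) * (real N ^ CARD('d) / c))"
proof -
  let ?n = "real N ^ CARD('d)"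
  define Z where "Z = Z_norm \<alpha> (a / c)"
  have "Z > 0" unfolding Z_def using Z_norm_bounds(2)[OF \<alpha>1, of "a / c"] a c by simp
  then interpret zrp_torus N \<alpha> c a Z
    by unfold_locales (use \<alpha>1 N c a in \<open>auto intro: finite_torus\<close>)
  have n: "?n > 0" using N by simp
  let ?A = "low_mass (K * ?n) :: (real ^ 'd \<Rightarrow> real) set"
  let ?\<mu> = "equilibrium \<alpha> N c a :: (real ^ 'd \<Rightarrow> real) measure"
  have A: "?A \<subseteq> config_space N c" unfolding configs_eq by (auto simp: low_mass_def)
  have single: "measure ?\<mu> {\<xi>} = weight \<xi>" if "\<xi> \<in> ?A" for \<xi>
    using that A by (intro measure_equilibrium_singleton Z_def) (auto simp: configs_eq)
  have "measure M {\<omega>\<in>space M. (LINT t:{0..T}|lborel. 1 / ?n * (\<Sum>x\<in>torus N. V \<alpha> N (\<eta> t \<omega>) \<epsilon> x)) > \<delta>}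
    \<le> measure ?\<mu> (config_space N c - ?A) + exp (T * (\<kappa> * ?n / c) - (\<gamma> * ?n / c) * \<delta>)"
  proof (rule markov_exponential_chebyshev[OF zrp[unfolded equilibrium_zrp_def] finite_low A])
    show "measure ?\<mu> {\<xi>} > 0" if "\<xi> \<in> ?A" for \<xi> using single[OF that] weight_pos by simp
    show "(real N)\<^sup>2 * zrp_generator \<alpha> N c (indicator ?A) \<xi> = 0" if "\<xi> \<in> ?A" for \<xi>
      by (simp add: generator_indicator_low[OF that])
    show "\<gamma> * ?n / c > 0" using \<gamma> n c by simp
    fix g :: "(real ^ 'd \<Rightarrow> real) \<Rightarrow> real"
    have "(\<Sum>\<xi>\<in>?A. measure ?\<mu> {\<xi>} * g \<xi> * ((real N)\<^sup>2 * zrp_generator \<alpha> N c g \<xi>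
        + \<gamma> * ?n / c * (1 / ?n * (\<Sum>x\<in>torus N. V \<alpha> N \<xi> \<epsilon> x)) * g \<xi>)) =
      (\<Sum>\<xi>\<in>?A. weight \<xi> * g \<xi> * ((real N)\<^sup>2 * zrp_generator \<alpha> N c g \<xi>
        + \<gamma> / c * (\<Sum>x\<in>torus N. V \<alpha> N \<xi> \<epsilon> x) * g \<xi>))"
      using n by (intro sum.cong refl) (simp add: single)
    also have "\<dots> \<le> \<kappa> * ?n / c * (\<Sum>\<xi>\<in>?A. weight \<xi> * (g \<xi>)\<^sup>2)"
      by (rule form_bound[OF \<alpha>1 \<epsilon> refl L \<beta> \<omega> K refl \<gamma> small[unfolded C_def]])
    also have "\<dots> = \<kappa> * ?n / c * (\<Sum>\<xi>\<in>?A. measure ?\<mu> {\<xi>} * (g \<xi>)\<^sup>2)" by (simp add: single)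
    finally show "(\<Sum>\<xi>\<in>?A. measure ?\<mu> {\<xi>} * g \<xi> * ((real N)\<^sup>2 * zrp_generator \<alpha> N c g \<xi>
        + \<gamma> * ?n / c * (1 / ?n * (\<Sum>x\<in>torus N. V \<alpha> N \<xi> \<epsilon> x)) * g \<xi>))
      \<le> \<kappa> * ?n / c * (\<Sum>\<xi>\<in>?A. measure ?\<mu> {\<xi>} * (g \<xi>)\<^sup>2)" .
  qed (rule T)
  also have "measure ?\<mu> (config_space N c - ?A) \<le> exp (\<alpha> * a * exp (1 / \<alpha>) * ?n / c - K * ?n / c)"
    unfolding configs_eq by (rule equilibrium_tail[OF \<alpha>1 Z_def])
  also have "\<alpha> * a * exp (1 / \<alpha>) * ?n / c - K * ?n / c = (\<alpha> * a * exp (1 / \<alpha>) - K) * (?n / c)"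
    by (simp add: left_diff_distrib diff_divide_distrib)
  also have "T * (\<kappa> * ?n / c) - (\<gamma> * ?n / c) * \<delta> = (T * \<kappa> - \<gamma> * \<delta>) * (?n / c)"
    by (simp add: algebra_simps diff_divide_distrib)
  finally show ?thesis by simp
qed

section \<open>Choice of the parameters and passage to the limit\<close>

lemma ext_ln_bound:
  assumes p: "p \<le> 2 * exp (- r * n / c)" and n: "n \<ge> 1" and c: "0 < c" "c \<le> 1"
  shows "ereal (c / n) * ext_ln p \<le> ereal (1 - r)"
proof (cases "p \<le> 0")
  case True
  then show ?thesis using n c by (simp add: ext_ln_def)
next
  case False
  then have "ln p \<le> ln (2 * exp (- r * n / c))" using p by (intro ln_mono) auto
  also have "\<dots> = ln 2 - r * n / c" by (simp add: ln_mult)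
  finally have "c / n * ln p \<le> c / n * (ln 2 - r * n / c)" using n c by (intro mult_left_mono) auto
  also have "\<dots> = c / n * ln 2 - r" using n c by (simp add: field_simps)
  \<comment> \<open>The factor 2, from adding two exponentials, costs at most 1 because c \<le> 1
    \<le> n and ln 2 \<le> 1.\<close>
  also have "c / n * ln 2 \<le> 1 * 1"
    using n c ln_le_minus_one[of "2 :: real"] by (intro mult_mono) (auto simp: divide_le_eq)
  finally show ?thesis using False by (simp add: ext_ln_def)
qed

theorem theorem2:
  fixes \<alpha> t_fin a \<delta> :: real
    and chi :: "nat \<Rightarrow> real"
    and M :: "nat \<Rightarrow> 'w measure"
    and \<eta> :: "nat \<Rightarrow> real \<Rightarrow> 'w \<Rightarrow> (real ^ 'd \<Rightarrow> real)"
  assumes "\<alpha> \<ge> 1" and "t_fin > 0" and "a > 0"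
    and "\<And>N. N \<ge> 1 \<Longrightarrow> chi N > 0" and "chi \<longlonglongrightarrow> 0"
    and "\<And>N. N \<ge> 1 \<Longrightarrow> equilibrium_zrp \<alpha> N (chi N) a (M N) (\<eta> N)"
    and "\<delta> > 0"
  shows "Limsup (at_right 0) (\<lambda>\<epsilon>. limsup (\<lambda>N.
           ereal (chi N / real N ^ CARD('d)) *
           ext_ln (measure (M N) {\<omega> \<in> space (M N).
             (LINT t:{0..t_fin}|lborel.
                1 / real N ^ CARD('d) * (\<Sum>x\<in>torus N. V \<alpha> N (\<eta> N t \<omega>) \<epsilon> x)) > \<delta>})))
         = -\<infinity>"
proof -
  let ?p = "\<lambda>\<epsilon> N. measure (M N) {\<omega> \<in> space (M N). (LINT t:{0..t_fin}|lborel.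
      1 / real N ^ CARD('d) * (\<Sum>x\<in>torus N. V \<alpha> N (\<eta> N t \<omega>) \<epsilon> x)) > \<delta>}"
  let ?L = "Limsup (at_right 0) (\<lambda>\<epsilon>. limsup (\<lambda>N. ereal (chi N / real N ^ CARD('d)) * ext_ln (?p \<epsilon> N)))"
  have "?L \<le> ereal (1 - r)" if r: "r > 0" for r
  proof -
    \<comment> \<open>K turns the tail exponent into -r, and \<gamma> with \<kappa> gives t_fin
      \<kappa> - \<gamma> \<delta> = 1 - (r + 1) = -r. Then \<beta> is fixed by the condition on the
      moment and \<omega> by that on the error; all are chosen before \<epsilon>, so the remaining
      condition holds for small \<epsilon>.\<close>
    define K where "K = r + \<alpha> * a * exp (1 / \<alpha>)"
    define \<gamma> where "\<gamma> = (r + 1) / \<delta>"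
    define \<kappa> where "\<kappa> = 1 / t_fin"
    define C where "C = 8 * (real CARD('d))\<^sup>2 + 1 + 8 * (2 * K) powr \<alpha>"
    define k where "k = min (\<kappa> / 2) (1 / 6)"
    define \<beta> where "\<beta> = k / (2 * (\<gamma> * \<alpha> * C))"
    define \<omega> where "\<omega> = min (1 / 32) (k * \<beta> / (\<gamma> * \<alpha> * (1 + 2 * C)))"
    have K: "K > 0" unfolding K_def using r assms(1,3) by (intro add_pos_pos mult_pos_pos) auto
    have \<gamma>: "\<gamma> > 0" unfolding \<gamma>_def using r assms(7) by simp
    have C: "C > 0" unfolding C_def by (intro add_pos_nonneg add_nonneg_pos) auto
    have k: "k > 0" unfolding k_def \<kappa>_def using assms(2) by simp
    have \<alpha>0: "\<alpha> > 0" using assms(1) by simp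
    have \<beta>: "\<beta> > 0" unfolding \<beta>_def using k \<gamma> \<alpha>0 C by simp
    have \<omega>: "\<omega> > 0" unfolding \<omega>_def using k \<beta> \<gamma> \<alpha>0 C by (simp add: add_pos_pos)
    have small2: "\<gamma> * \<alpha> * (\<omega> * (1 + 2 * C) / \<beta>) \<le> k"
    proof -
      have q: "\<gamma> * \<alpha> * (1 + 2 * C) > 0" using \<gamma> \<alpha>0 C by (simp add: add_pos_pos)
      have "\<omega> \<le> k * \<beta> / (\<gamma> * \<alpha> * (1 + 2 * C))" unfolding \<omega>_def by simp
      then have "\<omega> * (\<gamma> * \<alpha> * (1 + 2 * C)) \<le> k * \<beta>" using q by (simp add: pos_le_divide_eq)
      then show ?thesis using \<beta> by (simp add: field_simps)
    qed
    have small3: "\<gamma> * \<alpha> * (2 * \<beta> * C) \<le> k"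
      unfolding \<beta>_def using \<gamma> \<alpha>0 C by simp
    obtain c0 where c0: "c0 > 0" "\<And>c u. 0 < c \<Longrightarrow> c \<le> c0 \<Longrightarrow> 0 \<le> u \<Longrightarrow>
        (u + c) powr (\<alpha> / 2) \<le> u powr (\<alpha> / 2) + \<omega> * (1 + u powr (\<alpha> / 2))"
      using powr_modulus[of "\<alpha> / 2" \<omega>] \<alpha>0 \<omega> by auto
    have "((\<lambda>\<epsilon>. \<gamma> * \<alpha> * ((real CARD('d) * \<epsilon>)\<^sup>2 / (2 * \<beta>))) \<longlongrightarrow> \<gamma> * \<alpha> * ((real CARD('d) * 0)\<^sup>2 / (2 * \<beta>))) (at_right 0)"
      using \<beta> by (intro tendsto_intros) auto
    then have "\<forall>\<^sub>F \<epsilon> in at_right 0. \<gamma> * \<alpha> * ((real CARD('d) * \<epsilon>)\<^sup>2 / (2 * \<beta>)) < 1 / 6"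
      by (rule order_tendstoD) simp
    \<comment> \<open>With \<epsilon> < 1/4 and N \<ge> 2 the side length of a box is at most N/2 +
      1 \<le> N, so boxes do not wrap around.\<close>
    moreover have "\<forall>\<^sub>F \<epsilon> in at_right 0. \<epsilon> \<in> {0<..<1 / 4 :: real}" by (intro eventually_at_right_real) simp
    ultimately have "\<forall>\<^sub>F \<epsilon> in at_right 0. limsup (\<lambda>N. ereal (chi N / real N ^ CARD('d)) * ext_ln (?p \<epsilon> N)) \<le> ereal (1 - r)"
    proof eventually_elim
      case (elim \<epsilon>)
      \<comment> \<open>Below \<open>c0\<close> the modulus \<omega> is available; the bound 1 is
        for \<open>ext_ln_bound\<close>. Neither depends on \<epsilon>.\<close>
      have "\<forall>\<^sub>F N in sequentially. chi N < min c0 1" using c0(1) by (intro order_tendstoD[OF assms(5)]) simp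
      then have "\<forall>\<^sub>F N in sequentially. ereal (chi N / real N ^ CARD('d)) * ext_ln (?p \<epsilon> N) \<le> ereal (1 - r)"
        using eventually_ge_at_top[of 2]
      proof eventually_elim
        case (elim N)
        have N: "N \<ge> 1" using elim by simp
        have c: "chi N > 0" by (rule assms(4)[OF N])
        have L: "2 * nat \<lfloor>\<epsilon> * real N\<rfloor> + 1 \<le> N"
        proof -
          have "real (nat \<lfloor>\<epsilon> * real N\<rfloor>) \<le> \<epsilon> * real N" using \<open>\<epsilon> \<in> _\<close> by simp
          also have "\<dots> \<le> 1 / 4 * real N" using \<open>\<epsilon> \<in> _\<close> by (intro mult_right_mono) auto
          finally have "real (2 * nat \<lfloor>\<epsilon> * real N\<rfloor> + 1) \<le> real N" using elim by simp
          then show ?thesis by (simp only: of_nat_le_iff)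
        qed
        let ?e = "exp (- r * real N ^ CARD('d) / chi N)"
        have "?p \<epsilon> N \<le> exp ((\<alpha> * a * exp (1 / \<alpha>) - K) * (real N ^ CARD('d) / chi N))
            + exp ((t_fin * \<kappa> - \<gamma> * \<delta>) * (real N ^ CARD('d) / chi N))"
        proof (rule replacement_bound[OF assms(1) N c assms(3,2) assms(6)[OF N] _ L \<beta> _ _ _ K \<gamma>])
          show "\<omega> \<le> 1 / 32" unfolding \<omega>_def by (rule min.cobounded1)
          show "(u + chi N) powr (\<alpha> / 2) \<le> u powr (\<alpha> / 2) + \<omega> * (1 + u powr (\<alpha> / 2))" if "u \<ge> 0" for u
            using c0(2)[OF c _ that] elim by simp
          show "\<gamma> * \<alpha> * (\<omega> * (1 + 2 * (8 * (real CARD('d))\<^sup>2 + 1 + 8 * (2 * K) powr \<alpha>)) / \<beta>) \<le> min (\<kappa> / 2) (1 / 6)"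
            using small2 unfolding C_def k_def .
          show "\<gamma> * \<alpha> * (2 * \<beta> * (8 * (real CARD('d))\<^sup>2 + 1 + 8 * (2 * K) powr \<alpha>)) \<le> min (\<kappa> / 2) (1 / 6)"
            using small3 unfolding C_def k_def .
        qed (use \<omega> \<open>\<epsilon> \<in> _\<close> \<open>_ < 1 / 6\<close> in auto)
        also have "(\<alpha> * a * exp (1 / \<alpha>) - K) * (real N ^ CARD('d) / chi N) = - r * real N ^ CARD('d) / chi N"
          by (simp add: K_def)
        also have "(t_fin * \<kappa> - \<gamma> * \<delta>) * (real N ^ CARD('d) / chi N) = - r * real N ^ CARD('d) / chi N"
          using assms(2,7) by (simp add: \<kappa>_def \<gamma>_def)
        finally have "?p \<epsilon> N \<le> 2 * ?e" by simp
        then show ?case using N c elim by (intro ext_ln_bound) auto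
      qed
      then show ?case by (rule Limsup_bounded)
    qed
    then show ?thesis by (rule Limsup_bounded)
  qed
  note bound = this
  have "?L \<le> ereal x" for x
  proof -
    \<comment> \<open>This choice of r is positive and satisfies 1 - r \<le> x.\<close>
    have "?L \<le> ereal (1 - max 1 (1 - x))" by (rule bound) simp
    also have "\<dots> \<le> ereal x" by simp
    finally show ?thesis .
  qed
  then show ?thesis by (rule ereal_bot)
qed

end
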